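(* Let $0<\tau<\infty$ and let $l:[0,\tau]\to(a,b)$ be continuously differentiable with $\dot l\in\mathcal C([0,\tau],\mathbb R)$. Assume: (1) $\mathcal Q^\pm\in\mathcal C^1([a,b],\mathbb R^{2\times2})$ are diagonal, $\mathcal Q^\pm(z)=\begin{bmatrix}Q_{11}^\pm(z)&0\\0&Q_{22}^\pm(z)\end{bmatrix}$, and satisfy $\frac{Q_{11}^+}{Q_{11}^-}(0)=1$ and $\frac{Q_{11}^+}{Q_{11}^-}(z)=\frac{Q_{22}^+}{Q_{22}^-}(z)$ for all $z\in[a,b]$; (2) $r>0$, $W_B\in\mathbb R^{2\times 4}$, $\operatorname{rank}(W_B)=2$ and $W_B\Sigma W_B^\top>0$. Let $k>0$ be chosen such that $\langle A_{\mathcal Q_0}x_0,x_0\rangle_{\mathcal Q_0}\le-k\left(\|(\mathcal Q_0x_0)(a)\|_2^2+\|(\mathcal Q_0x_0)(b)\|_2^2\right)$ for all $x_0\in D(A_{\mathcal Q_0})$. Then the family $(A(t))_{t\in[0,\tau]}$ of port-Hamiltonian operators $A(t)=A_{\mathcal Q_{l(t)}}$ is stable on $(X,\|\cdot\|_{\mathcal Q_0})$ if the following two assertions hold: (i) There exists $\tilde\omega^->0$ such that for all $t\in[0,\tau]$ with $a<l(t)<0$ and all $x\in D(A(t))$, $$-k\left(\|(\mathcal Q^-x)(a)\|_2^2+\|(\mathcal Q^+x)(b)\|_2^2\right)+\frac r4\Big[(\eta^-(t)-1)\|\mathcal Q^-(l(t))x(l(t)^-)\|_2^2+(1-\eta^-(t))\|\mathcal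 Q^+(l(t))x(l(t)^+)\|_2^2\Big]\le\tilde\omega^-\|\mathcal Q_{l(t)}x\|_{L^2}^2,$$ where $\eta^-(t)=\frac12\left(\frac{Q_{11}^-}{Q_{11}^+}(l(t))+\frac{Q_{22}^-}{Q_{22}^+}(l(t))\right)$. (ii) There exists $\tilde\omega^+>0$ such that for all $t\in[0,\tau]$ with $0<l(t)<b$ and all $x\in D(A(t))$, $$-k\left(\|(\mathcal Q^-x)(a)\|_2^2+\|(\mathcal Q^+x)(b)\|_2^2\right)+\frac r4\Big[(1-\eta^+(t))\|\mathcal Q^-(l(t))x(l(t)^-)\|_2^2+(\eta^+(t)-1)\|\mathcal Q^+(l(t))x(l(t)^+)\|_2^2\Big]\le\tilde\omega^+\|\mathcal Q_{l(t)}x\|_{L^2}^2,$$ where $\eta^+(t)=\frac12\left(\frac{Q_{11}^+}{Q_{11}^-}(l(t))+\frac{Q_{22}^+}{Q_{22}^-}(l(t))\right)$.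
   Context: Let $a<0<b$ and $X=L^2([a,b],\mathbb R^2)$. $\mathcal Q^\pm$ are symmetric $2\times2$-matrix-valued functions on $[a,b]$ with $mI\le\mathcal Q^\pm(z)\le MI$ for constants $0<m\le M$. For $l\in(a,b)$ put $c_l=\mathbf 1_{[a,l)}$, $\overline c_l=\mathbf 1_{(l,b]}$, and $\mathcal Q_l=c_l\mathcal Q^-+\overline c_l\mathcal Q^+\in\mathcal L(X)$ (a coercive multiplication operator). $\langle x,y\rangle_{\mathcal Q_l}=\frac12\int_a^by^\top(z)\mathcal Q_l(z)x(z)\,dz$, with norm $\|\cdot\|_{\mathcal Q_l}$; $\mathcal Q_0$ is the case $l=0$. $\|\cdot\|_{L^2}$ is the standard norm of $X$, $\|\cdot\|_2$ the Euclidean norm. For $l\in(a,b)$ the operator $\mathcal J_l$ on $X$ has domain $D(\mathcal J_l)=\{e=(e_1,e_2)\in X: e_1|_{(a,l)}\in H^1((a,l),\mathbb R),\ e_1|_{(l,b)}\in H^1((l,b),\mathbb R),\ e_2\in H^1([a,b],\mathbb R)\}$ and acts as $\mathcal J_le=P_1\frac{d}{dz}e$ on each of $(a,l)$ and $(l,b)$, $P_1=\begin{bmatrix}0&-1\\-1&0\end{bmatrix}$. For $e\in D(\mathcal J_l)$ put $f_{\partial,e}=\frac1{\sqrt2}(P_1e(b)-P_1e(a))$, $e_{\partial,e}=\frac1{\sqrt2}(e(b)+e(a))$, $f_{I,e}=e_2(l)$, $e_{I,e}=e_1(l^-)-e_1(l^+)$. For $r\ge0$ and $W_B\in\mathbb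 R^{2\times4}$, the port-Hamiltonian operator $A_{\mathcal Q_l}$ is $$D(A_{\mathcal Q_l})=\left\{x\in X:\ \mathcal Q_lx\in D(\mathcal J_l),\ f_{I,\mathcal Q_lx}=r\,e_{I,\mathcal Q_lx},\ W_B\begin{bmatrix}f_{\partial,\mathcal Q_lx}\\ e_{\partial,\mathcal Q_lx}\end{bmatrix}=0\right\},\qquad A_{\mathcal Q_l}x=\mathcal J_l(\mathcal Q_lx).$$ $A_{\mathcal Q_0}$ is the case $l=0$. $\Sigma=\begin{bmatrix}0&I\\ I&0\end{bmatrix}\in\mathbb R^{4\times4}$ with $2\times2$ identity blocks; $>0$ means positive definite. A family $(A(t))_{t\in[0,\tau]}$ of infinitesimal generators of $C_0$-semigroups on a Hilbert space $X$ is called stable if there are constants $M\ge1$, $\omega\in\mathbb R$ such that $(\omega,\infty)\subset\rho(A(t))$ for all $t\in[0,\tau]$, and for every finite sequence $0\le t_1\le t_2\le\dots\le t_k\le\tau$, $k\in\mathbb N$, $\left\|\prod_{j=1}^kR(\lambda,A(t_j))\right\|_{\mathcal L(X)}\le\frac{M}{(\lambda-\omega)^k}$ for all $\lambda>\omega$, where $R(\lambda,A)=(\lambda I-A)^{-1}$. *)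

theory Defs
  imports "HOL-Analysis.Analysis"
begin

section \<open>Abstract operator theory on a normed space given by a carrier and a norm\<close>

text \<open>
  A normed space is a linear subspace \<open>X\<close> of a real vector space together with a norm
  \<open>N\<close> on \<open>X\<close>; an unbounded operator on \<open>X\<close> is given by its domain \<open>D\<close> and its action \<open>A\<close>,
  the values of \<open>A\<close> outside of \<open>D\<close> being irrelevant.
\<close>

definition bounded_op :: "'a::real_vector set \<Rightarrow> ('a \<Rightarrow> real) \<Rightarrow> ('a \<Rightarrow> 'a) \<Rightarrow> bool" where
  "bounded_op X N T \<longleftrightarrow>
     (\<forall>x\<in>X. T x \<in> X) \<and>
     (\<forall>x\<in>X. \<forall>y\<in>X. T (x + y) = T x + T y) \<and>
     (\<forall>c. \<forall>x\<in>X. T (c *\<^sub>R x) = c *\<^sub>R T x) \<and>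
     (\<exists>C. \<forall>x\<in>X. N (T x) \<le> C * N x)"

text \<open>The supremum below is meaningful for operators satisfying \<^const>\<open>bounded_op\<close>.\<close>

definition op_norm :: "'a::real_vector set \<Rightarrow> ('a \<Rightarrow> real) \<Rightarrow> ('a \<Rightarrow> 'a) \<Rightarrow> real" where
  "op_norm X N T = (SUP x\<in>{x\<in>X. N x \<le> 1}. N (T x))"

definition C0_semigroup ::
    "'a::real_vector set \<Rightarrow> ('a \<Rightarrow> real) \<Rightarrow> (real \<Rightarrow> 'a \<Rightarrow> 'a) \<Rightarrow> bool" where
  "C0_semigroup X N T \<longleftrightarrow>
     (\<forall>t\<ge>0. bounded_op X N (T t)) \<and>
     (\<forall>x\<in>X. T 0 x = x) \<and>
     (\<forall>s\<ge>0. \<forall>t\<ge>0. \<forall>x\<in>X. T (s + t) x = T s (T t x)) \<and>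
     (\<forall>x\<in>X. ((\<lambda>h. N (T h x - x)) \<longlongrightarrow> 0) (at_right 0))"

definition generates_semigroup ::
    "'a::real_vector set \<Rightarrow> ('a \<Rightarrow> real) \<Rightarrow> 'a set \<Rightarrow> ('a \<Rightarrow> 'a) \<Rightarrow> (real \<Rightarrow> 'a \<Rightarrow> 'a) \<Rightarrow> bool" where
  "generates_semigroup X N D A T \<longleftrightarrow>
     D = {x\<in>X. \<exists>y\<in>X. ((\<lambda>h. N ((1 / h) *\<^sub>R (T h x - x) - y)) \<longlongrightarrow> 0) (at_right 0)} \<and>
     (\<forall>x\<in>D. A x \<in> X \<and> ((\<lambda>h. N ((1 / h) *\<^sub>R (T h x - x) - A x)) \<longlongrightarrow> 0) (at_right 0))"

definition infinitesimal_generator ::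
    "'a::real_vector set \<Rightarrow> ('a \<Rightarrow> real) \<Rightarrow> 'a set \<Rightarrow> ('a \<Rightarrow> 'a) \<Rightarrow> bool" where
  "infinitesimal_generator X N D A \<longleftrightarrow>
     (\<exists>T. C0_semigroup X N T \<and> generates_semigroup X N D A T)"

definition resolvent :: "'a::real_vector set \<Rightarrow> ('a \<Rightarrow> 'a) \<Rightarrow> real \<Rightarrow> 'a \<Rightarrow> 'a" where
  "resolvent D A lam = inv_into D (\<lambda>x. lam *\<^sub>R x - A x)"

text \<open>The real points of the resolvent set; no others are needed.\<close>

definition resolvent_set ::
    "'a::real_vector set \<Rightarrow> ('a \<Rightarrow> real) \<Rightarrow> 'a set \<Rightarrow> ('a \<Rightarrow> 'a) \<Rightarrow> real set" where
  "resolvent_set X N D A =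
     {lam. bij_betw (\<lambda>x. lam *\<^sub>R x - A x) D X \<and> bounded_op X N (resolvent D A lam)}"

text \<open>
  The finite sequence \<open>t\<^sub>1 \<le> \<dots> \<le> t\<^sub>k\<close> is the sorted list \<open>ts\<close>.  The product of the resolvents is
  time-ordered, as usual for stable families: \<^const>\<open>fold\<close> yields
  \<open>R(lam, A(t\<^sub>k)) \<dots> R(lam, A(t\<^sub>1))\<close>.
\<close>

definition stable_family ::
    "'a::real_vector set \<Rightarrow> ('a \<Rightarrow> real) \<Rightarrow> real \<Rightarrow> (real \<Rightarrow> 'a set) \<Rightarrow> (real \<Rightarrow> 'a \<Rightarrow> 'a) \<Rightarrow> bool" where
  "stable_family X N \<tau> D A \<longleftrightarrow>
     (\<forall>t\<in>{0..\<tau>}. infinitesimal_generator X N (D t) (A t)) \<and>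
     (\<exists>M \<omega>. M \<ge> 1 \<and>
        (\<forall>t\<in>{0..\<tau>}. {\<omega><..} \<subseteq> resolvent_set X N (D t) (A t)) \<and>
        (\<forall>ts. sorted ts \<and> set ts \<subseteq> {0..\<tau>} \<longrightarrow>
           (\<forall>lam>\<omega>. op_norm X N (fold (\<lambda>t. resolvent (D t) (A t) lam) ts)
                       \<le> M / (lam - \<omega>) ^ length ts)))"


section \<open>The space of square integrable functions with values in the Euclidean plane\<close>

definition sq_integrable :: "(real \<Rightarrow> real^2) \<Rightarrow> bool" where
  "sq_integrable f \<longleftrightarrow> f \<in> borel_measurable lborel \<and> integrable lborel (\<lambda>z. (norm (f z))\<^sup>2)"

definition L2_rel :: "(real \<Rightarrow> real^2) \<Rightarrow> (real \<Rightarrow> real^2) \<Rightarrow> bool" where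
  "L2_rel f g \<longleftrightarrow> sq_integrable f \<and> sq_integrable g \<and> (AE z in lborel. f z = g z)"

lemma sq_integrable_zero: "sq_integrable (\<lambda>z. 0)"
  by (simp add: sq_integrable_def)

lemma sq_integrable_scaleR: "sq_integrable f \<Longrightarrow> sq_integrable (\<lambda>z. c *\<^sub>R f z)"
  by (auto simp: sq_integrable_def power_mult_distrib intro: borel_measurable_scaleR)

lemma sq_integrable_add:
  assumes "sq_integrable f" "sq_integrable g"
  shows "sq_integrable (\<lambda>z. f z + g z)"
proof -
  have [measurable]: "f \<in> borel_measurable lborel" "g \<in> borel_measurable lborel"
    using assms by (auto simp: sq_integrable_def)
  have "integrable lborel (\<lambda>z. 2 * (norm (f z))\<^sup>2 + 2 * (norm (g z))\<^sup>2)"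
    using assms by (auto simp: sq_integrable_def)
  then have "integrable lborel (\<lambda>z. (norm (f z + g z))\<^sup>2)"
  proof (rule Bochner_Integration.integrable_bound)
    have "(norm (f z + g z))\<^sup>2 \<le> 2 * (norm (f z))\<^sup>2 + 2 * (norm (g z))\<^sup>2" for z
    proof -
      have "(norm (f z + g z))\<^sup>2 \<le> (norm (f z) + norm (g z))\<^sup>2"
        by (simp add: norm_triangle_ineq power_mono)
      also have "\<dots> \<le> 2 * (norm (f z))\<^sup>2 + 2 * (norm (g z))\<^sup>2"
        using sum_squares_bound[of "norm (f z)" "norm (g z)"] by (simp add: power2_sum)
      finally show ?thesis .
    qed
    then show "AE z in lborel. norm ((norm (f z + g z))\<^sup>2)
                 \<le> norm (2 * (norm (f z))\<^sup>2 + 2 * (norm (g z))\<^sup>2)"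
      by (intro AE_I2) simp
  qed measurable
  then show ?thesis by (simp add: sq_integrable_def)
qed

lemma sq_integrable_diff:
  assumes "sq_integrable f" "sq_integrable g"
  shows "sq_integrable (\<lambda>z. f z - g z)"
  using sq_integrable_add[OF assms(1) sq_integrable_scaleR[OF assms(2), of "-1"]] by simp

lemma sq_integrable_inner:
  assumes "sq_integrable f" "sq_integrable g"
  shows "integrable lborel (\<lambda>z. f z \<bullet> g z)"
proof -
  have [measurable]: "f \<in> borel_measurable lborel" "g \<in> borel_measurable lborel"
    using assms by (auto simp: sq_integrable_def)
  have "integrable lborel (\<lambda>z. (norm (f z))\<^sup>2 + (norm (g z))\<^sup>2)"
    using assms by (auto simp: sq_integrable_def)
  then show ?thesis
  proof (rule Bochner_Integration.integrable_bound)
    have "\<bar>f z \<bullet> g z\<bar> \<le> (norm (f z))\<^sup>2 + (norm (g z))\<^sup>2" for z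
    proof -
      have "\<bar>f z \<bullet> g z\<bar> \<le> norm (f z) * norm (g z)"
        by (rule Cauchy_Schwarz_ineq2)
      also have "\<dots> \<le> 2 * norm (f z) * norm (g z)"
        by simp
      also have "\<dots> \<le> (norm (f z))\<^sup>2 + (norm (g z))\<^sup>2"
        using sum_squares_bound[of "norm (f z)" "norm (g z)"] .
      finally show ?thesis .
    qed
    then show "AE z in lborel. norm (f z \<bullet> g z) \<le> norm ((norm (f z))\<^sup>2 + (norm (g z))\<^sup>2)"
      by (intro AE_I2) simp
  qed measurable
qed

quotient_type L2 = "real \<Rightarrow> real^2" / partial: L2_rel
  morphisms rep_L2 abs_L2
proof (rule part_equivpI)
  show "\<exists>f. L2_rel f f"
    using sq_integrable_zero by (auto simp: L2_rel_def)
  show "symp L2_rel"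
    by (auto simp: symp_def L2_rel_def)
  show "transp L2_rel"
    by (auto simp: transp_def L2_rel_def elim: AE_mp)
qed

instantiation L2 :: real_inner
begin

lift_definition zero_L2 :: L2 is "\<lambda>z. 0"
  by (simp add: L2_rel_def sq_integrable_zero)

lift_definition plus_L2 :: "L2 \<Rightarrow> L2 \<Rightarrow> L2" is "\<lambda>f g z. f z + g z"
  by (auto simp: L2_rel_def sq_integrable_add)

lift_definition scaleR_L2 :: "real \<Rightarrow> L2 \<Rightarrow> L2" is "\<lambda>c f z. c *\<^sub>R f z"
  by (auto simp: L2_rel_def sq_integrable_scaleR)

lift_definition uminus_L2 :: "L2 \<Rightarrow> L2" is "\<lambda>f z. - f z"
  using sq_integrable_scaleR[of _ "-1"] by (auto simp: L2_rel_def)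

lift_definition minus_L2 :: "L2 \<Rightarrow> L2 \<Rightarrow> L2" is "\<lambda>f g z. f z - g z"
  by (auto simp: L2_rel_def intro!: sq_integrable_diff)

lift_definition inner_L2 :: "L2 \<Rightarrow> L2 \<Rightarrow> real" is "\<lambda>f g. LINT z|lborel. f z \<bullet> g z"
proof -
  fix f f' g g'
  assume *: "L2_rel f f'" "L2_rel g g'"
  then have [measurable]: "f \<in> borel_measurable lborel" "f' \<in> borel_measurable lborel"
      "g \<in> borel_measurable lborel" "g' \<in> borel_measurable lborel"
    by (auto simp: L2_rel_def sq_integrable_def)
  show "(LINT z|lborel. f z \<bullet> g z) = (LINT z|lborel. f' z \<bullet> g' z)"
    by (rule integral_cong_AE) (use * in \<open>auto simp: L2_rel_def\<close>)
qed

definition norm_L2 :: "L2 \<Rightarrow> real" where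
  "norm_L2 x = sqrt (x \<bullet> x)"

definition dist_L2 :: "L2 \<Rightarrow> L2 \<Rightarrow> real" where
  "dist_L2 x y = norm (x - y)"

definition sgn_L2 :: "L2 \<Rightarrow> L2" where
  "sgn_L2 x = inverse (norm x) *\<^sub>R x"

definition uniformity_L2 :: "(L2 \<times> L2) filter" where
  "uniformity_L2 = (INF e\<in>{0<..}. principal {(x, y). dist x y < e})"

definition open_L2 :: "L2 set \<Rightarrow> bool" where
  "open_L2 U \<longleftrightarrow> (\<forall>x\<in>U. eventually (\<lambda>(x', y). x' = x \<longrightarrow> y \<in> U) uniformity)"

instance
proof
  fix x y z :: L2 and c d :: real
  show "x + y + z = x + (y + z)"
    by transfer (auto simp: L2_rel_def add.assoc intro!: sq_integrable_add)
  show "x + y = y + x"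
    by transfer (auto simp: L2_rel_def add.commute intro!: sq_integrable_add)
  show "0 + x = x"
    by transfer (auto simp: L2_rel_def)
  show "- x + x = 0"
    by transfer (auto simp: L2_rel_def sq_integrable_zero)
  show "x - y = x + - y"
    by transfer (auto simp: L2_rel_def intro!: sq_integrable_diff)
  show "c *\<^sub>R (x + y) = c *\<^sub>R x + c *\<^sub>R y"
    by transfer (auto simp: L2_rel_def scaleR_add_right intro!: sq_integrable_add sq_integrable_scaleR)
  show "(c + d) *\<^sub>R x = c *\<^sub>R x + d *\<^sub>R x"
    by transfer (auto simp: L2_rel_def scaleR_add_left intro!: sq_integrable_add sq_integrable_scaleR)
  show "c *\<^sub>R d *\<^sub>R x = (c * d) *\<^sub>R x"
    by transfer (auto simp: L2_rel_def intro!: sq_integrable_scaleR)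
  show "1 *\<^sub>R x = x"
    by transfer (auto simp: L2_rel_def)
  show "x \<bullet> y = y \<bullet> x"
    by transfer (simp add: inner_commute)
  show "(x + y) \<bullet> z = x \<bullet> z + y \<bullet> z"
    by transfer (simp add: inner_add_left sq_integrable_inner L2_rel_def)
  show "(c *\<^sub>R x) \<bullet> y = c * (x \<bullet> y)"
    by transfer simp
  show "0 \<le> x \<bullet> x"
    by transfer simp
  show "(x \<bullet> x = 0) = (x = 0)"
  proof transfer
    fix f assume *: "L2_rel f f"
    then have "(LINT z|lborel. f z \<bullet> f z) = 0 \<longleftrightarrow> (AE z in lborel. f z \<bullet> f z = 0)"
      by (intro integral_nonneg_eq_0_iff_AE sq_integrable_inner) (auto simp: L2_rel_def)
    then show "((LINT z|lborel. f z \<bullet> f z) = 0) = L2_rel f (\<lambda>z. 0)"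
      using * by (auto simp: L2_rel_def sq_integrable_zero)
  qed
  show "dist x y = norm (x - y)" by (rule dist_L2_def)
  show "sgn x = inverse (norm x) *\<^sub>R x" by (rule sgn_L2_def)
  show "norm x = sqrt (x \<bullet> x)" by (rule norm_L2_def)
  show "uniformity = (INF e\<in>{0<..}. principal {(x :: L2, y). dist x y < e})"
    by (rule uniformity_L2_def)
  show "open U \<longleftrightarrow> (\<forall>x\<in>U. eventually (\<lambda>(x', y). x' = x \<longrightarrow> y \<in> U) uniformity)"
    for U :: "L2 set"
    by (rule open_L2_def)
qed

end

text \<open>
  \<open>L\<^sup>2([a,b], \<real>\<^sup>2)\<close> is identified with the closed subspace of \<open>L\<^sup>2(\<real>, \<real>\<^sup>2)\<close> of
  functions vanishing almost everywhere outside of \<open>[a,b]\<close> (extension by zero).  The norm of type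
  \<^typ>\<open>L2\<close> restricts to the standard norm.  Whatever is defined from \<^const>\<open>rep_L2\<close> below does not
  depend on the representative.
\<close>

definition L2_interval :: "real \<Rightarrow> real \<Rightarrow> L2 set" where
  "L2_interval a b = {x. AE z in lborel. z \<notin> {a..b} \<longrightarrow> rep_L2 x z = 0}"


section \<open>Sobolev functions on an interval\<close>

definition L2_on :: "real \<Rightarrow> real \<Rightarrow> (real \<Rightarrow> real) \<Rightarrow> bool" where
  "L2_on \<alpha> \<beta> u \<longleftrightarrow> set_borel_measurable lborel {\<alpha><..<\<beta>} u \<and>
                   set_integrable lborel {\<alpha><..<\<beta>} (\<lambda>z. (u z)\<^sup>2)"

definition test_function :: "real \<Rightarrow> real \<Rightarrow> (real \<Rightarrow> real) \<Rightarrow> (real \<Rightarrow> real) \<Rightarrow> bool" where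
  "test_function \<alpha> \<beta> \<phi> \<phi>' \<longleftrightarrow>
     (\<forall>z. (\<phi> has_real_derivative \<phi>' z) (at z)) \<and> continuous_on UNIV \<phi>' \<and>
     (\<exists>K. compact K \<and> K \<subseteq> {\<alpha><..<\<beta>} \<and> (\<forall>z. z \<notin> K \<longrightarrow> \<phi> z = 0))"

text \<open>
  \<open>H\<^sup>1(\<alpha>, \<beta>)\<close> is defined as by Brezis, with test functions in \<open>C\<^sub>c\<^sup>1(\<alpha>, \<beta>)\<close>.
\<close>

definition has_weak_deriv :: "real \<Rightarrow> real \<Rightarrow> (real \<Rightarrow> real) \<Rightarrow> (real \<Rightarrow> real) \<Rightarrow> bool" where
  "has_weak_deriv \<alpha> \<beta> u g \<longleftrightarrow> L2_on \<alpha> \<beta> g \<and>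
     (\<forall>\<phi> \<phi>'. test_function \<alpha> \<beta> \<phi> \<phi>' \<longrightarrow>
        (LINT z:{\<alpha><..<\<beta>}|lborel. u z * \<phi>' z) = - (LINT z:{\<alpha><..<\<beta>}|lborel. g z * \<phi> z))"

definition H1 :: "real \<Rightarrow> real \<Rightarrow> (real \<Rightarrow> real) set" where
  "H1 \<alpha> \<beta> = {u. L2_on \<alpha> \<beta> u \<and> (\<exists>g. has_weak_deriv \<alpha> \<beta> u g)}"

definition weak_deriv :: "real \<Rightarrow> real \<Rightarrow> (real \<Rightarrow> real) \<Rightarrow> real \<Rightarrow> real" where
  "weak_deriv \<alpha> \<beta> u = (SOME g. has_weak_deriv \<alpha> \<beta> u g)"

text \<open>
  \<open>trace_at \<alpha> \<beta> u p\<close> is the value at \<open>p \<in> [\<alpha>, \<beta>]\<close> of the representative of \<open>u\<close> that is continuous on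
  \<open>[\<alpha>, \<beta>]\<close>; so \<open>trace_at \<alpha> \<beta> u \<beta>\<close> is the one-sided limit \<open>u(\<beta>\<^sup>-)\<close> and \<open>trace_at \<alpha> \<beta> u \<alpha>\<close>
  is \<open>u(\<alpha>\<^sup>+)\<close>.
\<close>

definition trace_at :: "real \<Rightarrow> real \<Rightarrow> (real \<Rightarrow> 'a::real_normed_vector) \<Rightarrow> real \<Rightarrow> 'a" where
  "trace_at \<alpha> \<beta> u p = (THE y. \<exists>v. continuous_on {\<alpha>..\<beta>} v \<and>
                       (AE z in lborel. z \<in> {\<alpha><..<\<beta>} \<longrightarrow> u z = v z) \<and> y = v p)"


section \<open>Port-Hamiltonian operators with an interface\<close>

definition C1_on :: "real set \<Rightarrow> (real \<Rightarrow> 'a::real_normed_vector) \<Rightarrow> bool" where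
  "C1_on S f \<longleftrightarrow> (\<exists>f'. (\<forall>z\<in>S. (f has_vector_derivative f' z) (at z within S)) \<and> continuous_on S f')"

definition pos_def :: "real^'n^'n \<Rightarrow> bool" where
  "pos_def M \<longleftrightarrow> transpose M = M \<and> (\<forall>v. v \<noteq> 0 \<longrightarrow> v \<bullet> (M *v v) > 0)"

text \<open>The matrix function \<open>\<Q>\<^sub>l\<close>; \<open>Qm\<close> and \<open>Qp\<close> are \<open>\<Q>\<^sup>-\<close> and \<open>\<Q>\<^sup>+\<close>.\<close>

definition Q_at :: "real \<Rightarrow> real \<Rightarrow> (real \<Rightarrow> real^2^2) \<Rightarrow> (real \<Rightarrow> real^2^2) \<Rightarrow> real \<Rightarrow> real \<Rightarrow> real^2^2"
  where
  "Q_at a b Qm Qp l z = indicator {a..<l} z *\<^sub>R Qm z + indicator {l<..b} z *\<^sub>R Qp z"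

definition mult_op :: "(real \<Rightarrow> real^2^2) \<Rightarrow> L2 \<Rightarrow> L2" where
  "mult_op Q x = abs_L2 (\<lambda>z. Q z *v rep_L2 x z)"

definition inner_Q :: "real \<Rightarrow> real \<Rightarrow> (real \<Rightarrow> real^2^2) \<Rightarrow> L2 \<Rightarrow> L2 \<Rightarrow> real" where
  "inner_Q a b Q x y = 1/2 * (LINT z:{a..b}|lborel. rep_L2 y z \<bullet> (Q z *v rep_L2 x z))"

definition norm_Q :: "real \<Rightarrow> real \<Rightarrow> (real \<Rightarrow> real^2^2) \<Rightarrow> L2 \<Rightarrow> real" where
  "norm_Q a b Q x = sqrt (inner_Q a b Q x x)"

definition P1 :: "real^2^2" where
  "P1 = vector [vector [0, -1], vector [-1, 0]]"

definition J_dom :: "real \<Rightarrow> real \<Rightarrow> real \<Rightarrow> L2 set" where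
  "J_dom a b l = {e \<in> L2_interval a b.
     (\<lambda>z. rep_L2 e z $ 1) \<in> H1 a l \<and> (\<lambda>z. rep_L2 e z $ 1) \<in> H1 l b \<and>
     (\<lambda>z. rep_L2 e z $ 2) \<in> H1 a b}"

definition weak_deriv_vec :: "real \<Rightarrow> real \<Rightarrow> (real \<Rightarrow> real^2) \<Rightarrow> real \<Rightarrow> real^2" where
  "weak_deriv_vec \<alpha> \<beta> u z = (\<chi> i. weak_deriv \<alpha> \<beta> (\<lambda>s. u s $ i) z)"

definition J_op :: "real \<Rightarrow> real \<Rightarrow> real \<Rightarrow> L2 \<Rightarrow> L2" where
  "J_op a b l e = abs_L2 (\<lambda>z.
     if z \<in> {a<..<l} then P1 *v weak_deriv_vec a l (rep_L2 e) z
     else if z \<in> {l<..<b} then P1 *v weak_deriv_vec l b (rep_L2 e) z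
     else 0)"

definition f_boundary :: "real \<Rightarrow> real \<Rightarrow> real \<Rightarrow> L2 \<Rightarrow> real^2" where
  "f_boundary a b l e =
     (1 / sqrt 2) *\<^sub>R (P1 *v trace_at l b (rep_L2 e) b - P1 *v trace_at a l (rep_L2 e) a)"

definition e_boundary :: "real \<Rightarrow> real \<Rightarrow> real \<Rightarrow> L2 \<Rightarrow> real^2" where
  "e_boundary a b l e =
     (1 / sqrt 2) *\<^sub>R (trace_at l b (rep_L2 e) b + trace_at a l (rep_L2 e) a)"

definition f_interface :: "real \<Rightarrow> real \<Rightarrow> real \<Rightarrow> L2 \<Rightarrow> real" where
  "f_interface a b l e = trace_at a b (\<lambda>z. rep_L2 e z $ 2) l"

definition e_interface :: "real \<Rightarrow> real \<Rightarrow> real \<Rightarrow> L2 \<Rightarrow> real" where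
  "e_interface a b l e =
     trace_at a l (\<lambda>z. rep_L2 e z $ 1) l - trace_at l b (\<lambda>z. rep_L2 e z $ 1) l"

definition stack :: "real^2 \<Rightarrow> real^2 \<Rightarrow> real^4" where
  "stack f e = vector [f $ 1, f $ 2, e $ 1, e $ 2]"

definition Sigma_mat :: "real^4^4" where
  "Sigma_mat = vector [vector [0, 0, 1, 0], vector [0, 0, 0, 1],
                       vector [1, 0, 0, 0], vector [0, 1, 0, 0]]"

definition pH_dom :: "real \<Rightarrow> real \<Rightarrow> (real \<Rightarrow> real^2^2) \<Rightarrow> (real \<Rightarrow> real^2^2) \<Rightarrow>
    real \<Rightarrow> real^4^2 \<Rightarrow> real \<Rightarrow> L2 set" where
  "pH_dom a b Qm Qp r W_B l = {x \<in> L2_interval a b.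
     (let e = mult_op (Q_at a b Qm Qp l) x in
        e \<in> J_dom a b l \<and>
        f_interface a b l e = r * e_interface a b l e \<and>
        W_B *v stack (f_boundary a b l e) (e_boundary a b l e) = 0)}"

definition pH_op :: "real \<Rightarrow> real \<Rightarrow> (real \<Rightarrow> real^2^2) \<Rightarrow> (real \<Rightarrow> real^2^2) \<Rightarrow>
    real \<Rightarrow> L2 \<Rightarrow> L2" where
  "pH_op a b Qm Qp l x = J_op a b l (mult_op (Q_at a b Qm Qp l) x)"

text \<open>\<open>\<eta>\<^sup>-(t)\<close> is \<open>eta Qm Qp (l t)\<close> and \<open>\<eta>\<^sup>+(t)\<close> is \<open>eta Qp Qm (l t)\<close>.\<close>

definition eta :: "(real \<Rightarrow> real^2^2) \<Rightarrow> (real \<Rightarrow> real^2^2) \<Rightarrow> real \<Rightarrow> real" where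
  "eta Q Q' z = 1/2 * (Q z $ 1 $ 1 / Q' z $ 1 $ 1 + Q z $ 2 $ 2 / Q' z $ 2 $ 2)"

end

theory Submission
  imports Defs
begin

text \<open>
  In the norm of \<open>\<Q>\<^sub>l\<close> every \<open>A\<^bsub>\<Q>\<^sub>l\<^esub>\<close> is dissipative, boundedly invertible (integrate \<open>P\<^sub>1 e' = y\<close> and match
  the boundary and interface conditions) and hence m-dissipative, so it generates a contraction
  semigroup.  Taking the energy balance in the norm of \<open>\<Q>\<^sub>0\<close> instead multiplies the integrand by a
  weight that is Lipschitz on either side of the interface: its derivative contributes a bounded
  term, and its jump at the interface contributes exactly the quadratic form controlled by (i) and
  (ii).  So all \<open>A(t)\<close> are quasi-dissipative in this single norm with a common constant \<open>\<omega>\<close>, which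
  gives stability with \<open>M = 1\<close>.
\<close>

section \<open>Generation of contraction semigroups\<close>

text \<open>Each operator contracts only in its own norm, and these norms move with t, so generation
  alone bounds no product of resolvents. Two norms therefore share the work: that of Q_l gives
  bijectivity and generation, that of Q_0 the resolvent bounds; being a generator is insensitive to
  the choice between equivalent norms. The weight is scalar because both diagonal entries of Q^+ and
  Q^- have the same ratio: with e = Q_l x and y = P_1 e', the integrand x . Q_0 y is the weight
  times e . y = -(e_1 e_2)', so integration by parts applies. The value of the weight at the
  interface is eta, and the interface power stays below the form in (i) or (ii) by the square r/4 (1
  + eta) (e_1(l-) - e_1(l+))^2. The inequality with k is given for l = 0, but it only concerns the
  four boundary values, which do not see the interface; so it serves for every l, both in the energy
  balance and in showing that the 3 x 3 system for the free constants of the inversion is regular.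
  The bounds on the derivative of the weight are taken on all of [a,b], hence are uniform in l, and
  omega does not depend on t.\<close>

lemma tendsto_norm_equiv:
  fixes f :: "'b \<Rightarrow> 'a::real_normed_vector"
  assumes c: "0 < c" and N: "\<And>x. x \<in> X \<Longrightarrow> c * norm x \<le> N x \<and> N x \<le> C * norm x"
    and f: "eventually (\<lambda>h. f h \<in> X) F"
  shows "((\<lambda>h. N (f h)) \<longlongrightarrow> 0) F \<longleftrightarrow> (f \<longlongrightarrow> 0) F"
proof
  assume *: "((\<lambda>h. N (f h)) \<longlongrightarrow> 0) F"
  have "((\<lambda>h. N (f h) / c) \<longlongrightarrow> 0) F"
    using tendsto_divide[OF * tendsto_const[of c]] c by simp
  moreover have "eventually (\<lambda>h. norm (f h) \<le> N (f h) / c) F"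
    using f by eventually_elim (use N c in \<open>auto simp: field_simps\<close>)
  ultimately show "(f \<longlongrightarrow> 0) F"
    by (rule Lim_null_comparison[rotated])
next
  assume *: "(f \<longlongrightarrow> 0) F"
  have "((\<lambda>h. C * norm (f h)) \<longlongrightarrow> 0) F"
    by (rule tendsto_eq_intros * | simp)+
  moreover have "eventually (\<lambda>h. norm (N (f h)) \<le> C * norm (f h)) F"
    using f
  proof eventually_elim
    case (elim h)
    have "0 \<le> c * norm (f h)" using c by simp
    with N[OF elim] show ?case by simp
  qed
  ultimately show "((\<lambda>h. N (f h)) \<longlongrightarrow> 0) F"
    by (rule Lim_null_comparison[rotated])
qed

text \<open>Comparability is demanded on \<open>X\<close> only, because the norms in question
  integrate over [a,b] and vanish on functions supported elsewhere; on the whole type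
  \<open>N\<close> is just a seminorm.\<close>

locale equivalent_norm =
  fixes X :: "'a::real_normed_vector set" and N :: "'a \<Rightarrow> real" and c C :: real
  assumes subspace_X: "subspace X" and complete_X: "complete X"
    and N_triangle: "N (x + y) \<le> N x + N y"
    and N_scaleR: "N (s *\<^sub>R x) = \<bar>s\<bar> * N x"
    and c_pos: "0 < c"
    and N_lower: "x \<in> X \<Longrightarrow> c * norm x \<le> N x"
    and N_upper: "x \<in> X \<Longrightarrow> N x \<le> C * norm x"
begin

lemmas X_mem [simp, intro] = subspace_0[OF subspace_X] subspace_add[OF subspace_X]
  subspace_diff[OF subspace_X] subspace_scale[OF subspace_X]

lemma N_zero [simp]: "N 0 = 0"
  using N_scaleR[of 0 0] by simp

lemma N_minus: "N (x - y) = N (y - x)"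
  using N_scaleR[of "-1" "x - y"] by simp

lemma N_nonneg [simp]: "0 \<le> N x"
  using N_triangle[of x "-x"] N_scaleR[of "-1" x] by simp

lemma N_diff_triangle: "N (x - z) \<le> N (x - y) + N (y - z)"
  using N_triangle[of "x - y" "y - z"] by simp

lemma N_triangle_diff: "N (x - y) \<le> N x + N y"
  using N_triangle[of x "-y"] N_scaleR[of "-1" y] by simp

lemma N_abs_diff: "\<bar>N x - N y\<bar> \<le> N (x - y)"
  using N_triangle[of "x - y" y] N_triangle[of "y - x" x] N_minus[of x y] by simp

lemma N_tendsto0: 
  assumes "eventually (\<lambda>h. f h \<in> X) F"
  shows "((\<lambda>h. N (f h)) \<longlongrightarrow> 0) F \<longleftrightarrow> (f \<longlongrightarrow> 0) F"
  using tendsto_norm_equiv[where N = N and X = X and C = C, OF c_pos _ assms] N_lower N_upper by simp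

lemma N_eq_0: "x \<in> X \<Longrightarrow> N x = 0 \<longleftrightarrow> x = 0"
  using N_lower[of x] c_pos 
  by (metis N_zero mult_pos_pos not_le zero_less_norm_iff)

lemma tendsto_N:
  assumes "(f \<longlongrightarrow> l) F" "eventually (\<lambda>h. f h \<in> X) F" "l \<in> X"
  shows "((\<lambda>h. N (f h)) \<longlongrightarrow> N l) F"
proof -
  have "((\<lambda>h. N (f h - l)) \<longlongrightarrow> 0) F"
    using assms by (subst N_tendsto0) (auto elim!: eventually_mono simp: LIM_zero_iff)
  then have "((\<lambda>h. N (f h) - N l) \<longlongrightarrow> 0) F"
    by (rule Lim_null_comparison[rotated]) (simp add: N_abs_diff)
  then show ?thesis by (simp add: LIM_zero_iff)
qed

end

text \<open>Dissipativity is expressed through \<open>N\<close> alone, without an inner product.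
  Together with \<open>onto\<close> it makes every implicit Euler step solvable and contractive,
  which is what the construction of the semigroup rests on.\<close>

locale m_dissipative = equivalent_norm X N c C
  for X :: "'a::real_normed_vector set" and N c C +
  fixes D :: "'a set" and A :: "'a \<Rightarrow> 'a"
  assumes subspace_D: "subspace D" and D_sub: "D \<subseteq> X" and D_dense: "X \<subseteq> closure D"
    and A_mem: "x \<in> D \<Longrightarrow> A x \<in> X"
    and A_add: "x \<in> D \<Longrightarrow> y \<in> D \<Longrightarrow> A (x + y) = A x + A y"
    and A_scaleR: "x \<in> D \<Longrightarrow> A (s *\<^sub>R x) = s *\<^sub>R A x"
    and dissip: "x \<in> D \<Longrightarrow> 0 \<le> h \<Longrightarrow> N x \<le> N (x - h *\<^sub>R A x)"
    and onto: "0 < h \<Longrightarrow> y \<in> X \<Longrightarrow> \<exists>x\<in>D. x - h *\<^sub>R A x = y"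
begin

lemmas D_mem [simp, intro] = subspace_0[OF subspace_D] subspace_add[OF subspace_D]
  subspace_diff[OF subspace_D] subspace_scale[OF subspace_D]

lemma A_diff: "x \<in> D \<Longrightarrow> y \<in> D \<Longrightarrow> A (x - y) = A x - A y"
  using A_add[of "x - y" y] by simp

lemma D_X [simp, intro]: "x \<in> D \<Longrightarrow> x \<in> X"
  using D_sub by auto

declare A_mem [simp, intro]

lemma D_approx:
  assumes "y \<in> X" "0 < e" obtains z where "z \<in> D" "N (y - z) < e"
proof -
  have C: "0 < \<bar>C\<bar> + 1" by simp
  have "y \<in> closure D" using D_dense assms(1) by auto
  then obtain z where z: "z \<in> D" "dist z y < e / (\<bar>C\<bar> + 1)"
    using closure_approachable assms(2) C by (metis divide_pos_pos)
  have "N (y - z) \<le> C * norm (y - z)"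
    using z assms by (intro N_upper) auto
  also have "\<dots> \<le> (\<bar>C\<bar> + 1) * norm (y - z)"
    by (intro mult_right_mono) auto
  also have "\<dots> < e"
    using z(2) C by (simp add: dist_norm norm_minus_commute field_simps)
  finally show ?thesis using that z by blast
qed

section \<open>Resolvents and their powers\<close>

lemma inj_onto:
  assumes "x \<in> D" "y \<in> D" "0 < h" "x - h *\<^sub>R A x = y - h *\<^sub>R A y" shows "x = y"
proof -
  have "(x - y) - h *\<^sub>R A (x - y) = 0"
    using assms by (simp add: A_diff algebra_simps)
  then have "N (x - y) \<le> 0"
    using dissip[of "x - y" h] assms by simp
  then have "N (x - y) = 0" using N_nonneg[of "x - y"] by linarith
  then show ?thesis
    using N_eq_0[of "x - y"] assms by auto
qed

text \<open>The implicit Euler step \<open>(I - h A)^{-1}\<close>, that is, \<open>1 / h\<close>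
  times the resolvent of \<open>A\<close> at \<open>1 / h\<close>.\<close>

definition J :: "real \<Rightarrow> 'a \<Rightarrow> 'a" where
  "J h y = (THE x. x \<in> D \<and> x - h *\<^sub>R A x = y)"

lemma J_eqI: "0 < h \<Longrightarrow> x \<in> D \<Longrightarrow> x - h *\<^sub>R A x = y \<Longrightarrow> J h y = x"
  unfolding J_def by (rule the_equality) (auto intro: inj_onto)

lemma J_D [simp, intro]: "0 < h \<Longrightarrow> y \<in> X \<Longrightarrow> J h y \<in> D"
  using onto[of h y] J_eqI[of h _ y] by auto

lemma J_eq: "0 < h \<Longrightarrow> y \<in> X \<Longrightarrow> J h y - h *\<^sub>R A (J h y) = y"
  using onto[of h y] J_eqI[of h _ y] by auto

lemma J_add: "0 < h \<Longrightarrow> x \<in> X \<Longrightarrow> y \<in> X \<Longrightarrow> J h (x + y) = J h x + J h y"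
  using J_eq[of h x] J_eq[of h y] by (intro J_eqI) (auto simp: A_add scaleR_add_right add_diff_add)

lemma J_scaleR: "0 < h \<Longrightarrow> x \<in> X \<Longrightarrow> J h (s *\<^sub>R x) = s *\<^sub>R J h x"
  using J_eq[of h x] 
  by (intro J_eqI) (auto simp: A_scaleR simp del: scaleR_scaleR,
      metis scaleR_diff_right scaleR_left_commute)

lemma J_N: "0 < h \<Longrightarrow> y \<in> X \<Longrightarrow> N (J h y) \<le> N y"
  using dissip[of "J h y" h] J_eq[of h y] by simp

text \<open>The step sends \<open>y - h A y\<close> back to \<open>y\<close>; linearity turns this
  into an increment of order \<open>h\<close> in which the resolvent falls on
  \<open>A y\<close>.\<close>

lemma J_diff_eq: "0 < h \<Longrightarrow> y \<in> D \<Longrightarrow> J h y - y = h *\<^sub>R J h (A y)"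
proof -
  assume *: "0 < h" "y \<in> D"
  have "J h (y - h *\<^sub>R A y) = y"
    using * by (intro J_eqI) auto
  moreover have "J h (y + (-h) *\<^sub>R A y) = J h y + (-h) *\<^sub>R J h (A y)"
    using * by (subst J_add) (auto simp: J_scaleR simp del: scaleR_minus_left)
  ultimately show ?thesis by (simp add: algebra_simps)
qed

lemma Jn_X [simp, intro]: "0 < h \<Longrightarrow> y \<in> X \<Longrightarrow> (J h ^^ n) y \<in> X"
  by (induction n) auto

lemma Jn_D [simp, intro]: "0 < h \<Longrightarrow> y \<in> D \<Longrightarrow> (J h ^^ n) y \<in> D"
  by (cases n) auto

lemma Jn_add: "0 < h \<Longrightarrow> x \<in> X \<Longrightarrow> y \<in> X \<Longrightarrow> (J h ^^ n) (x + y) = (J h ^^ n) x + (J h ^^ n) y"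
  by (induction n) (auto simp: J_add)

lemma Jn_scaleR: "0 < h \<Longrightarrow> x \<in> X \<Longrightarrow> (J h ^^ n) (s *\<^sub>R x) = s *\<^sub>R (J h ^^ n) x"
  by (induction n) (auto simp: J_scaleR)

lemma Jn_diff: "0 < h \<Longrightarrow> x \<in> X \<Longrightarrow> y \<in> X \<Longrightarrow> (J h ^^ n) (x - y) = (J h ^^ n) x - (J h ^^ n) y"
  using Jn_add[of h "x - y" y n] by simp

lemma Jn_N: "0 < h \<Longrightarrow> y \<in> X \<Longrightarrow> N ((J h ^^ n) y) \<le> N y"
  by (induction n) (auto intro: order_trans[OF J_N])

lemma Jn_step: "0 < h \<Longrightarrow> y \<in> D \<Longrightarrow> (J h ^^ Suc n) y - (J h ^^ n) y = h *\<^sub>R (J h ^^ Suc n) (A y)"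
  using J_diff_eq[of h y] Jn_diff[of h "J h y" y n] Jn_scaleR[of h "J h (A y)" n h]
  by (simp add: funpow_swap1)

lemma Jn_move: 
  assumes "0 < h" "y \<in> D" shows "N ((J h ^^ n) y - y) \<le> real n * h * N (A y)"
proof (induction n)
  case (Suc n)
  have "N ((J h ^^ Suc n) y - y) \<le> N ((J h ^^ Suc n) y - (J h ^^ n) y) + N ((J h ^^ n) y - y)"
    by (rule N_diff_triangle)
  also have "\<dots> \<le> h * N (A y) + real n * h * N (A y)"
    unfolding Jn_step[OF assms] using Suc Jn_N[of h "A y" "Suc n"] assms
    by (intro add_mono) (auto simp: N_scaleR simp del: funpow.simps)
  finally show ?case by (simp add: algebra_simps)
qed simp

text \<open>Kobayashi's form of the Crandall--Liggett estimate: the right-hand side satisfies the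
  two-term recursion given by dissipativity with equality under the root.\<close>

lemma Jn_compare:
  assumes x: "x \<in> D" and \<mu>: "0 < \<mu>" and l: "0 < l"
  shows "N ((J \<mu> ^^ m) x - (J l ^^ n) x)
     \<le> sqrt ((real m * \<mu> - real n * l)\<^sup>2 + real m * \<mu>\<^sup>2 + real n * l\<^sup>2) * N (A x)"
proof (induction "m + n" arbitrary: m n)
  case 0
  then show ?case by simp
next
  case (Suc s)
  show ?case
  proof (cases "m = 0 \<or> n = 0")
    case True
    have "N ((J \<mu> ^^ m) x - (J l ^^ n) x) \<le> \<bar>real m * \<mu> - real n * l\<bar> * N (A x)"
      using True Jn_move[OF \<mu> x, of m] Jn_move[OF l x, of n] \<mu> l N_minus[of x]
      by (auto simp: abs_mult)
    also have "\<dots> \<le> sqrt ((real m * \<mu> - real n * l)\<^sup>2 + real m * \<mu>\<^sup>2 + real n * l\<^sup>2) * N (A x)"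
      by (intro mult_right_mono real_le_rsqrt) auto
    finally show ?thesis .
  next
    case False
    then obtain i j where ij: "m = Suc i" "n = Suc j"
      by (metis not0_implies_Suc)
    define u where "u = (J \<mu> ^^ i) x"
    define u' where "u' = J \<mu> u"
    define v where "v = (J l ^^ j) x"
    define v' where "v' = J l v"
    \<comment> \<open>Chosen so that \<open>h = p * \<mu> = q * l\<close> with
      \<open>p + q = 1\<close>: then \<open>h A u'\<close> and \<open>h A v'\<close> are the
      fractions \<open>p\<close> and \<open>q\<close> of the two Euler increments, and dissipativity
      with step \<open>h\<close> bounds \<open>u' - v'\<close> by a convex combination of the pairs
      in which one scheme is a step behind.\<close>
    define h where "h = \<mu> * l / (\<mu> + l)"
    define p where "p = l / (\<mu> + l)"
    define q where "q = \<mu> / (\<mu> + l)"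
    have pq: "0 \<le> p" "0 \<le> q" "p + q = 1" "h = p * \<mu>" "h = q * l" "h \<ge> 0"
      using \<mu> l by (auto simp: p_def q_def h_def add_divide_distrib[symmetric] add.commute)
    have D: "u \<in> D" "v \<in> D" "u' \<in> D" "v' \<in> D"
      using x \<mu> l by (auto simp: u_def v_def u'_def v'_def)
    have u: "u' - \<mu> *\<^sub>R A u' = u" and v: "v' - l *\<^sub>R A v' = v"
      using J_eq[of \<mu> u] J_eq[of l v] D \<mu> l by (auto simp: u'_def v'_def)
    have hu: "h *\<^sub>R A u' = p *\<^sub>R (u' - u)" and hv: "h *\<^sub>R A v' = q *\<^sub>R (v' - v)"
      unfolding pq(4) using u apply (simp add: algebra_simps flip: u)
      unfolding pq(4)[symmetric] pq(5) using v by (simp add: algebra_simps flip: v)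
    have "N (u' - v') \<le> N ((u' - v') - h *\<^sub>R A (u' - v'))"
      using D pq by (intro dissip) auto
    also have "h *\<^sub>R A (u' - v') = p *\<^sub>R (u' - u) - q *\<^sub>R (v' - v)"
      using D hu hv by (simp add: A_diff scaleR_diff_right)
    also have "(u' - v') - (p *\<^sub>R (u' - u) - q *\<^sub>R (v' - v)) = p *\<^sub>R (u - v') + q *\<^sub>R (u' - v)"
    proof -
      have "u' - v' = (p + q) *\<^sub>R u' - (p + q) *\<^sub>R v'" using pq by simp
      then show ?thesis by (simp add: algebra_simps)
    qed
    also have "N \<dots> \<le> p * N (u - v') + q * N (u' - v)"
      using N_triangle[of "p *\<^sub>R (u - v')" "q *\<^sub>R (u' - v)"] pq by (simp add: N_scaleR)
    also have "\<dots> \<le> p * (sqrt ((real i * \<mu> - real n * l)\<^sup>2 + real i * \<mu>\<^sup>2 + real n * l\<^sup>2) * N (A x))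
        + q * (sqrt ((real m * \<mu> - real j * l)\<^sup>2 + real m * \<mu>\<^sup>2 + real j * l\<^sup>2) * N (A x))"
      using Suc(1)[of i n] Suc(1)[of m j] Suc(2) pq ij 
      by (intro add_mono mult_left_mono) (auto simp: u_def u'_def v_def v'_def)
    also have "\<dots> = (p * sqrt ((real i * \<mu> - real n * l)\<^sup>2 + real i * \<mu>\<^sup>2 + real n * l\<^sup>2)
        + q * sqrt ((real m * \<mu> - real j * l)\<^sup>2 + real m * \<mu>\<^sup>2 + real j * l\<^sup>2)) * N (A x)" (is "_ = (p * sqrt ?S + q * sqrt ?T) * _")
      by (simp add: algebra_simps)
    also have "\<dots> \<le> sqrt ((real m * \<mu> - real n * l)\<^sup>2 + real m * \<mu>\<^sup>2 + real n * l\<^sup>2) * N (A x)"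
    proof (intro mult_right_mono real_le_rsqrt N_nonneg)
      have S: "?S \<ge> 0" "?T \<ge> 0" by auto
      \<comment> \<open>Convexity of the square; the defect is \<open>p * q\<close> times a
        square.\<close>
      have "(p * sqrt ?S + q * sqrt ?T)\<^sup>2 \<le> p * ?S + q * ?T"
      proof -
        have "(p * sqrt ?S + q * sqrt ?T)\<^sup>2 + p * q * (sqrt ?S - sqrt ?T)\<^sup>2 
            = p * (p + q) * (sqrt ?S)\<^sup>2 + q * (p + q) * (sqrt ?T)\<^sup>2"
          by (simp only: power2_eq_square) (simp add: algebra_simps)
        also have "\<dots> = p * ?S + q * ?T" using pq S by simp
        finally show ?thesis using pq 
          by (smt (verit) mult_nonneg_nonneg zero_le_power2)
      qed
      \<comment> \<open>Dropping a step shifts the difference of elapsed times by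
        \<open>\<mu>\<close> or \<open>l\<close>. The squares of these shifts replace the missing
        summands \<open>\<mu>\<^sup>2\<close> and \<open>l\<^sup>2\<close>, and the linear terms
        combine to the factor \<open>q * l - p * \<mu>\<close>, which is zero.\<close>
      also have "\<dots> = (p + q) * ((real m * \<mu> - real n * l)\<^sup>2 + real m * \<mu>\<^sup>2 + real n * l\<^sup>2)
         + 2 * (q * l - p * \<mu>) * (real m * \<mu> - real n * l)"
        unfolding ij p_def q_def using \<mu> l
        by (simp add: field_simps add_pos_pos) (simp add: power2_eq_square algebra_simps)
      also have "\<dots> = (real m * \<mu> - real n * l)\<^sup>2 + real m * \<mu>\<^sup>2 + real n * l\<^sup>2"
        using pq by simp
      finally show "(p * sqrt ?S + q * sqrt ?T)\<^sup>2 \<le> (real m * \<mu> - real n * l)\<^sup>2 + real m * \<mu>\<^sup>2 + real n * l\<^sup>2" .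
    qed
    finally show ?thesis
      by (simp add: ij u'_def v'_def u_def v_def)
  qed
qed

section \<open>The semigroup as a limit of Euler schemes\<close>

abbreviation steps :: "real \<Rightarrow> nat \<Rightarrow> nat" where "steps t n \<equiv> nat \<lfloor>t * real (Suc n)\<rfloor>"

text \<open>The step size 1/(n+1) does not depend on \<open>t\<close>, only the number of steps
  does. So the schemes for \<open>s\<close>, \<open>t\<close> and \<open>s + t\<close> run on one
  grid, which makes the semigroup law hold up to a single step.\<close>

definition E :: "real \<Rightarrow> nat \<Rightarrow> 'a \<Rightarrow> 'a" where
  "E t n = J (1 / real (Suc n)) ^^ steps t n"

definition T :: "real \<Rightarrow> 'a \<Rightarrow> 'a" where
  "T t y = lim (\<lambda>n. E t n y)"

lemma steps_bounds:
  assumes "0 \<le> t"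
  shows "real (steps t n) * (1 / real (Suc n)) \<le> t" "t \<le> real (steps t n) * (1 / real (Suc n)) + 1 / real (Suc n)"
proof -
  have "real (steps t n) = of_int \<lfloor>t * real (Suc n)\<rfloor>"
    using assms by simp
  then have "real (steps t n) \<le> t * real (Suc n)" "t * real (Suc n) \<le> real (steps t n) + 1"
    by linarith+
  then show "real (steps t n) * (1 / real (Suc n)) \<le> t" "t \<le> real (steps t n) * (1 / real (Suc n)) + 1 / real (Suc n)"
    by (auto simp: field_simps)
qed

lemma steps_lim: "0 \<le> t \<Longrightarrow> (\<lambda>n. real (steps t n) * (1 / real (Suc n))) \<longlonglongrightarrow> t"
proof (rule tendsto_sandwich[of "\<lambda>n. t - 1 / real (Suc n)" _ _ "\<lambda>n. t"])
  assume t: "0 \<le> t"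
  show "\<forall>\<^sub>F n in sequentially. t - 1 / real (Suc n) \<le> real (steps t n) * (1 / real (Suc n))"
    using steps_bounds(2)[OF t] by (intro always_eventually allI) (simp add: algebra_simps)
  show "\<forall>\<^sub>F n in sequentially. real (steps t n) * (1 / real (Suc n)) \<le> t"
    using steps_bounds(1)[OF t] by auto
  show "(\<lambda>n. t - 1 / real (Suc n)) \<longlonglongrightarrow> t"
    using tendsto_diff[OF tendsto_const LIMSEQ_inverse_real_of_nat, of t] by (simp add: inverse_eq_divide)
qed auto

lemma E_X [simp, intro]: "y \<in> X \<Longrightarrow> E t n y \<in> X"
  and E_D [simp, intro]: "y \<in> D \<Longrightarrow> E t n y \<in> D"
  and E_add: "x \<in> X \<Longrightarrow> y \<in> X \<Longrightarrow> E t n (x + y) = E t n x + E t n y"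
  and E_diff: "x \<in> X \<Longrightarrow> y \<in> X \<Longrightarrow> E t n (x - y) = E t n x - E t n y"
  and E_scaleR: "x \<in> X \<Longrightarrow> E t n (s *\<^sub>R x) = s *\<^sub>R E t n x"
  and E_N: "y \<in> X \<Longrightarrow> N (E t n y) \<le> N y"
  by (auto simp: E_def Jn_add Jn_diff Jn_scaleR Jn_N)

text \<open>Both schemes stop within one step before \<open>t\<close>. Hence in
  \<open>Jn_compare\<close> the elapsed times differ by at most the sum of the step sizes, and the
  number of steps times the squared step size is at most \<open>t\<close> times the step
  size.\<close>

lemma E_cauchy_D:
  assumes x: "x \<in> D" and t: "0 \<le> t"
  shows "N (E t m x - E t n x) \<le> sqrt ((1 / real (Suc m) + 1 / real (Suc n))\<^sup>2 + t / real (Suc m) + t / real (Suc n)) * N (A x)"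
proof -
  define p where "p = 1 / real (Suc m)"
  define q where "q = 1 / real (Suc n)"
  have pq: "0 < p" "0 < q" by (auto simp: p_def q_def)
  note b = steps_bounds[OF t, of m, folded p_def] steps_bounds[OF t, of n, folded q_def]
  have "N (E t m x - E t n x) \<le> sqrt ((real (steps t m) * p - real (steps t n) * q)\<^sup>2 + real (steps t m) * p\<^sup>2 + real (steps t n) * q\<^sup>2) * N (A x)"
    unfolding E_def p_def[symmetric] q_def[symmetric] using x pq by (intro Jn_compare) auto
  also have "\<dots> \<le> sqrt ((p + q)\<^sup>2 + t * p + t * q) * N (A x)"
  proof (intro mult_right_mono real_sqrt_le_mono add_mono N_nonneg)
    have "\<bar>real (steps t m) * p - real (steps t n) * q\<bar> \<le> \<bar>p + q\<bar>" using b pq by linarith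
    then show "(real (steps t m) * p - real (steps t n) * q)\<^sup>2 \<le> (p + q)\<^sup>2"
      by (simp add: abs_le_square_iff)
    show "real (steps t m) * p\<^sup>2 \<le> t * p" "real (steps t n) * q\<^sup>2 \<le> t * q"
      using mult_right_mono[OF b(1), of p] mult_right_mono[OF b(3), of q] pq 
      by (auto simp: power2_eq_square ac_simps)
  qed
  finally show ?thesis by (simp add: p_def q_def)
qed

lemma Cauchy_N:
  assumes f: "\<And>n. f n \<in> X" 
    and *: "\<And>e. 0 < e \<Longrightarrow> \<exists>M. \<forall>m\<ge>M. \<forall>n\<ge>M. N (f m - f n) < e"
  shows "Cauchy f"
proof (rule CauchyI)
  fix e :: real assume "0 < e"
  then obtain M where M: "\<forall>m\<ge>M. \<forall>n\<ge>M. N (f m - f n) < c * e"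
    using *[of "c * e"] c_pos by auto
  have "norm (f m - f n) < e" if "m \<ge> M" "n \<ge> M" for m n
    using N_lower[of "f m - f n"] M that f c_pos 
    by (metis X_mem(3) mult_less_cancel_left_pos order_le_less_trans)
  then show "\<exists>M. \<forall>m\<ge>M. \<forall>n\<ge>M. norm (f m - f n) < e" by blast
qed

text \<open>The rate of \<open>E_cauchy_D\<close> is available on \<open>D\<close>; contractivity of
  the schemes carries convergence over to the closure.\<close>

lemma E_Cauchy:
  assumes y: "y \<in> X" and t: "0 \<le> t" shows "Cauchy (\<lambda>n. E t n y)"
proof (rule Cauchy_N)
  fix e :: real assume e: "0 < e"
  obtain z where z: "z \<in> D" "N (y - z) < e / 4"
    using D_approx[OF y, of "e / 4"] e by auto
  define F where "F p = sqrt ((p + p)\<^sup>2 + t * p + t * p) * N (A z)" for p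
  have "((\<lambda>n. F (1 / real (Suc n))) \<longlonglongrightarrow> F 0)"
    unfolding F_def using LIMSEQ_inverse_real_of_nat
    by (intro tendsto_intros) (auto simp: inverse_eq_divide)
  then have "eventually (\<lambda>n. F (1 / real (Suc n)) < e / 2) sequentially"
    by (rule order_tendstoD) (use e in \<open>auto simp: F_def\<close>)
  then obtain M where M: "F (1 / real (Suc M)) < e / 2"
    by (meson eventually_happens sequentially_bot)
  have "N (E t m y - E t n y) < e" if "m \<ge> M" "n \<ge> M" for m n
  proof -
    have p: "1 / real (Suc m) \<le> 1 / real (Suc M)" "1 / real (Suc n) \<le> 1 / real (Suc M)"
      using that by (auto intro!: divide_left_mono)
    have "N (E t m z - E t n z) \<le> sqrt ((1 / real (Suc m) + 1 / real (Suc n))\<^sup>2 + t / real (Suc m) + t / real (Suc n)) * N (A z)"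
      using z t by (intro E_cauchy_D) auto
    also have "\<dots> \<le> F (1 / real (Suc M))"
      unfolding F_def using mult_left_mono[OF p(1) t] mult_left_mono[OF p(2) t] p
      by (intro mult_right_mono real_sqrt_le_mono add_mono power_mono) auto
    finally have 1: "N (E t m z - E t n z) < e / 2" using M by simp
    have "E t m y - E t n y = E t m (y - z) + (E t m z - E t n z) - E t n (y - z)"
      using z y by (simp add: E_diff)
    then have "N (E t m y - E t n y) \<le> N (E t m (y - z)) + N (E t m z - E t n z) + N (E t n (y - z))"
      using N_triangle_diff[of "E t m (y - z) + (E t m z - E t n z)" "E t n (y - z)"]
        N_triangle[of "E t m (y - z)" "E t m z - E t n z"] by simp
    also have "\<dots> < e"
      using 1 z E_N[of "y - z" t m] E_N[of "y - z" t n] y by auto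
    finally show ?thesis .
  qed
  then show "\<exists>M. \<forall>m\<ge>M. \<forall>n\<ge>M. N (E t m y - E t n y) < e" by blast
qed (use y in auto)

lemma
  assumes y: "y \<in> X" and t: "0 \<le> t" 
  shows T_lim: "(\<lambda>n. E t n y) \<longlonglongrightarrow> T t y" and T_X: "T t y \<in> X"
proof -
  obtain l where "l \<in> X" "(\<lambda>n. E t n y) \<longlonglongrightarrow> l"
    using completeE[OF complete_X _ E_Cauchy[OF y t]] y by auto
  moreover from this have "T t y = l" by (simp add: T_def limI)
  ultimately show "(\<lambda>n. E t n y) \<longlonglongrightarrow> T t y" "T t y \<in> X" by auto
qed

lemma T_N:
  assumes y: "y \<in> X" and t: "0 \<le> t" shows "N (T t y) \<le> N y"
proof (rule tendsto_upperbound)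
  show "(\<lambda>n. N (E t n y)) \<longlonglongrightarrow> N (T t y)"
    using T_lim[OF y t] T_X[OF y t] y by (intro tendsto_N) auto
qed (use y E_N in auto)

lemma T_add: "x \<in> X \<Longrightarrow> y \<in> X \<Longrightarrow> 0 \<le> t \<Longrightarrow> T t (x + y) = T t x + T t y"
  using tendsto_add[OF T_lim[of x t] T_lim[of y t]] T_lim[of "x + y" t]
  by (auto simp: E_add intro: LIMSEQ_unique)

lemma T_scaleR: "x \<in> X \<Longrightarrow> 0 \<le> t \<Longrightarrow> T t (s *\<^sub>R x) = s *\<^sub>R T t x"
  using tendsto_scaleR[OF tendsto_const T_lim[of x t], of s] T_lim[of "s *\<^sub>R x" t]
  by (auto simp: E_scaleR intro: LIMSEQ_unique)

lemma T_diff: "x \<in> X \<Longrightarrow> y \<in> X \<Longrightarrow> 0 \<le> t \<Longrightarrow> T t (x - y) = T t x - T t y"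
  using T_add[of "x - y" y t] by simp

lemma T_zero: "x \<in> X \<Longrightarrow> T 0 x = x"
  using T_lim[of x 0] by (auto simp: E_def LIMSEQ_const_iff)

text \<open>The floor of a sum exceeds the sum of the floors by at most one, and one further step
  costs at most \<open>N (A x) / (n + 1)\<close>.\<close>

lemma E_step_compare:
  assumes x: "x \<in> D" and st: "0 \<le> s" "0 \<le> t"
  shows "N (E (s + t) n x - E s n (E t n x)) \<le> 1 / real (Suc n) * N (A x)"
proof -
  define h where "h = 1 / real (Suc n)"
  have h: "0 < h" by (simp add: h_def)
  have "s * real (Suc n) \<ge> 0" "t * real (Suc n) \<ge> 0" using st by auto
  moreover have "(s + t) * real (Suc n) = s * real (Suc n) + t * real (Suc n)" by (simp add: algebra_simps)
  ultimately have "steps (s + t) n = steps s n + steps t n \<or> steps (s + t) n = Suc (steps s n + steps t n)"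
    by linarith
  then show ?thesis
  proof
    assume *: "steps (s + t) n = Suc (steps s n + steps t n)"
    have "N (E (s + t) n x - E s n (E t n x)) = h * N ((J h ^^ steps (s + t) n) (A x))"
      unfolding E_def funpow_add[symmetric] o_apply[symmetric, of "J _ ^^ steps s n"] h_def[symmetric] 
      unfolding * Jn_step[OF h x] using h by (simp add: N_scaleR)
    also have "\<dots> \<le> h * N (A x)" using h x by (intro mult_left_mono Jn_N) auto
    finally show ?thesis by (simp add: h_def)
  qed (auto simp: E_def funpow_add)
qed

text \<open>The one-step error between the schemes for \<open>s + t\<close> and for \<open>s\<close>
  after \<open>t\<close> vanishes in the limit; contractivity of \<open>E s n\<close> allows the
  inner scheme to be replaced by its limit first.\<close>

lemma T_semigroup_D:
  assumes x: "x \<in> D" and st: "0 \<le> s" "0 \<le> t"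
  shows "T (s + t) x = T s (T t x)"
proof -
  have x': "x \<in> X" using x by auto
  have "(\<lambda>n. E (s + t) n x - E s n (E t n x)) \<longlonglongrightarrow> 0"
  proof (subst N_tendsto0[symmetric])
    show "(\<lambda>n. N (E (s + t) n x - E s n (E t n x))) \<longlonglongrightarrow> 0"
    proof (rule Lim_null_comparison)
      show "\<forall>\<^sub>F n in sequentially. norm (N (E (s + t) n x - E s n (E t n x))) \<le> 1 / real (Suc n) * N (A x)"
        using E_step_compare[OF x st] by simp
      show "(\<lambda>n. 1 / real (Suc n) * N (A x)) \<longlonglongrightarrow> 0"
        using tendsto_mult[OF LIMSEQ_inverse_real_of_nat tendsto_const, of "N (A x)"] by (simp add: inverse_eq_divide)
    qed
  qed (use x' in auto)
  moreover have "(\<lambda>n. E s n (E t n x) - E s n (T t x)) \<longlonglongrightarrow> 0"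
  proof (subst N_tendsto0[symmetric])
    show "(\<lambda>n. N (E s n (E t n x) - E s n (T t x))) \<longlonglongrightarrow> 0"
    proof (rule Lim_null_comparison)
      show "\<forall>\<^sub>F n in sequentially. norm (N (E s n (E t n x) - E s n (T t x))) \<le> N (E t n x - T t x)"
        using x' T_X[OF x' st(2)] by (simp flip: E_diff add: E_N)
      show "(\<lambda>n. N (E t n x - T t x)) \<longlonglongrightarrow> 0"
        using x' T_X[OF x' st(2)] T_lim[OF x' st(2)] by (subst N_tendsto0) (auto simp: LIM_zero_iff)
    qed
  qed (use x' T_X[OF x' st(2)] in auto)
  moreover have "(\<lambda>n. E s n (T t x)) \<longlonglongrightarrow> T s (T t x)"
    using T_lim T_X st x' by blast
  ultimately have "(\<lambda>n. (E (s + t) n x - E s n (E t n x)) + (E s n (E t n x) - E s n (T t x)) + E s n (T t x))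
      \<longlonglongrightarrow> 0 + 0 + T s (T t x)"
    by (intro tendsto_add)
  then have "(\<lambda>n. E (s + t) n x) \<longlonglongrightarrow> T s (T t x)"
    by (simp add: algebra_simps)
  moreover have "(\<lambda>n. E (s + t) n x) \<longlonglongrightarrow> T (s + t) x"
    using x' st by (intro T_lim) auto
  ultimately show ?thesis by (rule LIMSEQ_unique[rotated])
qed

lemma T_semigroup:
  assumes x: "x \<in> X" and st: "0 \<le> s" "0 \<le> t"
  shows "T (s + t) x = T s (T t x)"
proof -
  have "N (T (s + t) x - T s (T t x)) \<le> e" if e: "0 < e" for e
  proof -
    obtain z where z: "z \<in> D" "N (x - z) < e / 2"
      using D_approx[OF x, of "e / 2"] e by auto
    have "T (s + t) x - T s (T t x) = T (s + t) (x - z) - T s (T t (x - z))"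
      using x z st T_semigroup_D[OF z(1) st] by (simp add: T_diff T_X)
    also have "N \<dots> \<le> N (T (s + t) (x - z)) + N (T s (T t (x - z)))"
      by (rule N_triangle_diff)
    also have "\<dots> \<le> N (x - z) + N (x - z)"
      using x z st by (intro add_mono T_N order_trans[OF T_N[of "T t (x - z)"]] T_X) auto
    finally show ?thesis using z by simp
  qed
  then have "N (T (s + t) x - T s (T t x)) = 0"
    by (meson N_nonneg dense_ge order_antisym)
  then show ?thesis
    using N_eq_0[of "T (s + t) x - T s (T t x)"] x st by (simp add: T_X)
qed

section \<open>The generator of the limit semigroup\<close>

lemma T_move:
  assumes x: "x \<in> D" and t: "0 \<le> t" shows "N (T t x - x) \<le> t * N (A x)"
proof (rule tendsto_upperbound)
  show "(\<lambda>n. N (E t n x - x)) \<longlonglongrightarrow> N (T t x - x)"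
    using T_lim[of x t] T_X[of x t] x t by (intro tendsto_N tendsto_intros) auto
  have "N (E t n x - x) \<le> t * N (A x)" for n
  proof -
    have "N (E t n x - x) \<le> real (steps t n) * (1 / real (Suc n)) * N (A x)"
      unfolding E_def using x by (intro Jn_move) auto
    also have "\<dots> \<le> t * N (A x)"
      by (intro mult_right_mono steps_bounds t) auto
    finally show ?thesis .
  qed
  then show "\<forall>\<^sub>F n in sequentially. N (E t n x - x) \<le> t * N (A x)" by simp
qed simp

lemma T_continuous:
  assumes x: "x \<in> X" shows "((\<lambda>h. N (T h x - x)) \<longlongrightarrow> 0) (at_right 0)"
proof (rule tendstoI)
  fix e :: real assume e: "0 < e"
  obtain z where z: "z \<in> D" "N (x - z) < e / 4"
    using D_approx[OF x, of "e / 4"] e by auto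
  have "((\<lambda>h. h * N (A z)) \<longlongrightarrow> 0 * N (A z)) (at_right 0)"
    by (intro tendsto_intros)
  then have "\<forall>\<^sub>F h in at_right 0. h * N (A z) < e / 2"
    using e by (intro order_tendstoD) auto
  moreover have "\<forall>\<^sub>F h::real in at_right 0. 0 < h"
    by (simp add: eventually_at_right_less)
  ultimately show "\<forall>\<^sub>F h in at_right 0. dist (N (T h x - x)) 0 < e"
  proof eventually_elim
    case (elim h)
    have "T h x - x = T h (x - z) + (T h z - z) - (x - z)"
      using x z elim by (simp add: T_diff)
    then have "N (T h x - x) \<le> N (T h (x - z)) + N (T h z - z) + N (x - z)"
      using N_triangle_diff[of "T h (x - z) + (T h z - z)" "x - z"]
        N_triangle[of "T h (x - z)" "T h z - z"] by simp
    also have "\<dots> < e"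
      using T_N[of "x - z" h] T_move[OF z(1), of h] x z elim by auto
    finally show ?case by simp
  qed
qed

text \<open>The error is \<open>h\<close> times the sum of the increments
  \<open>(J h ^^ j) (A x) - A x\<close>. As \<open>A x\<close> need not lie in \<open>D\<close>,
  each of them is estimated through an auxiliary \<open>z\<close> in \<open>D\<close>, whose own
  increments are of size \<open>j * h * N (A z)\<close>; the bound depends on \<open>k\<close> and
  \<open>h\<close> only through \<open>k * h\<close> and so survives the limit.\<close>

lemma Jn_taylor:
  assumes x: "x \<in> D" and z: "z \<in> D" and h: "0 < h"
  shows "N ((J h ^^ k) x - x - (real k * h) *\<^sub>R A x) \<le> real k * h * (2 * N (A x - z) + real k * h * N (A z))"
proof (induction k)
  case (Suc k)
  have e: "(J h ^^ Suc k) x - x - (real (Suc k) * h) *\<^sub>R A x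
      = ((J h ^^ k) x - x - (real k * h) *\<^sub>R A x) + h *\<^sub>R ((J h ^^ Suc k) (A x) - A x)"
    using Jn_step[OF h x, of k] by (simp add: algebra_simps)
  have "(J h ^^ Suc k) (A x) - A x = (J h ^^ Suc k) (A x - z) + ((J h ^^ Suc k) z - z) - (A x - z)"
    using x z h by (subst Jn_diff) auto
  then have "N ((J h ^^ Suc k) (A x) - A x) \<le> N ((J h ^^ Suc k) (A x - z)) + N ((J h ^^ Suc k) z - z) + N (A x - z)"
    using N_triangle_diff[of "(J h ^^ Suc k) (A x - z) + ((J h ^^ Suc k) z - z)" "A x - z"]
        N_triangle[of "(J h ^^ Suc k) (A x - z)" "(J h ^^ Suc k) z - z"] by simp
  also have "\<dots> \<le> N (A x - z) + real (Suc k) * h * N (A z) + N (A x - z)"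
    using x z h by (intro add_mono Jn_N Jn_move) auto
  finally have 1: "N ((J h ^^ Suc k) (A x) - A x) \<le> 2 * N (A x - z) + real (Suc k) * h * N (A z)"
    by simp
  have "N ((J h ^^ Suc k) x - x - (real (Suc k) * h) *\<^sub>R A x)
      \<le> N ((J h ^^ k) x - x - (real k * h) *\<^sub>R A x) + h * N ((J h ^^ Suc k) (A x) - A x)"
    unfolding e using N_triangle[of "(J h ^^ k) x - x - (real k * h) *\<^sub>R A x" "h *\<^sub>R ((J h ^^ Suc k) (A x) - A x)"] h
    by (simp add: N_scaleR)
  also have "\<dots> \<le> real k * h * (2 * N (A x - z) + real k * h * N (A z)) + h * (2 * N (A x - z) + real (Suc k) * h * N (A z))"
    using Suc 1 h by (intro add_mono mult_left_mono) auto
  also have "\<dots> \<le> real k * h * (2 * N (A x - z) + real (Suc k) * h * N (A z)) + h * (2 * N (A x - z) + real (Suc k) * h * N (A z))"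
    using h by (intro add_right_mono mult_left_mono add_left_mono mult_right_mono) auto
  finally show ?case by (simp add: algebra_simps)
qed simp

lemma T_taylor:
  assumes x: "x \<in> D" and z: "z \<in> D" and h: "0 \<le> h"
  shows "N (T h x - x - h *\<^sub>R A x) \<le> h * (2 * N (A x - z) + h * N (A z))"
proof (rule tendsto_le)
  show "(\<lambda>n. N (E h n x - x - (real (steps h n) * (1 / real (Suc n))) *\<^sub>R A x)) \<longlonglongrightarrow> N (T h x - x - h *\<^sub>R A x)"
    using T_lim[of x h] T_X[of x h] x h by (intro tendsto_N tendsto_intros steps_lim) auto
  show "(\<lambda>n. (real (steps h n) * (1 / real (Suc n))) * (2 * N (A x - z) + (real (steps h n) * (1 / real (Suc n))) * N (A z)))
     \<longlonglongrightarrow> h * (2 * N (A x - z) + h * N (A z))"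
    by (intro tendsto_intros steps_lim h)
  show "\<forall>\<^sub>F n in sequentially. N (E h n x - x - (real (steps h n) * (1 / real (Suc n))) *\<^sub>R A x)
      \<le> (real (steps h n) * (1 / real (Suc n))) * (2 * N (A x - z) + (real (steps h n) * (1 / real (Suc n))) * N (A z))"
    unfolding E_def using Jn_taylor[OF x z, of "1 / real (Suc _)"] by (intro always_eventually allI) simp
qed simp

lemma T_derivative:
  assumes x: "x \<in> D"
  shows "((\<lambda>h. N ((1 / h) *\<^sub>R (T h x - x) - A x)) \<longlongrightarrow> 0) (at_right 0)"
proof (rule tendstoI)
  fix e :: real assume e: "0 < e"
  \<comment> \<open>First \<open>z\<close> is fixed close to \<open>A x\<close>, then
    \<open>h\<close> is taken small relative to \<open>A z\<close>.\<close>
  obtain z where z: "z \<in> D" "N (A x - z) < e / 4"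
    using D_approx[of "A x" "e / 4"] x e by auto
  have "((\<lambda>h. h * N (A z)) \<longlongrightarrow> 0 * N (A z)) (at_right 0)"
    by (intro tendsto_intros)
  then have "\<forall>\<^sub>F h in at_right 0. h * N (A z) < e / 2"
    using e by (intro order_tendstoD) auto
  moreover have "\<forall>\<^sub>F h::real in at_right 0. 0 < h"
    by (simp add: eventually_at_right_less)
  ultimately show "\<forall>\<^sub>F h in at_right 0. dist (N ((1 / h) *\<^sub>R (T h x - x) - A x)) 0 < e"
  proof eventually_elim
    case (elim h)
    have "(1 / h) *\<^sub>R (T h x - x) - A x = (1 / h) *\<^sub>R (T h x - x - h *\<^sub>R A x)"
      using elim by (simp add: scaleR_diff_right)
    then have "N ((1 / h) *\<^sub>R (T h x - x) - A x) = (1 / h) * N (T h x - x - h *\<^sub>R A x)"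
      using elim by (simp only: N_scaleR) simp
    also have "\<dots> \<le> (1 / h) * (h * (2 * N (A x - z) + h * N (A z)))"
      using elim T_taylor[OF x z(1), of h] by (intro mult_left_mono) auto
    also have "\<dots> < e" using elim z by simp
    finally show ?case by simp
  qed
qed

text \<open>The generator of the semigroup is dissipative and extends \<^term>\<open>A\<close>, which is maximal.\<close>

lemma T_generator_sub:
  assumes x: "x \<in> X" and y: "y \<in> X"
    and lim: "((\<lambda>h. N ((1 / h) *\<^sub>R (T h x - x) - y)) \<longlongrightarrow> 0) (at_right 0)"
  shows "x \<in> D"
proof -
  \<comment> \<open>By solving x' - A x' = x - y, the difference \<open>d\<close> becomes an
    eigenvector of the generator for the eigenvalue 1; a contraction semigroup admits none, so
    \<open>d\<close> must vanish.\<close>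
  define x' where "x' = J 1 (x - y)"
  have x': "x' \<in> D" "x' - A x' = x - y"
    using x y J_eq[of 1 "x - y"] by (auto simp: x'_def)
  define d where "d = x - x'"
  have d: "d \<in> X" using x x' by (auto simp: d_def)
  have yA: "y - A x' = d" using x' by (simp add: d_def algebra_simps)
  have lim_d: "((\<lambda>h. N ((1 / h) *\<^sub>R (T h d - d) - d)) \<longlongrightarrow> 0) (at_right 0)"
  proof (rule Lim_null_comparison)
    show "((\<lambda>h. N ((1 / h) *\<^sub>R (T h x - x) - y) + N ((1 / h) *\<^sub>R (T h x' - x') - A x')) \<longlongrightarrow> 0) (at_right 0)"
      using tendsto_add[OF lim T_derivative[OF x'(1)]] by simp
    show "\<forall>\<^sub>F h in at_right 0. norm (N ((1 / h) *\<^sub>R (T h d - d) - d))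
        \<le> N ((1 / h) *\<^sub>R (T h x - x) - y) + N ((1 / h) *\<^sub>R (T h x' - x') - A x')"
      using eventually_at_right_less[of 0]
    proof eventually_elim
      case (elim h)
      have "(1 / h) *\<^sub>R (T h d - d) - d = ((1 / h) *\<^sub>R (T h x - x) - y) - ((1 / h) *\<^sub>R (T h x' - x') - A x')"
      proof -
        have "T h d - d = (T h x - x) - (T h x' - x')"
          using x x' elim by (simp add: T_diff d_def)
        then have "(1 / h) *\<^sub>R (T h d - d) = (1 / h) *\<^sub>R (T h x - x) - (1 / h) *\<^sub>R (T h x' - x')"
          by (simp only: scaleR_diff_right)
        moreover have "P - Q - d = P - y - (Q - A x')" for P Q
          using yA by (simp add: algebra_simps)
        ultimately show ?thesis by (simp only:)
      qed
      then show ?case by (simp add: N_triangle_diff)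
    qed
  qed
  have "\<forall>\<^sub>F h in at_right 0. N d \<le> N ((1 / h) *\<^sub>R (T h d - d) - d)"
    using eventually_at_right_less[of 0]
  proof eventually_elim
    case (elim h)
    \<comment> \<open>\<open>T h d\<close> is no longer than \<open>d\<close>, so taking
      \<open>(1 / h) T h d\<close> away from \<open>(1 + 1 / h) d\<close> leaves at least the length
      of \<open>d\<close>; yet the remainder tends to zero.\<close>
    have "(1 + 1 / h) * N d = N ((1 + 1 / h) *\<^sub>R d)" 
      using elim by (simp add: N_scaleR)
    also have "(1 + 1 / h) *\<^sub>R d = (1 / h) *\<^sub>R T h d - ((1 / h) *\<^sub>R (T h d - d) - d)"
      by (simp add: algebra_simps)
    also have "N \<dots> \<le> N ((1 / h) *\<^sub>R T h d) + N ((1 / h) *\<^sub>R (T h d - d) - d)"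
      by (rule N_triangle_diff)
    also have "N ((1 / h) *\<^sub>R T h d) \<le> (1 / h) * N d"
      using elim d T_N[of d h] by (simp add: N_scaleR divide_right_mono)
    finally show ?case by (simp add: algebra_simps)
  qed
  then have "N d \<le> 0"
    by (rule tendsto_lowerbound[OF lim_d]) simp
  then have "N d = 0" using N_nonneg[of d] by linarith
  then have "d = 0" using N_eq_0 d by simp
  then show ?thesis using x' by (simp add: d_def)
qed

text \<open>Convergence to zero and boundedness do not distinguish between gauges comparable to the
  ambient norm on \<open>X\<close>. Dissipativity is tied to \<open>N\<close>, while
  \<open>N'\<close> is free: this permits generating in one norm and concluding in another.\<close>

theorem infinitesimal_generator:
  assumes c': "0 < c'" and N': "\<And>x. x \<in> X \<Longrightarrow> c' * norm x \<le> N' x \<and> N' x \<le> C' * norm x"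
  shows "infinitesimal_generator X N' D A"
proof -
  have eq: "((\<lambda>h. N' (f h)) \<longlongrightarrow> 0) (at_right 0) \<longleftrightarrow> ((\<lambda>h. N (f h)) \<longlongrightarrow> 0) (at_right 0)"
    if "\<And>h. 0 < h \<Longrightarrow> f h \<in> X" for f :: "real \<Rightarrow> 'a"
  proof -
    have "\<forall>\<^sub>F h in at_right 0. f h \<in> X"
      using eventually_at_right_less[of 0] by eventually_elim (use that in auto)
    then show ?thesis
      using tendsto_norm_equiv[OF c' N', where f = f] N_tendsto0[of f] by blast
  qed
  have "bounded_op X N' (T t)" if t: "0 \<le> t" for t
    unfolding bounded_op_def
  proof (intro conjI ballI allI exI[of _ "C' / c * (C / c')"])
    fix x assume x: "x \<in> X"
    have nonneg: "0 \<le> N' x" "0 \<le> N' (T t x)" if "x \<in> X" for x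
      using N'[OF that] N'[OF T_X[OF that t]] c' by (auto intro: order_trans[rotated])
    have "norm (T t x) \<le> N (T t x) / c"
      using N_lower[of "T t x"] T_X[OF x t] c_pos by (simp add: field_simps)
    also have "\<dots> \<le> C * norm x / c"
      using T_N[OF x t] N_upper[OF x] c_pos by (intro divide_right_mono) auto
    finally have 1: "norm (T t x) \<le> C / c * norm x" by simp
    show "N' (T t x) \<le> C' / c * (C / c') * N' x"
    proof (cases "x = 0")
      case True
      then have "T t x = 0" using T_scaleR[of 0 t 0] t by simp
      moreover have "N' 0 = 0" using N'[of 0] by (intro order_antisym) auto
      ultimately show ?thesis using True by simp
    next
      case False
      then have nx: "0 < norm x" by simp
      \<comment> \<open>Positivity of the upper constants \<open>C\<close> and \<open>C'\<close> is
        not among the assumptions; a nonzero element of \<open>X\<close> forces it.\<close>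
      have "0 < c * norm x" using c_pos nx by simp
      then have C: "0 < C" using N_lower[OF x] N_upper[OF x] nx 
        by (smt (verit) mult_nonpos_nonneg)
      have "0 < c' * norm x" using c' nx by simp
      then have C': "0 < C'" using N'[OF x] nx
        by (smt (verit) mult_nonpos_nonneg)
      have "N' (T t x) \<le> C' * norm (T t x)" using N'[of "T t x"] T_X[OF x t] by simp
      also have "\<dots> \<le> C' * (C / c * norm x)" using 1 C' by (intro mult_left_mono) auto
      also have "\<dots> \<le> C' * (C / c * (N' x / c'))"
        using C C' c_pos c' N'[OF x] by (intro mult_left_mono) (auto simp: field_simps)
      finally show ?thesis by (simp add: ac_simps)
    qed
  qed (use t in \<open>auto simp: T_X T_add T_scaleR\<close>)
  then have "C0_semigroup X N' T"
    unfolding C0_semigroup_def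
  proof (intro conjI ballI allI impI)
    fix x assume x: "x \<in> X"
    show "((\<lambda>h. N' (T h x - x)) \<longlongrightarrow> 0) (at_right 0)"
      using eq[of "\<lambda>h. T h x - x"] x T_X[OF x] T_continuous[OF x] by simp
  qed (simp_all add: T_zero T_semigroup)
  moreover have eqD: "((\<lambda>h. N' ((1 / h) *\<^sub>R (T h x - x) - y)) \<longlongrightarrow> 0) (at_right 0)
      \<longleftrightarrow> ((\<lambda>h. N ((1 / h) *\<^sub>R (T h x - x) - y)) \<longlongrightarrow> 0) (at_right 0)" if "x \<in> X" "y \<in> X" for x y
    using that eq[of "\<lambda>h. (1 / h) *\<^sub>R (T h x - x) - y"] by (simp add: T_X)
  have "generates_semigroup X N' D A T"
    unfolding generates_semigroup_def
  proof (intro conjI ballI)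
    show "D = {x \<in> X. \<exists>y\<in>X. ((\<lambda>h. N' ((1 / h) *\<^sub>R (T h x - x) - y)) \<longlongrightarrow> 0) (at_right 0)}"
    proof (intro set_eqI iffI CollectI conjI)
      fix x assume x: "x \<in> D"
      show "x \<in> X" using x by simp
      show "\<exists>y\<in>X. ((\<lambda>h. N' ((1 / h) *\<^sub>R (T h x - x) - y)) \<longlongrightarrow> 0) (at_right 0)"
        using eqD[of x "A x"] T_derivative[OF x] x by (intro bexI[of _ "A x"]) simp_all
    next
      fix x assume "x \<in> {x \<in> X. \<exists>y\<in>X. ((\<lambda>h. N' ((1 / h) *\<^sub>R (T h x - x) - y)) \<longlongrightarrow> 0) (at_right 0)}"
      then obtain y where "x \<in> X" "y \<in> X" "((\<lambda>h. N' ((1 / h) *\<^sub>R (T h x - x) - y)) \<longlongrightarrow> 0) (at_right 0)"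
        by (elim CollectE conjE bexE)
      then show "x \<in> D" using T_generator_sub[of x y] eqD[of x y] by simp
    qed
  next
    fix x assume x: "x \<in> D"
    show "A x \<in> X" using x by simp
    show "((\<lambda>h. N' ((1 / h) *\<^sub>R (T h x - x) - A x)) \<longlongrightarrow> 0) (at_right 0)"
      using eqD[of x "A x"] T_derivative[OF x] x by simp
  qed
  ultimately show ?thesis
    unfolding infinitesimal_generator_def by blast
qed

end

section \<open>Maximal dissipativity from bounded invertibility in a Hilbert space norm\<close>

locale hilbert_dissipative =
  fixes X :: "'a::real_normed_vector set" and B :: "'a \<Rightarrow> 'a \<Rightarrow> real" and c :: real
    and D :: "'a set" and A :: "'a \<Rightarrow> 'a" and K :: real
  assumes subspace_X: "subspace X" and complete_X: "complete X"
    and bilin: "bounded_bilinear B" and B_sym: "B x y = B y x" and B_nonneg: "0 \<le> B x x"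
    and c_pos: "0 < c" and B_lower: "x \<in> X \<Longrightarrow> c * (norm x)\<^sup>2 \<le> B x x"
    and subspace_D: "subspace D" and D_sub: "D \<subseteq> X"
    and A_mem: "x \<in> D \<Longrightarrow> A x \<in> X"
    and A_add: "x \<in> D \<Longrightarrow> y \<in> D \<Longrightarrow> A (x + y) = A x + A y"
    and A_scaleR: "x \<in> D \<Longrightarrow> A (s *\<^sub>R x) = s *\<^sub>R A x"
    and B_dissip: "x \<in> D \<Longrightarrow> B (A x) x \<le> 0"
    and A_onto: "y \<in> X \<Longrightarrow> \<exists>x\<in>D. A x = y"
    and A_coercive: "x \<in> D \<Longrightarrow> norm x \<le> K * norm (A x)"
begin

interpretation B: bounded_bilinear B by (rule bilin)

text \<open>\<open>B\<close> may be degenerate outside \<open>X\<close>, so the discriminant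
  argument has to treat \<open>B y y = 0\<close> separately.\<close>

lemma Cauchy_Schwarz_form: "(B x y)\<^sup>2 \<le> B x x * B y y"
proof -
  have *: "0 \<le> B x x + 2 * t * B x y + t\<^sup>2 * B y y" for t
    using B_nonneg[of "x + t *\<^sub>R y"] B_sym[of y x]
    by (simp add: B.add_left B.add_right B.scaleR_left B.scaleR_right power2_eq_square algebra_simps)
  show ?thesis
  proof (cases "B y y = 0")
    case True
    have "B x y = 0"
    proof (rule ccontr)
      assume n: "B x y \<noteq> 0"
      \<comment> \<open>Without its quadratic term the expression is affine in the parameter, and
        this value would make it equal to -1.\<close>
      then have "2 * (- (B x x + 1) / (2 * B x y)) * B x y = - (B x x + 1)" by simp
      then show False using *[of "- (B x x + 1) / (2 * B x y)"] True by simp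
    qed
    then show ?thesis using True by simp
  next
    case False
    then have y: "0 < B y y" using B_nonneg[of y] by simp
    have "0 \<le> B y y * (B x x + 2 * (- B x y / B y y) * B x y + (- B x y / B y y)\<^sup>2 * B y y)"
      using *[of "- B x y / B y y"] y by (intro mult_nonneg_nonneg) auto
    also have "\<dots> = B x x * B y y - (B x y)\<^sup>2"
      using y by (simp add: field_simps power2_eq_square)
    finally show ?thesis by simp
  qed
qed

definition N where "N x = sqrt (B x x)"

lemma N_sq: "(N x)\<^sup>2 = B x x"
  by (simp add: N_def B_nonneg)

lemma form_le: "B x y \<le> N x * N y"
  using real_sqrt_le_mono[OF Cauchy_Schwarz_form[of x y]] by (simp add: N_def real_sqrt_mult)

lemma equivalent_norm_exists: "\<exists>C. equivalent_norm X N (sqrt c) C"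
proof -
  obtain C where C: "0 < C" "\<And>x y. norm (B x y) \<le> norm x * norm y * C"
    using B.pos_bounded by blast
  have "equivalent_norm X N (sqrt c) (sqrt C)"
  proof
    fix x y and s :: real
    show "N (x + y) \<le> N x + N y"
    proof (rule power2_le_imp_le)
      have "(N (x + y))\<^sup>2 = (N x)\<^sup>2 + 2 * B x y + (N y)\<^sup>2"
        using B_sym[of y x] by (simp add: N_sq B.add_left B.add_right)
      then show "(N (x + y))\<^sup>2 \<le> (N x + N y)\<^sup>2"
        using form_le[of x y] by (simp add: power2_sum)
    qed (simp add: N_def B_nonneg)
    show "N (s *\<^sub>R x) = \<bar>s\<bar> * N x"
      by (simp add: N_def B.scaleR_left B.scaleR_right real_sqrt_mult flip: mult.assoc power2_eq_square)
    show "sqrt c * norm x \<le> N x" if "x \<in> X"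
      using real_sqrt_le_mono[OF B_lower[OF that]] by (simp add: N_def real_sqrt_mult)
    have "B x x \<le> C * (norm x)\<^sup>2"
      using C(2)[of x x] by (simp add: power2_eq_square ac_simps)
    then show "N x \<le> sqrt C * norm x"
      unfolding N_def using real_sqrt_le_mono by (fastforce simp: real_sqrt_mult)
  qed (use subspace_X complete_X c_pos in auto)
  then show ?thesis by blast
qed

lemma D_add: "x \<in> D \<Longrightarrow> y \<in> D \<Longrightarrow> x + y \<in> D" and D_scaleR: "x \<in> D \<Longrightarrow> s *\<^sub>R x \<in> D"
  and D_diff: "x \<in> D \<Longrightarrow> y \<in> D \<Longrightarrow> x - y \<in> D" and D_X: "x \<in> D \<Longrightarrow> x \<in> X"
  using subspace_D D_sub by (auto simp: subspace_add subspace_scale subspace_diff)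

lemma X_closed: "x \<in> X \<Longrightarrow> y \<in> X \<Longrightarrow> x + y \<in> X" "x \<in> X \<Longrightarrow> s *\<^sub>R x \<in> X"
  "x \<in> X \<Longrightarrow> y \<in> X \<Longrightarrow> x - y \<in> X"
  using subspace_X by (auto simp: subspace_add subspace_scale subspace_diff)

lemma A_diff: "x \<in> D \<Longrightarrow> y \<in> D \<Longrightarrow> A (x - y) = A x - A y"
  using A_add[of "x - y" y] by (simp add: D_diff)

text \<open>Expanding the square, the two terms that come with \<open>s\<close> are nonnegative. So
  the lower bound for \<open>A\<close> passes to all nonnegative shifts at once.\<close>

lemma shift_lower: "x \<in> D \<Longrightarrow> 0 \<le> s \<Longrightarrow> B (A x) (A x) \<le> B (s *\<^sub>R x - A x) (s *\<^sub>R x - A x)"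
proof -
  assume x: "x \<in> D" and s: "0 \<le> s"
  have "B (s *\<^sub>R x - A x) (s *\<^sub>R x - A x) = s\<^sup>2 * B x x - 2 * s * B (A x) x + B (A x) (A x)"
    using B_sym[of x "A x"] 
    by (simp add: B.diff_left B.diff_right B.scaleR_left B.scaleR_right power2_eq_square algebra_simps)
  then show ?thesis
    using mult_nonneg_nonneg[OF zero_le_power2 B_nonneg, of s x] mult_nonneg_nonpos[OF s B_dissip[OF x]] by simp
qed

text \<open>\<open>shift_lower\<close> reduces every shift to the unshifted operator, for which
  \<open>A_coercive\<close> holds; \<open>L\<close> is therefore independent of \<open>s\<close>,
  which is what the continuity method needs.\<close>

lemma shift_coercive:
  obtains L where "0 < L" "\<And>s x. 0 \<le> s \<Longrightarrow> x \<in> D \<Longrightarrow> norm x \<le> L * norm (s *\<^sub>R x - A x)"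
proof -
  obtain C where "equivalent_norm X N (sqrt c) C" using equivalent_norm_exists by blast
  then interpret equivalent_norm X N "sqrt c" C .
  define L where "L = \<bar>K * C\<bar> / sqrt c + 1"
  have "0 < L" using c_pos by (auto simp: L_def intro!: add_nonneg_pos divide_nonneg_pos)
  moreover have "norm x \<le> L * norm (s *\<^sub>R x - A x)" if "0 \<le> s" "x \<in> D" for s x
  proof -
    have "sqrt c * norm (A x) \<le> N (A x)"
      using that by (intro N_lower A_mem)
    also have "\<dots> \<le> N (s *\<^sub>R x - A x)"
      unfolding N_def using shift_lower[OF that(2,1)] by simp
    also have "\<dots> \<le> C * norm (s *\<^sub>R x - A x)"
      using that by (intro N_upper X_closed D_X A_mem)
    finally have 1: "norm (A x) \<le> C * norm (s *\<^sub>R x - A x) / sqrt c"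
      using c_pos by (simp add: field_simps)
    have "norm x \<le> \<bar>K\<bar> * norm (A x)"
      using A_coercive[OF that(2)] by (rule order_trans) (intro mult_right_mono, auto)
    also have "\<dots> \<le> \<bar>K\<bar> * (\<bar>C\<bar> * norm (s *\<^sub>R x - A x) / sqrt c)"
      using c_pos by (intro mult_left_mono order_trans[OF 1] divide_right_mono mult_right_mono) auto
    also have "\<dots> \<le> L * norm (s *\<^sub>R x - A x)"
      using norm_ge_zero[of "s *\<^sub>R x - A x"] by (simp only: L_def abs_mult distrib_right) (simp add: field_simps)
    finally show ?thesis .
  qed
  ultimately show ?thesis by (rule that)
qed

lemma shift_inj:
  assumes "0 \<le> s" "x \<in> D" "y \<in> D" "s *\<^sub>R x - A x = s *\<^sub>R y - A y" shows "x = y"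
proof -
  obtain L where L: "0 < L" "\<And>s x. 0 \<le> s \<Longrightarrow> x \<in> D \<Longrightarrow> norm x \<le> L * norm (s *\<^sub>R x - A x)"
    using shift_coercive by blast
  have "s *\<^sub>R (x - y) - A (x - y) = 0"
    using assms by (simp add: A_diff algebra_simps)
  then have "norm (x - y) \<le> 0"
    using L(2)[OF assms(1) D_diff[OF assms(2,3)]] by simp
  then show ?thesis by simp
qed

text \<open>The continuity method: as the lower bound does not depend on the shift, surjectivity
  propagates from shift \<open>0\<close> in steps of a fixed size.\<close>

lemma shift_onto:
  assumes s: "0 \<le> s" and y: "y \<in> X" shows "\<exists>x\<in>D. s *\<^sub>R x - A x = y"
proof -
  obtain L where L: "0 < L" "\<And>s x. 0 \<le> s \<Longrightarrow> x \<in> D \<Longrightarrow> norm x \<le> L * norm (s *\<^sub>R x - A x)"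
    using shift_coercive by blast
  have step: "\<exists>x\<in>D. (s + d) *\<^sub>R x - A x = y"
    if s: "0 \<le> s" and IH: "\<And>y. y \<in> X \<Longrightarrow> \<exists>x\<in>D. s *\<^sub>R x - A x = y" and d: "0 \<le> d" "d * L \<le> 1 / 2" and y: "y \<in> X" 
    for s d y
  proof -
    obtain R where R: "\<And>u. u \<in> X \<Longrightarrow> R u \<in> D \<and> s *\<^sub>R R u - A (R u) = u"
      using IH by metis
    \<comment> \<open>The equation for the shift \<open>s + d\<close> reads
      \<open>x = R (y - d x)\<close>. As \<open>R\<close> inverts the operator with shift
      \<open>s\<close>, it has Lipschitz constant \<open>L\<close>, so the right-hand side contracts
      by the factor \<open>d * L\<close>.\<close>
    define F where "F x = R (y - d *\<^sub>R x)" for x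
    have F: "F x \<in> D" "s *\<^sub>R F x - A (F x) = y - d *\<^sub>R x" if "x \<in> X" for x
      using R[of "y - d *\<^sub>R x"] y that by (auto simp: F_def X_closed)
    have "\<exists>!x\<in>X. F x = x"
    proof (rule Banach_fix[OF complete_X _ _ _ _ ])
      show "X \<noteq> {}" using y by auto
      show "F ` X \<subseteq> X" using F D_X by auto
      show "dist (F x) (F z) \<le> 1 / 2 * dist x z" if "x \<in> X" "z \<in> X" for x z
      proof -
        have "s *\<^sub>R (F x - F z) - A (F x - F z) = (s *\<^sub>R F x - A (F x)) - (s *\<^sub>R F z - A (F z))"
          using F that by (simp add: A_diff algebra_simps)
        also have "\<dots> = d *\<^sub>R (z - x)"
          using F that by (simp add: algebra_simps)
        finally have "norm (F x - F z) \<le> L * norm (d *\<^sub>R (z - x))"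
          using L(2)[OF s D_diff[OF F(1) F(1)], OF that] by simp
        also have "\<dots> = (d * L) * norm (x - z)"
          using d by (simp add: norm_minus_commute)
        also have "\<dots> \<le> 1 / 2 * norm (x - z)"
          using d by (intro mult_right_mono) auto
        finally show ?thesis by (simp add: dist_norm)
      qed
    qed auto
    then obtain x where "x \<in> X" "F x = x" by auto
    then show ?thesis
      using F[of x] by (intro bexI[of _ x]) (auto simp: algebra_simps)
  qed
  \<comment> \<open>Enough steps that each has length at most 1/(2 L).\<close>
  obtain n where n: "s * L * 2 < real n" using reals_Archimedean2 by blast
  then have n0: "0 < real n"
    using s L by (smt (verit) mult_nonneg_nonneg)
  define d where "d = s / real n"
  have d: "0 \<le> d" "d * L \<le> 1 / 2" using s n n0 by (auto simp: d_def field_simps)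
  have "\<forall>y\<in>X. \<exists>x\<in>D. (real k * d) *\<^sub>R x - A x = y" for k
  proof (induction k)
    case 0
    show ?case
    proof
      fix y assume "y \<in> X"
      then have "(-1) *\<^sub>R y \<in> X" by (rule X_closed)
      then obtain x where "x \<in> D" "A x = - y" using A_onto by auto
      then show "\<exists>x\<in>D. (real 0 * d) *\<^sub>R x - A x = y" by (intro bexI[of _ x]) auto
    qed
  next
    case (Suc k)
    then show ?case
      using step[of "real k * d" d] d by (auto simp: algebra_simps)
  qed
  from this[of n] show ?thesis using y n0 by (simp add: d_def)
qed

text \<open>The resolvents \<open>u n\<close> of \<open>y\<close> converge to the orthogonal
  projection of \<open>y\<close> onto the closure of \<open>D\<close>, so the projection comes out
  as an explicit limit. The residual \<open>v\<close> is orthogonal to \<open>D\<close> and has the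
  form x - A x with x in \<open>D\<close>; hence \<open>B x x = B (A x) x\<close>, which is at most
  0, and everything vanishes.\<close>

lemma D_dense: "X \<subseteq> closure D"
proof
  fix y assume y: "y \<in> X"
  obtain C where "equivalent_norm X N (sqrt c) C" using equivalent_norm_exists by blast
  then interpret eqn: equivalent_norm X N "sqrt c" C .
  have "\<exists>x\<in>D. real (Suc n) *\<^sub>R x - A x = real (Suc n) *\<^sub>R y" for n
    using y by (intro shift_onto X_closed) auto
  then obtain u where u: "\<And>n. u n \<in> D" "\<And>n. real (Suc n) *\<^sub>R u n - A (u n) = real (Suc n) *\<^sub>R y"
    by metis
  define w where "w n = y - u n" for n
  have w: "w n \<in> X" for n using y u D_X by (simp add: w_def X_closed)
  have Au: "A (u n) = - real (Suc n) *\<^sub>R w n" for n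
    using u(2)[of n] by (simp add: w_def algebra_simps)
  \<comment> \<open>Dissipativity of the difference \<open>u m - u n\<close> shows that the squared
    norms of \<open>w\<close> decrease and that their drop controls the distance of two terms; so
    \<open>w\<close> is Cauchy.\<close>
  have key: "B (w m - w n) (w m - w n) \<le> B (w m) (w m) - B (w n) (w n)" if mn: "m \<le> n" for m n
  proof -
    define p where "p = real (Suc m)"
    define q where "q = real (Suc n)"
    have pq: "0 < p" "p \<le> q" using mn by (auto simp: p_def q_def)
    have "A (u m - u n) = q *\<^sub>R w n - p *\<^sub>R w m"
      unfolding A_diff[OF u(1) u(1)] Au p_def q_def by (simp add: scaleR_left_distrib del: of_nat_Suc)
    moreover have "u m - u n = w n - w m" by (simp add: w_def)
    ultimately have "B (q *\<^sub>R w n - p *\<^sub>R w m) (w n - w m) \<le> 0"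
      using B_dissip[OF D_diff, OF u(1) u(1), of m n] by simp
    then have f: "p * B (w m) (w m) + q * B (w n) (w n) \<le> (p + q) * B (w m) (w n)"
      using B_sym[of "w n" "w m"]
      by (simp add: B.diff_left B.diff_right B.scaleR_left B.scaleR_right algebra_simps)
    have e: "B (w m - w n) (w m - w n) = B (w m) (w m) + B (w n) (w n) - 2 * B (w m) (w n)"
      using B_sym[of "w n" "w m"] by (simp add: B.diff_left B.diff_right)
    have 1: "(p + q) * B (w m - w n) (w m - w n) \<le> (q - p) * (B (w m) (w m) - B (w n) (w n))"
      unfolding e using f by (simp add: algebra_simps)
    have "0 \<le> (p + q) * B (w m - w n) (w m - w n)"
      using pq B_nonneg by simp
    with 1 have 2: "p = q \<or> 0 \<le> B (w m) (w m) - B (w n) (w n)"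
      using pq by (smt (verit) mult_pos_neg)
    show ?thesis
    proof (cases "p = q")
      case True
      then have "m = n" by (simp add: p_def q_def)
      then show ?thesis by (simp add: B.zero_left)
    next
      case False
      then have "(q - p) * (B (w m) (w m) - B (w n) (w n)) \<le> (p + q) * (B (w m) (w m) - B (w n) (w n))"
        using 2 pq by (intro mult_right_mono) auto
      then show ?thesis using 1 pq
        by (meson add_pos_pos dual_order.trans less_le_trans mult_le_cancel_left_pos)
    qed
  qed
  have "decseq (\<lambda>n. B (w n) (w n))"
    unfolding decseq_def using key B_nonneg by (smt (verit))
  then obtain L where "(\<lambda>n. B (w n) (w n)) \<longlonglongrightarrow> L"
    using decseq_convergent[of "\<lambda>n. B (w n) (w n)" 0] B_nonneg by blast
  then have Cau: "Cauchy (\<lambda>n. B (w n) (w n))" by (rule LIMSEQ_imp_Cauchy)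
  have "Cauchy w"
  proof (rule CauchyI)
    fix e :: real assume e: "0 < e"
    then have "0 < c * e\<^sup>2" using c_pos by simp
    then obtain M where M: "\<And>m n. m \<ge> M \<Longrightarrow> n \<ge> M \<Longrightarrow> norm (B (w m) (w m) - B (w n) (w n)) < c * e\<^sup>2"
      using CauchyD[OF Cau] by blast
    have "norm (w m - w n) < e" if "m \<ge> M" "n \<ge> M" for m n
    proof -
      have "B (w m - w n) (w m - w n) \<le> norm (B (w m) (w m) - B (w n) (w n))"
      proof (cases "m \<le> n")
        case True
        then show ?thesis using key[OF True] by simp
      next
        case False
        have "B (w m - w n) (w m - w n) = B (w n - w m) (w n - w m)"
          by (metis B.minus_left B.minus_right minus_diff_eq add.inverse_inverse)
        then show ?thesis using key[of n m] False by simp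
      qed
      then have "c * (norm (w m - w n))\<^sup>2 < c * e\<^sup>2"
        using B_lower[of "w m - w n"] w M[OF that] by (auto simp: X_closed)
      then have "(norm (w m - w n))\<^sup>2 < e\<^sup>2"
        using c_pos by simp
      then show ?thesis using e by (simp add: power2_less_imp_less)
    qed
    then show "\<exists>M. \<forall>m\<ge>M. \<forall>n\<ge>M. norm (w m - w n) < e" by blast
  qed
  then obtain v where v: "v \<in> X" "w \<longlonglongrightarrow> v"
    using completeE[OF complete_X] w by blast
  have u_lim: "u \<longlonglongrightarrow> y - v"
    using tendsto_diff[OF tendsto_const[of y] v(2)] by (simp add: w_def)
  \<comment> \<open>Dissipativity at \<open>u n - z\<close>, divided by -(n+1): the contribution of
    \<open>A z\<close> disappears in the limit.\<close>
  have nonneg: "0 \<le> B v (y - v - z)" if z: "z \<in> D" for z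
  proof (rule tendsto_lowerbound)
    have "(\<lambda>n. w n + inverse (real (Suc n)) *\<^sub>R A z) \<longlonglongrightarrow> v + 0 *\<^sub>R A z"
      by (intro tendsto_intros v LIMSEQ_inverse_real_of_nat)
    then show "(\<lambda>n. B (w n + inverse (real (Suc n)) *\<^sub>R A z) (u n - z)) \<longlonglongrightarrow> B v (y - v - z)"
      by (intro B.tendsto tendsto_intros u_lim) simp
    have "0 \<le> B (w n + inverse (real (Suc n)) *\<^sub>R A z) (u n - z)" for n
    proof -
      have "A (u n - z) = (- real (Suc n)) *\<^sub>R (w n + inverse (real (Suc n)) *\<^sub>R A z)"
        unfolding A_diff[OF u(1) z] Au by (simp add: scaleR_add_right del: of_nat_Suc)
      then have "- real (Suc n) * B (w n + inverse (real (Suc n)) *\<^sub>R A z) (u n - z) \<le> 0"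
        using B_dissip[OF D_diff[OF u(1)[of n] z]] by (simp only: B.scaleR_left) simp
      then show ?thesis
        by (simp add: zero_le_mult_iff del: of_nat_Suc)
    qed
    then show "\<forall>\<^sub>F n in sequentially. 0 \<le> B (w n + inverse (real (Suc n)) *\<^sub>R A z) (u n - z)"
      by simp
  qed simp
  \<comment> \<open>With \<open>t z\<close> in place of \<open>z\<close> an affine function of
    \<open>t\<close> stays bounded above on the whole line, so its slope is zero.\<close>
  have perp: "B v z = 0" if z: "z \<in> D" for z
  proof -
    have "t * B v z \<le> B v (y - v)" for t
      using nonneg[OF D_scaleR[OF z, of t]] by (simp add: B.diff_right B.scaleR_right)
    from this[of "(B v (y - v) + 1) / B v z"] show ?thesis by (auto split: if_splits)
  qed
  obtain x where x: "x \<in> D" "1 *\<^sub>R x - A x = v"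
    using shift_onto[of 1 v] v by auto
  have "B x x - B (A x) x = B v x"
    using x by (simp add: B.diff_left flip: x(2))
  then have "B x x = 0"
    using perp[OF x(1)] B_dissip[OF x(1)] B_nonneg[of x] by simp
  then have "x = 0"
    using B_lower[OF D_X[OF x(1)]] c_pos by (simp add: mult_le_0_iff)
  then have "v = 0"
    using x(2) A_scaleR[OF x(1), of 0] by simp
  then show "y \<in> closure D"
    using u_lim u(1) unfolding closure_sequential by auto
qed

theorem generator:
  assumes "0 < c'" and "\<And>x. x \<in> X \<Longrightarrow> c' * norm x \<le> N' x \<and> N' x \<le> C' * norm x"
  shows "infinitesimal_generator X N' D A"
proof -
  obtain C where "equivalent_norm X N (sqrt c) C" using equivalent_norm_exists by blast
  then interpret equivalent_norm X N "sqrt c" C .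
  have "m_dissipative X N (sqrt c) C D A"
  proof
    fix h x assume x: "x \<in> D" and h: "(0::real) \<le> h"
    have "B (x - h *\<^sub>R A x) (x - h *\<^sub>R A x) = B x x - 2 * h * B (A x) x + h\<^sup>2 * B (A x) (A x)"
      using B_sym[of x "A x"] 
      by (simp add: B.diff_left B.diff_right B.scaleR_left B.scaleR_right power2_eq_square algebra_simps)
    then have "B x x \<le> B (x - h *\<^sub>R A x) (x - h *\<^sub>R A x)"
      using mult_nonneg_nonneg[OF zero_le_power2 B_nonneg, of h "A x"] mult_nonneg_nonpos[OF h B_dissip[OF x]] by simp
    then show "N x \<le> N (x - h *\<^sub>R A x)" by (simp add: N_def)
  next
    fix h y assume h: "(0::real) < h" and y: "y \<in> X"
    obtain x where x: "x \<in> D" "(1 / h) *\<^sub>R x - A x = (1 / h) *\<^sub>R y"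
      using shift_onto[of "1 / h" "(1 / h) *\<^sub>R y"] h y by (auto simp: X_closed)
    have "h *\<^sub>R ((1 / h) *\<^sub>R x - A x) = h *\<^sub>R ((1 / h) *\<^sub>R y)" by (simp only: x(2))
    then have "x - h *\<^sub>R A x = y" using h by (simp add: scaleR_diff_right)
    then show "\<exists>x\<in>D. x - h *\<^sub>R A x = y" using x by blast
  qed (use subspace_D D_sub D_dense A_mem A_add A_scaleR in auto)
  then show ?thesis
    using assms by (rule m_dissipative.infinitesimal_generator)
qed

lemma shift_bij:
  assumes "0 \<le> s" shows "bij_betw (\<lambda>x. s *\<^sub>R x - A x) D X"
  unfolding bij_betw_def
proof
  show "inj_on (\<lambda>x. s *\<^sub>R x - A x) D"
    using shift_inj[OF assms] by (auto simp: inj_on_def)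
  show "(\<lambda>x. s *\<^sub>R x - A x) ` D = X"
    using shift_onto[OF assms] by (auto simp: image_iff X_closed A_mem D_X dest: sym)
qed

end

section \<open>The space \<open>L\<^sup>2([a,b], \<real>\<^sup>2)\<close>\<close>

lemma L2_rel_refl: "sq_integrable f \<Longrightarrow> L2_rel f f"
  by (simp add: L2_rel_def)

lemma sq_integrable_rep [simp, intro]: "sq_integrable (rep_L2 x)"
  using Quotient3_rep_reflp[OF Quotient3_L2, of x] by (simp add: L2_rel_def)

lemma measurable_rep [measurable]: "rep_L2 x \<in> borel_measurable borel"
  using sq_integrable_rep[of x] by (simp add: sq_integrable_def)

lemma abs_rep_L2 [simp]: "abs_L2 (rep_L2 x) = x"
  by (rule Quotient3_abs_rep[OF Quotient3_L2])

text \<open>\<open>rep_L2\<close> picks an arbitrary member of the class; therefore all pointwise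
  facts about elements of \<open>L2\<close> hold almost everywhere only.\<close>

lemma rep_abs_L2: "sq_integrable f \<Longrightarrow> AE z in lborel. rep_L2 (abs_L2 f) z = f z"
  using Quotient3_rep_abs[OF Quotient3_L2 L2_rel_refl] by (auto simp: L2_rel_def)

lemma L2_eq_iff: "x = y \<longleftrightarrow> (AE z in lborel. rep_L2 x z = rep_L2 y z)"
  using Quotient3_rel_rep[OF Quotient3_L2, of x y] by (auto simp: L2_rel_def)

lemma L2_eqI: "AE z in lborel. rep_L2 x z = rep_L2 y z \<Longrightarrow> x = y"
  using L2_eq_iff by blast

lemma abs_L2_eqI: "sq_integrable f \<Longrightarrow> AE z in lborel. f z = rep_L2 x z \<Longrightarrow> abs_L2 f = x"
  by (rule L2_eqI) (use rep_abs_L2[of f] in \<open>auto elim!: AE_mp\<close>)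

lemma rep_plus: "AE z in lborel. rep_L2 (x + y) z = rep_L2 x z + rep_L2 y z"
  using rep_abs_L2[OF sq_integrable_add, OF sq_integrable_rep sq_integrable_rep, of x y]
  by (simp add: plus_L2.abs_eq[of "rep_L2 x" "rep_L2 y", symmetric, OF L2_rel_refl L2_rel_refl] eq_onp_def)

lemma rep_diff: "AE z in lborel. rep_L2 (x - y) z = rep_L2 x z - rep_L2 y z"
  using rep_abs_L2[OF sq_integrable_diff, OF sq_integrable_rep sq_integrable_rep, of x y]
  by (simp add: minus_L2.abs_eq[of "rep_L2 x" "rep_L2 y", symmetric, OF L2_rel_refl L2_rel_refl])

lemma rep_scaleR: "AE z in lborel. rep_L2 (c *\<^sub>R x) z = c *\<^sub>R rep_L2 x z"
  using rep_abs_L2[OF sq_integrable_scaleR, OF sq_integrable_rep, of c x]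
  by (simp add: scaleR_L2.abs_eq[of "rep_L2 x", symmetric, OF L2_rel_refl])

lemma rep_zero: "AE z in lborel. rep_L2 0 z = 0"
  using rep_abs_L2[OF sq_integrable_zero] by (simp add: zero_L2.abs_eq[symmetric])

lemma inner_rep: "x \<bullet> y = (LINT z|lborel. rep_L2 x z \<bullet> rep_L2 y z)"
  using inner_L2.abs_eq[of "rep_L2 x" "rep_L2 y", OF L2_rel_refl L2_rel_refl] by simp

lemma norm_rep: "(norm x)\<^sup>2 = (LINT z|lborel. (norm (rep_L2 x z))\<^sup>2)" for x :: L2
  by (simp add: power2_norm_eq_inner inner_rep)

lemma integrable_norm_rep: "integrable lborel (\<lambda>z. (norm (rep_L2 x z))\<^sup>2)"
  using sq_integrable_rep[of x] by (simp add: sq_integrable_def)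

lemma L2_interval_iff: "x \<in> L2_interval a b \<longleftrightarrow> (AE z in lborel. z \<notin> {a..b} \<longrightarrow> rep_L2 x z = 0)"
  by (simp add: L2_interval_def)

lemma subspace_L2_interval: "subspace (L2_interval a b)"
proof (rule subspaceI)
  show "0 \<in> L2_interval a b"
    unfolding L2_interval_iff using rep_zero by eventually_elim auto
  show "x + y \<in> L2_interval a b" if "x \<in> L2_interval a b" "y \<in> L2_interval a b" for x y
    using that rep_plus[of x y] unfolding L2_interval_iff by eventually_elim auto
  show "c *\<^sub>R x \<in> L2_interval a b" if "x \<in> L2_interval a b" for x c
    using that rep_scaleR[of c x] unfolding L2_interval_iff by eventually_elim auto
qed

lemma integrable_rep_interval:
  assumes "x \<in> L2_interval a b"
  shows "integrable lborel (rep_L2 x)"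
proof (rule Bochner_Integration.integrable_bound)
  show "integrable lborel (\<lambda>z. indicator {a..b} z + (norm (rep_L2 x z))\<^sup>2 :: real)"
    using integrable_norm_rep by (intro Bochner_Integration.integrable_add integrable_real_indicator)
      (auto simp: emeasure_lborel_Icc_eq)
  have "norm (rep_L2 x z) \<le> indicator {a..b} z + (norm (rep_L2 x z))\<^sup>2"
    if "z \<notin> {a..b} \<longrightarrow> rep_L2 x z = 0" for z
  proof -
    have "norm (rep_L2 x z) \<le> 1 + (norm (rep_L2 x z))\<^sup>2"
      using sum_squares_bound[of "norm (rep_L2 x z)" 1] norm_ge_zero[of "rep_L2 x z"] by (simp only: power_one mult_1_right)
    then show ?thesis using that by (auto simp: indicator_def)
  qed
  then show "AE z in lborel. norm (rep_L2 x z) \<le> norm (indicator {a..b} z + (norm (rep_L2 x z))\<^sup>2 :: real)"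
    using assms unfolding L2_interval_iff by (auto elim!: AE_mp)
qed auto

text \<open>From \<open>t <= d + t^2 / d\<close>. The free parameter does the work of the
  Cauchy-Schwarz inequality: a small \<open>d\<close> gives convergence in L1, and
  \<open>d = norm x\<close> gives a bound linear in the norm.\<close>

lemma L1_le_L2:
  assumes x: "x \<in> L2_interval a b" and d: "0 < d" and "a \<le> b"
  shows "(LINT z|lborel. norm (rep_L2 x z)) \<le> d * (b - a) + (norm x)\<^sup>2 / d"
proof -
  have "(LINT z|lborel. norm (rep_L2 x z)) \<le> (LINT z|lborel. d * indicator {a..b} z + (norm (rep_L2 x z))\<^sup>2 / d)"
  proof (rule integral_mono_AE)
    show "integrable lborel (\<lambda>z. norm (rep_L2 x z))"
      using integrable_rep_interval[OF x] by simp
    show "integrable lborel (\<lambda>z. d * indicator {a..b} z + (norm (rep_L2 x z))\<^sup>2 / d)"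
      using integrable_norm_rep
      by (intro Bochner_Integration.integrable_add integrable_mult_right integrable_real_indicator)
        (auto simp: emeasure_lborel_Icc_eq)
    have "t \<le> d + t\<^sup>2 / d" if "0 \<le> t" for t :: real
    proof -
      have "t * d \<le> d * d + t * t"
        using sum_squares_bound[of t d] mult_nonneg_nonneg[OF that, of d] d 
        unfolding power2_eq_square by linarith
      then show ?thesis using d by (simp add: field_simps power2_eq_square)
    qed
    then have "norm (rep_L2 x z) \<le> d * indicator {a..b} z + (norm (rep_L2 x z))\<^sup>2 / d"
      if "z \<notin> {a..b} \<longrightarrow> rep_L2 x z = 0" for z
      using that by (auto simp: indicator_def)
    then show "AE z in lborel. norm (rep_L2 x z) \<le> d * indicator {a..b} z + (norm (rep_L2 x z))\<^sup>2 / d"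
      using x unfolding L2_interval_iff by (auto elim!: AE_mp)
  qed
  also have "\<dots> = d * (b - a) + (norm x)\<^sup>2 / d"
    using integrable_norm_rep[of x] \<open>a \<le> b\<close>
    by (subst Bochner_Integration.integral_add) (auto simp: norm_rep emeasure_lborel_Icc_eq intro!: integrable_real_indicator)
  finally show ?thesis .
qed

text \<open>Riesz--Fischer.  On a bounded interval an \<open>L\<^sup>2\<close> Cauchy sequence is Cauchy in \<open>L\<^sup>1\<close>, hence has
  a subsequence that converges almost everywhere; Fatou's lemma then gives convergence in \<open>L\<^sup>2\<close>.\<close>

lemma complete_L2_interval:
  assumes ab: "a \<le> b" shows "complete (L2_interval a b)"
proof (rule completeI)
  fix x assume x: "\<forall>n. x n \<in> L2_interval a b" and "Cauchy x"
  have xd: "x m - x n \<in> L2_interval a b" for m n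
    using x subspace_L2_interval by (auto intro: subspace_diff)
  have "AE z in lborel. \<forall>m n. rep_L2 (x m - x n) z = rep_L2 (x m) z - rep_L2 (x n) z"
    unfolding AE_all_countable using rep_diff by blast
  then have rd: "AE z in lborel. rep_L2 (x m - x n) z = rep_L2 (x m) z - rep_L2 (x n) z" for m n
    using rep_diff by blast
  have "\<exists>N. \<forall>i\<ge>N. \<forall>j\<ge>N. LINT z|lborel. norm (rep_L2 (x i) z - rep_L2 (x j) z) < e" if e: "0 < e" for e
  proof -
    \<comment> \<open>\<open>d\<close> makes the first summand of \<open>L1_le_L2\<close> smaller
      than \<open>e / 2\<close>, and \<open>q\<close> then keeps the second one at most
      \<open>e / 2\<close>.\<close>
    define d where "d = e / (2 * (b - a + 1))"
    have d: "0 < d" "d * (b - a) < e / 2"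
      using e ab by (auto simp: d_def field_simps)
    define q where "q = sqrt (d * (e / 2))"
    have q: "0 < q" using d e by (simp add: q_def)
    obtain N where N: "\<And>i j. i \<ge> N \<Longrightarrow> j \<ge> N \<Longrightarrow> norm (x i - x j) < q"
      using CauchyD[OF \<open>Cauchy x\<close> q] by blast
    have "LINT z|lborel. norm (rep_L2 (x i) z - rep_L2 (x j) z) < e" if "i \<ge> N" "j \<ge> N" for i j
    proof -
      have "(norm (x i - x j))\<^sup>2 \<le> q\<^sup>2" using N[OF that] by (intro power_mono) auto
      then have s: "(norm (x i - x j))\<^sup>2 / d \<le> e / 2"
        using d e by (simp add: q_def field_simps)
      have "(LINT z|lborel. norm (rep_L2 (x i) z - rep_L2 (x j) z)) = (LINT z|lborel. norm (rep_L2 (x i - x j) z))"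
        using rd[of i j] by (intro integral_cong_AE) (auto elim!: AE_mp)
      also have "\<dots> \<le> d * (b - a) + (norm (x i - x j))\<^sup>2 / d"
        by (rule L1_le_L2[OF xd d(1) ab])
      finally show ?thesis using d(2) s by linarith
    qed
    then show ?thesis by blast
  qed
  then obtain r where r: "strict_mono r" "AE z in lborel. Cauchy (\<lambda>i. rep_L2 (x (r i)) z)"
    using cauchy_L1_AE_cauchy_subseq[of lborel "\<lambda>n. rep_L2 (x n)"] integrable_rep_interval x by blast
  define f where "f z = lim (\<lambda>i. rep_L2 (x (r i)) z)" for z
  have f_meas [measurable]: "f \<in> borel_measurable lborel"
    unfolding f_def by (rule borel_measurable_lim_metric) simp
  have f_lim: "AE z in lborel. (\<lambda>i. rep_L2 (x (r i)) z) \<longlonglongrightarrow> f z"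
    using r(2) unfolding f_def by eventually_elim (simp add: Cauchy_convergent convergent_LIMSEQ_iff[symmetric])
  \<comment> \<open>One index runs to infinity along the subsequence while \<open>n\<close> stays
    fixed, so the estimate covers the full sequence and not only the subsequence.\<close>
  have fatou: "(\<integral>\<^sup>+z. ennreal ((norm (f z - rep_L2 (x n) z))\<^sup>2) \<partial>lborel) \<le> ennreal (e\<^sup>2)"
    if n: "n \<ge> M" and M: "\<forall>i\<ge>M. \<forall>j\<ge>M. norm (x i - x j) < e" and e: "0 < e" for n M e
  proof -
    have "(\<integral>\<^sup>+z. ennreal ((norm (f z - rep_L2 (x n) z))\<^sup>2) \<partial>lborel)
       \<le> (\<integral>\<^sup>+z. liminf (\<lambda>i. ennreal ((norm (rep_L2 (x (r i)) z - rep_L2 (x n) z))\<^sup>2)) \<partial>lborel)"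
    proof (rule nn_integral_mono_AE)
      show "AE z in lborel. ennreal ((norm (f z - rep_L2 (x n) z))\<^sup>2)
          \<le> liminf (\<lambda>i. ennreal ((norm (rep_L2 (x (r i)) z - rep_L2 (x n) z))\<^sup>2))"
        using f_lim
      proof eventually_elim
        case (elim z)
        then have "(\<lambda>i. ennreal ((norm (rep_L2 (x (r i)) z - rep_L2 (x n) z))\<^sup>2)) \<longlonglongrightarrow> ennreal ((norm (f z - rep_L2 (x n) z))\<^sup>2)"
          by (intro tendsto_intros)
        from lim_imp_Liminf[OF sequentially_bot this] show ?case by simp
      qed
    qed
    also have "\<dots> \<le> liminf (\<lambda>i. \<integral>\<^sup>+z. ennreal ((norm (rep_L2 (x (r i)) z - rep_L2 (x n) z))\<^sup>2) \<partial>lborel)"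
      by (rule nn_integral_liminf) measurable
    also have "\<dots> \<le> liminf (\<lambda>i. ennreal (e\<^sup>2))"
    proof (rule Liminf_mono)
      show "\<forall>\<^sub>F i in sequentially. (\<integral>\<^sup>+z. ennreal ((norm (rep_L2 (x (r i)) z - rep_L2 (x n) z))\<^sup>2) \<partial>lborel) \<le> ennreal (e\<^sup>2)"
        using eventually_ge_at_top[of M]
      proof eventually_elim
        case (elim i)
        have "(\<integral>\<^sup>+z. ennreal ((norm (rep_L2 (x (r i)) z - rep_L2 (x n) z))\<^sup>2) \<partial>lborel)
            = (\<integral>\<^sup>+z. ennreal ((norm (rep_L2 (x (r i) - x n) z))\<^sup>2) \<partial>lborel)"
          using rd[of "r i" n] by (intro nn_integral_cong_AE) (auto elim!: AE_mp)
        also have "\<dots> = ennreal ((norm (x (r i) - x n))\<^sup>2)"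
          unfolding norm_rep using integrable_norm_rep by (intro nn_integral_eq_integral) auto
        also have "\<dots> \<le> ennreal (e\<^sup>2)"
        proof -
          have "r i \<ge> M" using elim seq_suble[OF r(1), of i] by simp
          then have "norm (x (r i) - x n) \<le> e" using M n by (simp add: less_imp_le)
          then show ?thesis using e by (intro ennreal_leI power_mono) auto
        qed
        finally show ?case .
      qed
    qed
    also have "\<dots> = ennreal (e\<^sup>2)" by (simp add: Liminf_const)
    finally show ?thesis .
  qed
  have sq_diff: "sq_integrable (\<lambda>z. f z - rep_L2 (x n) z)"
    if "n \<ge> M" "\<forall>i\<ge>M. \<forall>j\<ge>M. norm (x i - x j) < e" "0 < e" for n M e
  proof -
    have "(\<integral>\<^sup>+z. ennreal (norm ((norm (f z - rep_L2 (x n) z))\<^sup>2)) \<partial>lborel) < \<infinity>"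
      using fatou[OF that] by (auto intro: le_less_trans)
    then show ?thesis
      unfolding sq_integrable_def by (intro conjI integrableI_bounded) auto
  qed
  obtain M where M: "\<forall>i\<ge>M. \<forall>j\<ge>M. norm (x i - x j) < 1"
    using CauchyD[OF \<open>Cauchy x\<close>, of 1] by auto
  have sq_f: "sq_integrable f"
    using sq_integrable_add[OF sq_diff[OF order_refl M] sq_integrable_rep[of "x M"]] by simp
  define y where "y = abs_L2 f"
  have y: "AE z in lborel. rep_L2 y z = f z"
    unfolding y_def by (rule rep_abs_L2[OF sq_f])
  have "AE z in lborel. \<forall>i. z \<notin> {a..b} \<longrightarrow> rep_L2 (x (r i)) z = 0"
    unfolding AE_all_countable using x by (auto simp: L2_interval_iff)
  then have "y \<in> L2_interval a b"
    unfolding L2_interval_iff using y f_lim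
    by eventually_elim (auto simp: LIMSEQ_const_iff)
  moreover have "x \<longlonglongrightarrow> y"
  proof (rule LIMSEQ_I)
    fix e :: real assume e: "0 < e"
    then obtain M where M: "\<forall>i\<ge>M. \<forall>j\<ge>M. norm (x i - x j) < e / 2"
      using CauchyD[OF \<open>Cauchy x\<close>, of "e / 2"] by auto
    have "norm (x n - y) < e" if n: "n \<ge> M" for n
    proof -
      have sq: "sq_integrable (\<lambda>z. f z - rep_L2 (x n) z)"
        using sq_diff[OF n M] e by simp
      have "(norm (y - x n))\<^sup>2 = (LINT z|lborel. (norm (f z - rep_L2 (x n) z))\<^sup>2)"
        unfolding norm_rep using y rep_diff[of y "x n"]
        by (intro integral_cong_AE) (auto elim!: AE_mp)
      also have "ennreal \<dots> = (\<integral>\<^sup>+z. ennreal ((norm (f z - rep_L2 (x n) z))\<^sup>2) \<partial>lborel)"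
        using sq by (subst nn_integral_eq_integral) (auto simp: sq_integrable_def)
      also have "\<dots> \<le> ennreal ((e/2)\<^sup>2)"
        using fatou[OF n M] e by simp
      finally have "norm (y - x n) \<le> e / 2"
        using e by (simp add: power2_le_iff_abs_le)
      then show ?thesis using e by (simp add: norm_minus_commute)
    qed
    then show "\<exists>no. \<forall>n\<ge>no. norm (x n - y) < e" by blast
  qed
  ultimately show "\<exists>l\<in>L2_interval a b. x \<longlonglongrightarrow> l" by blast
qed

section \<open>Absolutely continuous functions and weak derivatives\<close>

text \<open>Absolute continuity in integral form: the fundamental theorem is built into the notion,
  so differentiation almost everywhere never enters.\<close>

definition indef_integral :: "real \<Rightarrow> real \<Rightarrow> (real \<Rightarrow> real) \<Rightarrow> (real \<Rightarrow> real) \<Rightarrow> bool" where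
  "indef_integral \<alpha> \<beta> F f \<longleftrightarrow> set_integrable lborel {\<alpha>..\<beta>} f \<and>
     (\<forall>z\<in>{\<alpha>..\<beta>}. F z = F \<alpha> + (LINT s:{\<alpha>..z}|lborel. f s))"

lemma indef_integrable: "indef_integral \<alpha> \<beta> F f \<Longrightarrow> set_integrable lborel {\<alpha>..\<beta>} f"
  and indef_eq: "indef_integral \<alpha> \<beta> F f \<Longrightarrow> z \<in> {\<alpha>..\<beta>} \<Longrightarrow> F z = F \<alpha> + (LINT s:{\<alpha>..z}|lborel. f s)"
  by (auto simp only: indef_integral_def)

lemma set_integrable_imp_measurable: "set_integrable M A f \<Longrightarrow> set_borel_measurable M A f"
  unfolding set_integrable_def set_borel_measurable_def by (rule borel_measurable_integrable)

lemma set_integral_split: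
  fixes f :: "real \<Rightarrow> real"
  assumes "set_integrable lborel {\<alpha>..\<beta>} f" "\<alpha> \<le> y" "y \<le> z" "z \<le> \<beta>"
  shows "(LINT s:{\<alpha>..z}|lborel. f s) = (LINT s:{\<alpha>..y}|lborel. f s) + (LINT s:{y..z}|lborel. f s)"
proof -
  have "{\<alpha>..z} = {\<alpha>..y} \<union> {y<..z}" using assms by auto
  moreover have "(LINT s:{\<alpha>..y} \<union> {y<..z}|lborel. f s) = (LINT s:{\<alpha>..y}|lborel. f s) + (LINT s:{y<..z}|lborel. f s)"
    using assms by (intro set_integral_Un) (auto intro: set_integrable_subset)
  moreover have "(LINT s:{y<..z}|lborel. f s) = (LINT s:{y..z}|lborel. f s)"
  proof (rule set_integral_cong_set)
    show "set_borel_measurable lborel {y<..z} f" "set_borel_measurable lborel {y..z} f"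
      using assms by (auto intro!: set_integrable_imp_measurable intro: set_integrable_subset)
    show "AE x in lborel. (x \<in> {y..z}) = (x \<in> {y<..z})"
      using AE_lborel_singleton[of y] by eventually_elim auto
  qed
  ultimately show ?thesis by simp
qed

lemma indef_diff:
  assumes "indef_integral \<alpha> \<beta> F f" "\<alpha> \<le> y" "y \<le> z" "z \<le> \<beta>"
  shows "F z - F y = (LINT s:{y..z}|lborel. f s)"
  using indef_eq[OF assms(1), of y] indef_eq[OF assms(1), of z] assms(2-)
    set_integral_split[OF indef_integrable[OF assms(1)] assms(2-)] by simp

lemma indef_sub:
  assumes "indef_integral \<alpha> \<beta> F f" "\<alpha> \<le> \<gamma>" "\<delta> \<le> \<beta>"
  shows "indef_integral \<gamma> \<delta> F f"
  unfolding indef_integral_def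
proof (intro conjI ballI)
  show "set_integrable lborel {\<gamma>..\<delta>} f"
    by (rule set_integrable_subset[OF indef_integrable[OF assms(1)]]) (use assms in auto)
  show "F z = F \<gamma> + (LINT s:{\<gamma>..z}|lborel. f s)" if "z \<in> {\<gamma>..\<delta>}" for z
    using indef_diff[OF assms(1), of \<gamma> z] assms that by simp
qed

lemma indef_continuous:
  assumes "indef_integral \<alpha> \<beta> F f" shows "continuous_on {\<alpha>..\<beta>} F"
proof -
  have int: "set_integrable lborel {\<alpha>..\<beta>} f" by (rule indef_integrable[OF assms(1)])
  have "continuous_on {\<alpha>..\<beta>} (\<lambda>z. F \<alpha> + integral {\<alpha>..z} f)"
    by (intro continuous_intros indefinite_integral_continuous_1 set_borel_integral_eq_integral[OF int])
  moreover have "F \<alpha> + integral {\<alpha>..z} f = F z" if "z \<in> {\<alpha>..\<beta>}" for z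
  proof -
    have "set_integrable lborel {\<alpha>..z} f"
      by (rule set_integrable_subset[OF int]) (use that in auto)
    from set_borel_integral_eq_integral(2)[OF this] show ?thesis
      using indef_eq[OF assms that] by linarith
  qed
  ultimately show ?thesis
    by (rule continuous_on_eq)
qed

lemma indef_bound:
  assumes "indef_integral \<alpha> \<beta> F f" "y \<in> {\<alpha>..\<beta>}" "z \<in> {\<alpha>..\<beta>}"
  shows "\<bar>F z - F y\<bar> \<le> (LINT s:{\<alpha>..\<beta>}|lborel. \<bar>f s\<bar>)"
proof -
  have *: "\<bar>F z - F y\<bar> \<le> (LINT s:{\<alpha>..\<beta>}|lborel. \<bar>f s\<bar>)" if "\<alpha> \<le> y" "y \<le> z" "z \<le> \<beta>" for y z
  proof -
    have int: "set_integrable lborel {\<alpha>..\<beta>} f" by (rule indef_integrable[OF assms(1)])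
    have "\<bar>F z - F y\<bar> = norm (LINT s:{y..z}|lborel. f s)" using indef_diff[OF assms(1) that] by simp
    also have "\<dots> \<le> (LINT s:{y..z}|lborel. \<bar>f s\<bar>)"
      using that set_integral_norm_bound[OF set_integrable_subset[OF int], of "{y..z}"] by simp
    also have "\<dots> \<le> (LINT s:{\<alpha>..\<beta>}|lborel. \<bar>f s\<bar>)"
      unfolding set_lebesgue_integral_def using that
      by (intro integral_mono set_integrable_subset[OF set_integrable_abs[OF int], unfolded set_integrable_def])
        (auto simp: indicator_def)
    finally show ?thesis .
  qed
  show ?thesis
    using *[of y z] *[of z y] assms(2,3) by (cases "y \<le> z") (auto simp: abs_minus_commute)
qed

lemma indef_C1:
  assumes "\<And>z. z \<in> {\<alpha>..\<beta>} \<Longrightarrow> (F has_vector_derivative f z) (at z within {\<alpha>..\<beta>})"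
    and "continuous_on {\<alpha>..\<beta>} f"
  shows "indef_integral \<alpha> \<beta> F f"
  unfolding indef_integral_def
proof (intro conjI ballI)
  show int: "set_integrable lborel {\<alpha>..\<beta>} f"
    using assms(2) unfolding set_integrable_def
    by (intro borel_integrable_compact) auto
  fix z assume z: "z \<in> {\<alpha>..\<beta>}"
  have "(f has_integral F z - F \<alpha>) {\<alpha>..z}"
    using z by (intro fundamental_theorem_of_calculus) 
      (auto intro: has_vector_derivative_within_subset[OF assms(1)])
  moreover have "(LINT s:{\<alpha>..z}|lborel. f s) = integral {\<alpha>..z} f"
    using z by (intro set_borel_integral_eq_integral set_integrable_subset[OF int]) auto
  ultimately show "F z = F \<alpha> + (LINT s:{\<alpha>..z}|lborel. f s)"
    by (simp add: integral_unique)
qed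

lemma set_integrable_continuous_mult:
  fixes F g :: "real \<Rightarrow> real"
  assumes cont: "continuous_on {\<alpha>..\<beta>} F" and g: "set_integrable lborel {\<alpha>..\<beta>} g"
  shows "set_integrable lborel {\<alpha>..\<beta>} (\<lambda>s. F s * g s)"
proof -
  have "bounded (F ` {\<alpha>..\<beta>})"
    using cont by (intro compact_imp_bounded compact_continuous_image compact_Icc)
  then obtain K where "\<forall>y\<in>F ` {\<alpha>..\<beta>}. norm y \<le> K"
    unfolding bounded_iff by blast
  then have K: "\<bar>F s\<bar> \<le> K" if "s \<in> {\<alpha>..\<beta>}" for s
    using that by simp
  have [measurable]: "(\<lambda>s. indicator {\<alpha>..\<beta>} s *\<^sub>R F s) \<in> borel_measurable borel"
    by (rule borel_measurable_continuous_on_indicator[OF _ cont]) simp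
  have [measurable]: "(\<lambda>s. indicator {\<alpha>..\<beta>} s *\<^sub>R g s) \<in> borel_measurable borel"
    using g by (auto simp: set_integrable_def)
  have "integrable lborel (\<lambda>s. (indicator {\<alpha>..\<beta>} s *\<^sub>R F s) * (indicator {\<alpha>..\<beta>} s *\<^sub>R g s))"
  proof (rule Bochner_Integration.integrable_bound)
    show "integrable lborel (\<lambda>s. K * (indicator {\<alpha>..\<beta>} s *\<^sub>R g s))"
      using g by (auto simp: set_integrable_def)
    show "AE s in lborel. norm ((indicator {\<alpha>..\<beta>} s *\<^sub>R F s) * (indicator {\<alpha>..\<beta>} s *\<^sub>R g s))
         \<le> norm (K * (indicator {\<alpha>..\<beta>} s *\<^sub>R g s))"
      using K by (intro AE_I2) (fastforce simp: indicator_def abs_mult intro: mult_right_mono)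
  qed measurable
  then show ?thesis
    unfolding set_integrable_def by (rule Bochner_Integration.integrable_cong[THEN iffD1, rotated 2]) (auto simp: indicator_def)
qed

lemmas set_integrable_indef_mult = set_integrable_continuous_mult[OF indef_continuous]

text \<open>Fubini's theorem on the two triangles of the square \<open>[\<alpha>, \<beta>]\<^sup>2\<close>.\<close>

lemma integral_product_rule:
  assumes F: "indef_integral \<alpha> \<beta> F f" and G: "indef_integral \<alpha> \<beta> G g" and ab: "\<alpha> \<le> \<beta>"
  shows "F \<beta> * G \<beta> - F \<alpha> * G \<alpha> = (LINT s:{\<alpha>..\<beta>}|lborel. F s * g s + G s * f s)"
proof -
  define f' where "f' s = indicator {\<alpha>..\<beta>} s * f s" for s
  define g' where "g' s = indicator {\<alpha>..\<beta>} s * g s" for s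
  have f': "integrable lborel f'" and g': "integrable lborel g'"
    using indef_integrable[OF F] indef_integrable[OF G] unfolding set_integrable_def f'_def g'_def by auto
  then have [measurable]: "f' \<in> borel_measurable borel" "g' \<in> borel_measurable borel" by auto
  \<comment> \<open>A closed ray for \<open>F\<close> and an open one for \<open>G\<close>: the
    diagonal of the square then belongs to exactly one of the two triangles.\<close>
  have Fz: "F z - F \<alpha> = (LINT s|lborel. indicator {..z} s * f' s)"
    and Gz: "G z - G \<alpha> = (LINT s|lborel. indicator {..<z} s * g' s)" if "z \<in> {\<alpha>..\<beta>}" for z
  proof -
    have "F z - F \<alpha> = (LINT s:{\<alpha>..z}|lborel. f s)" using indef_eq[OF F that] by simp
    also have "\<dots> = (LINT s|lborel. indicator {..z} s * f' s)"
      unfolding set_lebesgue_integral_def f'_def using that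
      by (intro Bochner_Integration.integral_cong) (auto simp: indicator_def)
    finally show "F z - F \<alpha> = (LINT s|lborel. indicator {..z} s * f' s)" .
    have "G z - G \<alpha> = (LINT s:{\<alpha>..z}|lborel. g s)" using indef_eq[OF G that] by simp
    also have "\<dots> = (LINT s|lborel. indicator {..z} s * g' s)"
      unfolding set_lebesgue_integral_def g'_def using that
      by (intro Bochner_Integration.integral_cong) (auto simp: indicator_def)
    also have "\<dots> = (LINT s|lborel. indicator {..<z} s * g' s)"
      proof (rule integral_cong_AE)
      show "AE s in lborel. indicator {..z} s * g' s = indicator {..<z} s * g' s"
        using AE_lborel_singleton[of z] by eventually_elim (auto simp: indicator_def)
    qed measurable
    finally show "G z - G \<alpha> = (LINT s|lborel. indicator {..<z} s * g' s)" .
  qed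
  have prod: "integrable (lborel \<Otimes>\<^sub>M lborel) (\<lambda>(s, t). f' s * g' t)"
  proof (rule lborel_pair.Fubini_integrable)
    have "(\<lambda>s. LINT t|lborel. norm (case (s, t) of (s, t) \<Rightarrow> f' s * g' t))
        = (\<lambda>s. \<bar>f' s\<bar> * (LINT t|lborel. \<bar>g' t\<bar>))"
      by (simp add: abs_mult)
    then show "integrable lborel (\<lambda>s. LINT t|lborel. norm (case (s, t) of (s, t) \<Rightarrow> f' s * g' t))"
      using f' by simp
  qed (use g' in auto)
  have p1: "integrable (lborel \<Otimes>\<^sub>M lborel) (\<lambda>(s, t). (if s \<le> t then f' s * g' t else 0))"
    and p2: "integrable (lborel \<Otimes>\<^sub>M lborel) (\<lambda>(s, t). (if t < s then f' s * g' t else 0))"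
  proof -
    have "(\<lambda>(s, t). if s \<le> t then f' s * g' t else 0) \<in> borel_measurable (lborel \<Otimes>\<^sub>M lborel)"
      "(\<lambda>(s, t). if t < s then f' s * g' t else 0) \<in> borel_measurable (lborel \<Otimes>\<^sub>M lborel)"
      by measurable
    then show "integrable (lborel \<Otimes>\<^sub>M lborel) (\<lambda>(s, t). if s \<le> t then f' s * g' t else 0)"
      "integrable (lborel \<Otimes>\<^sub>M lborel) (\<lambda>(s, t). if t < s then f' s * g' t else 0)"
      by - (rule Bochner_Integration.integrable_bound[OF prod]; auto)+
  qed
  have Fg: "set_integrable lborel {\<alpha>..\<beta>} (\<lambda>s. F s * g s)" "set_integrable lborel {\<alpha>..\<beta>} (\<lambda>s. G s * f s)"
    by (rule set_integrable_indef_mult[OF F indef_integrable[OF G]] set_integrable_indef_mult[OF G indef_integrable[OF F]])+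
  have fi: "set_integrable lborel {\<alpha>..\<beta>} f" "set_integrable lborel {\<alpha>..\<beta>} g"
    by (rule indef_integrable[OF F] indef_integrable[OF G])+
  \<comment> \<open>The product of the two increments is the integral over the whole square.\<close>
  have "(F \<beta> - F \<alpha>) * (G \<beta> - G \<alpha>) = (LINT s|lborel. f' s) * (LINT t|lborel. g' t)"
  proof -
    have "(LINT s|lborel. indicator {..\<beta>} s * f' s) = (LINT s|lborel. f' s)"
      by (intro Bochner_Integration.integral_cong) (auto simp: f'_def indicator_def)
    moreover have "(LINT s|lborel. indicator {..<\<beta>} s * g' s) = (LINT s|lborel. g' s)"
      proof (rule integral_cong_AE)
      show "AE s in lborel. indicator {..<\<beta>} s * g' s = g' s"
        using AE_lborel_singleton[of \<beta>] by eventually_elim (auto simp: g'_def indicator_def)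
    qed measurable
    ultimately show ?thesis using Fz[of \<beta>] Gz[of \<beta>] ab by simp
  qed
  also have "\<dots> = (LINT p|(lborel \<Otimes>\<^sub>M lborel). (case p of (s, t) \<Rightarrow> f' s * g' t))"
    using lborel_pair.integral_fst'[OF prod] by simp
  also have "\<dots> = (LINT p|(lborel \<Otimes>\<^sub>M lborel). (case p of (s, t) \<Rightarrow> (if s \<le> t then f' s * g' t else 0))
      + (case p of (s, t) \<Rightarrow> (if t < s then f' s * g' t else 0)))"
    by (intro Bochner_Integration.integral_cong) (auto simp: indicator_def)
  also have "\<dots> = (LINT p|(lborel \<Otimes>\<^sub>M lborel). (case p of (s, t) \<Rightarrow> (if s \<le> t then f' s * g' t else 0)))
      + (LINT p|(lborel \<Otimes>\<^sub>M lborel). (case p of (s, t) \<Rightarrow> (if t < s then f' s * g' t else 0)))"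
    by (rule Bochner_Integration.integral_add[OF p1 p2])
  also have "(LINT p|(lborel \<Otimes>\<^sub>M lborel). (case p of (s, t) \<Rightarrow> (if s \<le> t then f' s * g' t else 0)))
      = (LINT t|lborel. (LINT s|lborel. (if s \<le> t then f' s * g' t else 0)))"
    using lborel_pair.integral_snd[OF p1] by simp
  also have "\<dots> = (LINT t:{\<alpha>..\<beta>}|lborel. (F t - F \<alpha>) * g t)"
    unfolding set_lebesgue_integral_def
  proof (intro Bochner_Integration.integral_cong refl)
    fix t
    have "(LINT s|lborel. (if s \<le> t then f' s * g' t else 0)) = (LINT s|lborel. (indicator {..t} s * f' s) * g' t)"
      by (intro Bochner_Integration.integral_cong) (auto simp: indicator_def)
    then show "(LINT s|lborel. (if s \<le> t then f' s * g' t else 0)) = indicator {\<alpha>..\<beta>} t *\<^sub>R ((F t - F \<alpha>) * g t)"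
      using Fz[of t] by (auto simp: g'_def indicator_def)
  qed
  also have "(LINT p|(lborel \<Otimes>\<^sub>M lborel). (case p of (s, t) \<Rightarrow> (if t < s then f' s * g' t else 0)))
      = (LINT s|lborel. (LINT t|lborel. (if t < s then f' s * g' t else 0)))"
    using lborel_pair.integral_fst'[OF p2] by simp
  also have "\<dots> = (LINT s:{\<alpha>..\<beta>}|lborel. (G s - G \<alpha>) * f s)"
    unfolding set_lebesgue_integral_def
  proof (intro Bochner_Integration.integral_cong refl)
    fix s
    have "(LINT t|lborel. (if t < s then f' s * g' t else 0)) = (LINT t|lborel. f' s * (indicator {..<s} t * g' t))"
      by (intro Bochner_Integration.integral_cong) (auto simp: indicator_def)
    then show "(LINT t|lborel. (if t < s then f' s * g' t else 0)) = indicator {\<alpha>..\<beta>} s *\<^sub>R ((G s - G \<alpha>) * f s)"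
      using Gz[of s] by (auto simp: f'_def indicator_def)
  qed
  also have "(LINT t:{\<alpha>..\<beta>}|lborel. (F t - F \<alpha>) * g t) = (LINT t:{\<alpha>..\<beta>}|lborel. F t * g t) - F \<alpha> * (G \<beta> - G \<alpha>)"
  proof -
    have "(LINT t:{\<alpha>..\<beta>}|lborel. F t * g t - F \<alpha> * g t) = (LINT t:{\<alpha>..\<beta>}|lborel. F t * g t) - (LINT t:{\<alpha>..\<beta>}|lborel. F \<alpha> * g t)"
      using Fg fi by (intro set_integral_diff) auto
    then show ?thesis using indef_diff[OF G, of \<alpha> \<beta>] ab by (simp add: left_diff_distrib)
  qed
  also have "(LINT t:{\<alpha>..\<beta>}|lborel. (G t - G \<alpha>) * f t) = (LINT t:{\<alpha>..\<beta>}|lborel. G t * f t) - G \<alpha> * (F \<beta> - F \<alpha>)"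
  proof -
    have "(LINT t:{\<alpha>..\<beta>}|lborel. G t * f t - G \<alpha> * f t) = (LINT t:{\<alpha>..\<beta>}|lborel. G t * f t) - (LINT t:{\<alpha>..\<beta>}|lborel. G \<alpha> * f t)"
      using Fg fi by (intro set_integral_diff) auto
    then show ?thesis using indef_diff[OF F, of \<alpha> \<beta>] ab by (simp add: left_diff_distrib)
  qed
  finally have "F \<beta> * G \<beta> - F \<alpha> * G \<alpha> = (LINT t:{\<alpha>..\<beta>}|lborel. F t * g t) + (LINT t:{\<alpha>..\<beta>}|lborel. G t * f t)"
    by (simp add: algebra_simps)
  also have "\<dots> = (LINT t:{\<alpha>..\<beta>}|lborel. F t * g t + G t * f t)"
    using Fg by (intro set_integral_add(2)[symmetric]) auto
  finally show ?thesis .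
qed

lemma indef_mult:
  assumes F: "indef_integral \<alpha> \<beta> F f" and G: "indef_integral \<alpha> \<beta> G g"
  shows "indef_integral \<alpha> \<beta> (\<lambda>s. F s * G s) (\<lambda>s. F s * g s + G s * f s)"
  unfolding indef_integral_def
proof (intro conjI ballI)
  show "set_integrable lborel {\<alpha>..\<beta>} (\<lambda>s. F s * g s + G s * f s)"
    using set_integrable_indef_mult[OF F indef_integrable[OF G]] set_integrable_indef_mult[OF G indef_integrable[OF F]]
    by (rule set_integral_add)
  show "F z * G z = F \<alpha> * G \<alpha> + (LINT s:{\<alpha>..z}|lborel. F s * g s + G s * f s)" if "z \<in> {\<alpha>..\<beta>}" for z
    using integral_product_rule[OF indef_sub[OF F] indef_sub[OF G], of \<alpha> z] that by simp
qed

lemma set_integral_Icc_Ioo: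
  fixes f :: "real \<Rightarrow> real"
  shows "set_integrable lborel {\<alpha><..<\<beta>} f \<longleftrightarrow> set_integrable lborel {\<alpha>..\<beta>} f"
    and "(LINT s:{\<alpha><..<\<beta>}|lborel. f s) = (LINT s:{\<alpha>..\<beta>}|lborel. f s)"
  by (intro set_integrable_discrete_difference[where X = "{\<alpha>, \<beta>}"] set_integral_discrete_difference[where X = "{\<alpha>, \<beta>}"];
      auto)+

text \<open>The integral as a function of the set vanishes on all rays. These generate the Borel
  sets and are closed under intersection, so it vanishes on every Borel set, and uniqueness of
  densities applies.\<close>

lemma AE_zero_if_integrals_zero:
  fixes h :: "real \<Rightarrow> real"
  assumes h: "set_integrable lborel {\<alpha>..\<beta>} h"
    and zero: "\<And>z. z \<in> {\<alpha>..\<beta>} \<Longrightarrow> (LINT s:{\<alpha>..z}|lborel. h s) = 0"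
  shows "AE s in lborel. s \<in> {\<alpha>..\<beta>} \<longrightarrow> h s = 0"
proof -
  define H where "H s = indicator {\<alpha>..\<beta>} s * h s" for s
  have H: "integrable lborel H"
    using h by (simp add: set_integrable_def H_def[abs_def])
  have HA: "set_integrable lborel A H" if "A \<in> sets borel" for A
    using integrable_mult_indicator[OF _ H, of A] that by (simp add: set_integrable_def)
  have ray: "(LINT s:{..a}|lborel. H s) = 0" for a
  proof (cases "\<alpha> \<le> a \<and> \<alpha> \<le> \<beta>")
    case True
    have "(LINT s:{..a}|lborel. H s) = (LINT s:{\<alpha>..min a \<beta>}|lborel. h s)"
      unfolding set_lebesgue_integral_def H_def
      by (intro Bochner_Integration.integral_cong) (auto simp: indicator_def)
    then show ?thesis using zero[of "min a \<beta>"] True by simp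
  next
    case False
    have "(LINT s:{..a}|lborel. H s) = (LINT s::real|lborel. 0)"
      unfolding set_lebesgue_integral_def H_def
      by (intro Bochner_Integration.integral_cong) (use False in \<open>auto simp: indicator_def\<close>)
    then show ?thesis by simp
  qed
  have total: "(LINT s|lborel. H s) = 0"
  proof -
    have "(LINT s|lborel. H s) = (LINT s:{..\<beta>}|lborel. H s)"
      unfolding set_lebesgue_integral_def H_def
      by (intro Bochner_Integration.integral_cong) (auto simp: indicator_def)
    then show ?thesis using ray by simp
  qed
  have "(LINT s:A|lborel. H s) = 0" if "A \<in> sets borel" for A
  proof -
    have subset_Pow_UNIV: "range (\<lambda>a::real. {..a}) \<subseteq> Pow UNIV" by simp
    have stable: "Int_stable (range (\<lambda>a::real. {..a}))"
      by (auto simp: Int_stable_def)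
    have "A \<in> sigma_sets UNIV (range (\<lambda>a::real. {..a}))"
      using that unfolding borel_eq_atMost by simp
    with stable subset_Pow_UNIV show ?thesis
    proof (induction rule: sigma_sets_induct_disjoint)
      case (basic A)
      then show ?case using ray by auto
    next
      case empty
      then show ?case by (simp add: set_lebesgue_integral_def)
    next
      case (compl A)
      have A: "A \<in> sets borel" using compl unfolding borel_eq_atMost by simp
      have "(LINT s:A \<union> (UNIV - A)|lborel. H s) = (LINT s:A|lborel. H s) + (LINT s:UNIV - A|lborel. H s)"
        using A by (intro set_integral_Un HA) auto
      then show ?case using compl total by (simp add: set_lebesgue_integral_def)
    next
      case (union A)
      have A: "A i \<in> sets lborel" for i
      proof -
        have "A i \<in> sigma_sets UNIV (range (\<lambda>a::real. {..a}))" using union(2) by auto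
        then show ?thesis unfolding sets_lborel borel_eq_atMost by simp
      qed
      have "(LINT s:(\<Union>i. A i)|lborel. H s) = (\<Sum>i. (LINT s:A i|lborel. H s))"
      proof (rule lebesgue_integral_countable_add[OF A])
        show "A i \<inter> A j = {}" if "i \<noteq> j" for i j
          using union(1) that by (auto simp: disjoint_family_on_def)
        show "set_integrable lborel (\<Union> (range A)) H"
          using A by (intro HA) auto
      qed
      then show ?case using union(3) by simp
    qed
  qed
  then have "AE s in lborel. H s = 0"
    using density_unique_real[OF H, of "\<lambda>_. 0"] by simp
  then show ?thesis
    by eventually_elim (auto simp: H_def)
qed

section \<open>Continuous representatives and traces\<close>

lemma AE_Ioo_ex:
  assumes "AE z in lborel. z \<in> {u<..<v::real} \<longrightarrow> P z" "u < v"
  shows "\<exists>z\<in>{u<..<v}. P z"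
proof (rule ccontr)
  assume "\<not> ?thesis"
  with assms(1) have "AE z in lborel. z \<notin> {u<..<v}"
    by (auto elim!: AE_mp)
  then have "{u<..<v} \<in> null_sets lborel"
    using AE_iff_null_sets[of "{u<..<v}" lborel] by simp
  then show False using assms(2) by auto
qed

text \<open>A continuous difference that is nonzero at \<open>z\<close> is nonzero on a
  nondegenerate interval, which is not a null set. That interval is cut off at
  \<open>\<alpha>\<close> and \<open>\<beta>\<close>, so the end points are covered as well.\<close>

lemma continuous_AE_unique:
  fixes F G :: "real \<Rightarrow> 'a::real_normed_vector"
  assumes F: "continuous_on {\<alpha>..\<beta>} F" and G: "continuous_on {\<alpha>..\<beta>} G"
    and ae: "AE z in lborel. z \<in> {\<alpha><..<\<beta>} \<longrightarrow> F z = G z" and "\<alpha> < \<beta>" and z: "z \<in> {\<alpha>..\<beta>}"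
  shows "F z = G z"
proof (rule ccontr)
  assume neq: "F z \<noteq> G z"
  have "continuous_on {\<alpha>..\<beta>} (\<lambda>z. norm (F z - G z))"
    by (intro continuous_intros F G)
  then obtain d where d: "0 < d"
    "\<And>y. y \<in> {\<alpha>..\<beta>} \<Longrightarrow> dist y z < d \<Longrightarrow> dist (norm (F y - G y)) (norm (F z - G z)) < norm (F z - G z)"
    unfolding continuous_on_iff using z neq by (metis right_minus_eq zero_less_norm_iff)
  define u where "u = max \<alpha> (z - d)"
  define v where "v = min \<beta> (z + d)"
  have "u < v" using d(1) z \<open>\<alpha> < \<beta>\<close> by (auto simp: u_def v_def)
  moreover have "AE y in lborel. y \<in> {u<..<v} \<longrightarrow> F y = G y"
    using ae by eventually_elim (auto simp: u_def v_def)
  ultimately obtain y where y: "y \<in> {u<..<v}" "F y = G y"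
    using AE_Ioo_ex[of u v "\<lambda>y. F y = G y"] by blast
  have "y \<in> {\<alpha>..\<beta>}" "dist y z < d"
    using y(1) unfolding u_def v_def dist_real_def greaterThanLessThan_iff atLeastAtMost_iff by linarith+
  from d(2)[OF this] show False
    using y(2) by simp
qed

text \<open>Uniqueness of the continuous version makes the description in \<open>trace_at\<close>
  definite; every trace below is computed by exhibiting such a version.\<close>

lemma trace_at_eq:
  fixes V :: "real \<Rightarrow> 'a::real_normed_vector"
  assumes "continuous_on {\<alpha>..\<beta>} V" "AE z in lborel. z \<in> {\<alpha><..<\<beta>} \<longrightarrow> u z = V z"
    and "\<alpha> < \<beta>" "p \<in> {\<alpha>..\<beta>}"
  shows "trace_at \<alpha> \<beta> u p = V p"
  unfolding trace_at_def
proof (rule the_equality)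
  show "\<exists>v. continuous_on {\<alpha>..\<beta>} v \<and> (AE z in lborel. z \<in> {\<alpha><..<\<beta>} \<longrightarrow> u z = v z) \<and> V p = v p"
    by (intro exI[of _ V] conjI assms refl)
  fix y assume "\<exists>v. continuous_on {\<alpha>..\<beta>} v \<and> (AE z in lborel. z \<in> {\<alpha><..<\<beta>} \<longrightarrow> u z = v z) \<and> y = v p"
  then obtain v where v: "continuous_on {\<alpha>..\<beta>} v" "AE z in lborel. z \<in> {\<alpha><..<\<beta>} \<longrightarrow> u z = v z" "y = v p"
    by (elim exE conjE)
  have "AE z in lborel. z \<in> {\<alpha><..<\<beta>} \<longrightarrow> v z = V z"
    using v(2) assms(2) by eventually_elim auto
  then show "y = V p"
    using continuous_AE_unique[OF v(1) assms(1) _ assms(3,4)] v(3) by simp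
qed

text \<open>A trapezoid with ramps of width 1/n, zero outside [p + 1/n, q - 1/n]; when the interval
  is long enough it equals 1 on [p + 2/n, q - 2/n]. It is used as a derivative of test functions of
  class C^1, so continuity is enough.\<close>

definition bump :: "nat \<Rightarrow> real \<Rightarrow> real \<Rightarrow> real \<Rightarrow> real" where
  "bump n p q z = max 0 (min 1 (real n * min (z - p) (q - z) - 1))"

lemma bump_continuous: "continuous_on A (bump n p q)"
  unfolding bump_def by (intro continuous_intros)

lemma bump_bounds: "0 \<le> bump n p q z" "bump n p q z \<le> 1"
  by (auto simp: bump_def)

lemma bump_support: "0 < n \<Longrightarrow> z \<notin> {p + 1 / real n<..<q - 1 / real n} \<Longrightarrow> bump n p q z = 0"
proof -
  assume n: "0 < n" and z: "z \<notin> {p + 1 / real n<..<q - 1 / real n}"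
  then have "min (z - p) (q - z) \<le> 1 / real n" by auto
  then have "real n * min (z - p) (q - z) \<le> real n * (1 / real n)"
    by (intro mult_left_mono) auto
  then show ?thesis using n by (simp add: bump_def)
qed

lemma bump_lim: "(\<lambda>n. bump n p q z) \<longlonglongrightarrow> indicator {p<..<q} z"
proof (cases "z \<in> {p<..<q}")
  case True
  define d where "d = min (z - p) (q - z)"
  have d: "0 < d" using True by (auto simp: d_def)
  obtain N where N: "2 / d < real N" using reals_Archimedean2 by blast
  have "bump n p q z = 1" if "n \<ge> N" for n
  proof -
    have "2 \<le> real N * d" using N d by (simp add: field_simps)
    also have "\<dots> \<le> real n * d" using that d by (intro mult_right_mono) auto
    finally show ?thesis by (simp add: bump_def d_def)
  qed
  then have "\<forall>\<^sub>F n in sequentially. bump n p q z = 1"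
    unfolding eventually_sequentially by blast
  then show ?thesis using True by (simp add: tendsto_eventually)
next
  case False
  have "bump n p q z = 0" for n
  proof -
    have "min (z - p) (q - z) \<le> 0" using False by auto
    then have "real n * min (z - p) (q - z) \<le> 0" by (simp add: mult_nonneg_nonpos)
    then show ?thesis by (simp add: bump_def)
  qed
  then show ?thesis using False by simp
qed

lemma bump_measurable [measurable]: "bump n p q \<in> borel_measurable borel"
  by (intro borel_measurable_continuous_onI bump_continuous)

lemma bump_integral_lim:
  fixes w :: "real \<Rightarrow> real"
  assumes w: "set_integrable lborel {\<alpha>..\<beta>} w" and pq: "\<alpha> \<le> p" "q \<le> \<beta>"
  shows "set_integrable lborel {\<alpha>..\<beta>} (\<lambda>s. w s * bump n p q s)"
    and "(\<lambda>n. LINT s:{\<alpha>..\<beta>}|lborel. w s * bump n p q s) \<longlonglongrightarrow> (LINT s:{p..q}|lborel. w s)"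
proof -
  have w': "integrable lborel (\<lambda>s. indicator {\<alpha>..\<beta>} s * w s)"
    using w by (simp add: set_integrable_def)
  then have [measurable]: "(\<lambda>s. indicator {\<alpha>..\<beta>} s * w s) \<in> borel_measurable borel" by auto
  have dom: "norm (indicator {\<alpha>..\<beta>} s * w s * bump n p q s) \<le> \<bar>indicator {\<alpha>..\<beta>} s * w s\<bar>" for s n
    using bump_bounds[of n p q s] by (auto simp: abs_mult indicator_def mult_left_le)
  have "integrable lborel (\<lambda>s. indicator {\<alpha>..\<beta>} s * w s * bump n p q s)"
    by (rule Bochner_Integration.integrable_bound[OF w']) (use dom in auto)
  then show "set_integrable lborel {\<alpha>..\<beta>} (\<lambda>s. w s * bump n p q s)"
    by (simp add: set_integrable_def mult.assoc)
  have "(\<lambda>n. LINT s|lborel. indicator {\<alpha>..\<beta>} s * w s * bump n p q s) \<longlonglongrightarrow> (LINT s|lborel. indicator {\<alpha>..\<beta>} s * w s * indicator {p<..<q} s)"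
  proof (rule integral_dominated_convergence[where w = "\<lambda>s. \<bar>indicator {\<alpha>..\<beta>} s * w s\<bar>"])
    show "AE s in lborel. (\<lambda>n. indicator {\<alpha>..\<beta>} s * w s * bump n p q s) \<longlonglongrightarrow> indicator {\<alpha>..\<beta>} s * w s * indicator {p<..<q} s"
      by (intro AE_I2 tendsto_intros bump_lim)
    show "AE s in lborel. norm (indicator {\<alpha>..\<beta>} s * w s * bump n p q s) \<le> \<bar>indicator {\<alpha>..\<beta>} s * w s\<bar>" for n
      using dom by auto
    show "integrable lborel (\<lambda>s. \<bar>indicator {\<alpha>..\<beta>} s * w s\<bar>)" using w' by (rule integrable_abs)
  qed measurable
  moreover have "(LINT s|lborel. indicator {\<alpha>..\<beta>} s * w s * indicator {p<..<q} s) = (LINT s:{p<..<q}|lborel. w s)"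
    unfolding set_lebesgue_integral_def using pq
    by (intro Bochner_Integration.integral_cong) (auto simp: indicator_def)
  ultimately show "(\<lambda>n. LINT s:{\<alpha>..\<beta>}|lborel. w s * bump n p q s) \<longlonglongrightarrow> (LINT s:{p..q}|lborel. w s)"
    unfolding set_integral_Icc_Ioo(2) by (simp add: set_lebesgue_integral_def mult.assoc)
qed

text \<open>An antiderivative is constant to the left of \<open>p\<close> and, the total integral
  being zero, takes the same value to the right of \<open>q\<close>; subtracting that value gives
  compact support.\<close>

lemma mean_zero_test_function:
  assumes cont: "continuous_on UNIV \<theta>" and supp: "\<And>z. z \<notin> {p<..<q} \<Longrightarrow> \<theta> z = 0"
    and pq: "\<alpha> < p" "q < \<beta>" and zero: "(LINT s:{\<alpha>..\<beta>}|lborel. \<theta> s) = 0"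
  obtains \<phi> where "test_function \<alpha> \<beta> \<phi> \<theta>"
proof (cases "p \<le> q")
  case False
  \<comment> \<open>The interval can be empty, as happens for bumps with small
    \<open>n\<close>.\<close>
  then have "\<theta> z = 0" for z using supp[of z] by auto
  then have "test_function \<alpha> \<beta> (\<lambda>_. 0) \<theta>"
    unfolding test_function_def using cont by (auto intro!: exI[of _ "{}"])
  then show ?thesis by (rule that)
next
  case True
  have "\<exists>F. \<forall>z::real. -\<infinity> < ereal z \<longrightarrow> ereal z < \<infinity> \<longrightarrow> (F has_vector_derivative \<theta> z) (at z)"
    using cont by (intro einterval_antiderivative) (auto simp: continuous_on_eq_continuous_at)
  then obtain F where F: "\<And>z. (F has_vector_derivative \<theta> z) (at z)" by auto
  have FTC: "(\<theta> has_integral F v - F u) {u..v}" if "u \<le> v" for u v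
    using that F by (intro fundamental_theorem_of_calculus) (auto intro: has_vector_derivative_at_within)
  have outside: "F z = F p" if "z \<notin> {p<..<q}" for z
  proof (cases "z \<le> p")
    case True
    have "(\<theta> has_integral 0) {z..p}"
      by (rule has_integral_is_0) (use supp in auto)
    from has_integral_unique[OF FTC[OF True] this] show ?thesis by simp
  next
    case False
    then have z: "p \<le> z" "q \<le> z" using that by auto
    have int: "set_integrable lborel {u..v} \<theta>" for u v
      using cont unfolding set_integrable_def
      by (intro borel_integrable_compact) (auto intro: continuous_on_subset)
    have "F z - F p = (LINT s:{p..z}|lborel. \<theta> s)"
      using FTC[OF z(1)] set_borel_integral_eq_integral(2)[OF int, of p z] by (simp add: integral_unique)
    also have "\<dots> = (LINT s:{\<alpha>..\<beta>}|lborel. \<theta> s)"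
      unfolding set_lebesgue_integral_def
    proof (intro Bochner_Integration.integral_cong refl)
      fix x show "indicator {p..z} x *\<^sub>R \<theta> x = indicator {\<alpha>..\<beta>} x *\<^sub>R \<theta> x"
        using supp[of x] z pq by (cases "x \<in> {p<..<q}") (auto simp: indicator_def)
    qed
    finally show ?thesis using zero by simp
  qed
  then have "test_function \<alpha> \<beta> (\<lambda>z. F z - F p) \<theta>"
    unfolding test_function_def
  proof (intro conjI allI exI[of _ "{p..q}"] cont impI)
    fix z
    have "((\<lambda>z. F z - F p) has_vector_derivative \<theta> z - 0) (at z)"
      by (intro has_vector_derivative_diff F has_vector_derivative_const)
    then show "((\<lambda>z. F z - F p) has_real_derivative \<theta> z) (at z)"
      by (simp add: has_real_derivative_iff_has_vector_derivative)
  next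
    fix z assume "z \<notin> {p..q}"
    then have "z \<notin> {p<..<q}" by auto
    then show "F z - F p = 0" using outside[OF \<open>z \<notin> {p<..<q}\<close>] by simp
  qed (use pq in auto)
  then show ?thesis by (rule that)
qed

text \<open>Testing with mean-zero combinations of two bumps that converge to the indicators of \<open>[\<alpha>, z]\<close> and
  \<open>[\<alpha>, \<beta>]\<close> shows that the primitive of \<open>w\<close> is affine.\<close>

lemma du_Bois_Reymond:
  fixes w :: "real \<Rightarrow> real"
  assumes w: "set_integrable lborel {\<alpha>..\<beta>} w" and ab: "\<alpha> < \<beta>"
    and test: "\<And>\<phi> \<phi>'. test_function \<alpha> \<beta> \<phi> \<phi>' \<Longrightarrow> (LINT z:{\<alpha>..\<beta>}|lborel. w z * \<phi>' z) = 0"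
  obtains c where "AE z in lborel. z \<in> {\<alpha>..\<beta>} \<longrightarrow> w z = c"
proof -
  have one: "set_integrable lborel {\<alpha>..\<beta>} (\<lambda>_. 1 :: real)"
    unfolding set_integrable_def by (intro borel_integrable_compact) auto
  define L where "L n z = (LINT s:{\<alpha>..\<beta>}|lborel. w s * bump n \<alpha> z s)" for n z
  define I where "I n z = (LINT s:{\<alpha>..\<beta>}|lborel. 1 * bump n \<alpha> z s)" for n z
  \<comment> \<open>Each bump is weighted with the integral of the other one, so the combination has
    mean zero and is the derivative of a test function.\<close>
  have cross: "I n \<beta> * L n z = I n z * L n \<beta>" if "0 < n" "z \<in> {\<alpha>..\<beta>}" for n z
  proof -
    define \<theta> where "\<theta> s = I n \<beta> * bump n \<alpha> z s - I n z * bump n \<alpha> \<beta> s" for s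
    have "\<alpha> < \<alpha> + 1 / real n" "\<beta> - 1 / real n < \<beta>" using that by auto
    moreover have "continuous_on UNIV \<theta>"
      unfolding \<theta>_def by (intro continuous_intros bump_continuous)
    moreover have "\<theta> s = 0" if "s \<notin> {\<alpha> + 1 / real n<..<\<beta> - 1 / real n}" for s
      using bump_support[of n s \<alpha> z] bump_support[of n s \<alpha> \<beta>] \<open>0 < n\<close> \<open>z \<in> {\<alpha>..\<beta>}\<close> that by (auto simp: \<theta>_def)
    moreover have "(LINT s:{\<alpha>..\<beta>}|lborel. \<theta> s) = 0"
    proof -
      have "(LINT s:{\<alpha>..\<beta>}|lborel. \<theta> s) = I n \<beta> * I n z - I n z * I n \<beta>"
        unfolding \<theta>_def using bump_integral_lim(1)[OF one, of \<alpha> z n] bump_integral_lim(1)[OF one, of \<alpha> \<beta> n] that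
        by (subst set_integral_diff) (auto simp: I_def)
      then show ?thesis by simp
    qed
    ultimately obtain \<phi> where "test_function \<alpha> \<beta> \<phi> \<theta>"
      using mean_zero_test_function[of \<theta> "\<alpha> + 1 / real n" "\<beta> - 1 / real n" \<alpha> \<beta>] by blast
    then have "0 = (LINT s:{\<alpha>..\<beta>}|lborel. w s * \<theta> s)" using test by simp
    also have "\<dots> = (LINT s:{\<alpha>..\<beta>}|lborel. I n \<beta> * (w s * bump n \<alpha> z s) - I n z * (w s * bump n \<alpha> \<beta> s))"
      by (simp add: \<theta>_def algebra_simps)
    also have "\<dots> = I n \<beta> * L n z - I n z * L n \<beta>"
      using bump_integral_lim(1)[OF w, of \<alpha> z n] bump_integral_lim(1)[OF w, of \<alpha> \<beta> n] that
      by (subst set_integral_diff) (auto simp: L_def)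
    finally show ?thesis by simp
  qed
  \<comment> \<open>The mean value of \<open>w\<close>, the only candidate for the constant.\<close>
  define c where "c = (LINT s:{\<alpha>..\<beta>}|lborel. w s) / (\<beta> - \<alpha>)"
  have len: "(LINT s:{\<alpha>..z}|lborel. (1::real)) = z - \<alpha>" if "\<alpha> \<le> z" for z
    using that by (simp add: set_lebesgue_integral_def)
  have key: "(LINT s:{\<alpha>..z}|lborel. w s) = c * (z - \<alpha>)" if z: "z \<in> {\<alpha>..\<beta>}" for z
  proof -
    have l1: "(\<lambda>n. I n \<beta> * L n z) \<longlonglongrightarrow> (\<beta> - \<alpha>) * (LINT s:{\<alpha>..z}|lborel. w s)"
      unfolding I_def L_def using bump_integral_lim(2)[OF one, of \<alpha> \<beta>] bump_integral_lim(2)[OF w, of \<alpha> z] z ab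
      by (intro tendsto_mult) (auto simp: len)
    have l2: "(\<lambda>n. I n z * L n \<beta>) \<longlonglongrightarrow> (z - \<alpha>) * (LINT s:{\<alpha>..\<beta>}|lborel. w s)"
      unfolding I_def L_def using bump_integral_lim(2)[OF one, of \<alpha> z] bump_integral_lim(2)[OF w, of \<alpha> \<beta>] z ab
      by (intro tendsto_mult) (auto simp: len)
    have ev: "\<forall>\<^sub>F n in sequentially. I n \<beta> * L n z = I n z * L n \<beta>"
      using eventually_gt_at_top[of 0] by eventually_elim (use cross z in auto)
    have "(\<beta> - \<alpha>) * (LINT s:{\<alpha>..z}|lborel. w s) = (z - \<alpha>) * (LINT s:{\<alpha>..\<beta>}|lborel. w s)"
      by (rule LIMSEQ_unique[OF iffD1[OF tendsto_cong[OF ev] l1] l2])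
    then show ?thesis using ab by (simp add: c_def field_simps)
  qed
  have cint: "set_integrable lborel {\<alpha>..z} (\<lambda>_. c)" for z
    unfolding set_integrable_def by (intro borel_integrable_compact) auto
  have "AE s in lborel. s \<in> {\<alpha>..\<beta>} \<longrightarrow> w s - c = 0"
  proof (rule AE_zero_if_integrals_zero)
    show "set_integrable lborel {\<alpha>..\<beta>} (\<lambda>s. w s - c)"
      using w cint by (rule set_integral_diff)
    fix z assume z: "z \<in> {\<alpha>..\<beta>}"
    have "(LINT s:{\<alpha>..z}|lborel. w s - c) = (LINT s:{\<alpha>..z}|lborel. w s) - (LINT s:{\<alpha>..z}|lborel. c)"
      using w cint z by (intro set_integral_diff) (auto intro: set_integrable_subset)
    also have "(LINT s:{\<alpha>..z}|lborel. c) = c * (z - \<alpha>)"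
      using z by (simp add: set_lebesgue_integral_def)
    finally show "(LINT s:{\<alpha>..z}|lborel. w s - c) = 0" using key[OF z] by simp
  qed
  then have "AE s in lborel. s \<in> {\<alpha>..\<beta>} \<longrightarrow> w s = c" by simp
  then show ?thesis by (rule that)
qed

section \<open>Weak derivatives as densities of absolutely continuous functions\<close>

lemma L2_on_integrable:
  assumes "L2_on \<alpha> \<beta> u" shows "set_integrable lborel {\<alpha>..\<beta>} u"
proof -
  have [measurable]: "(\<lambda>z. indicator {\<alpha><..<\<beta>} z *\<^sub>R u z) \<in> borel_measurable borel"
    using assms by (simp add: L2_on_def set_borel_measurable_def)
  have "set_integrable lborel {\<alpha><..<\<beta>} u"
    unfolding set_integrable_def
  proof (rule Bochner_Integration.integrable_bound)
    show "integrable lborel (\<lambda>z. indicator {\<alpha><..<\<beta>} z + indicator {\<alpha><..<\<beta>} z *\<^sub>R (u z)\<^sup>2 :: real)"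
      using assms by (intro Bochner_Integration.integrable_add integrable_real_indicator)
        (auto simp: L2_on_def set_integrable_def intro!: emeasure_bounded_finite simp del: infinity_ennreal_def)
    have "\<bar>t\<bar> \<le> 1 + t\<^sup>2" for t :: real
      using sum_squares_bound[of "\<bar>t\<bar>" 1] abs_ge_zero[of t] by (simp only: power_one mult_1_right power2_abs)
    then show "AE z in lborel. norm (indicator {\<alpha><..<\<beta>} z *\<^sub>R u z)
         \<le> norm (indicator {\<alpha><..<\<beta>} z + indicator {\<alpha><..<\<beta>} z *\<^sub>R (u z)\<^sup>2 :: real)"
      by (intro AE_I2) (auto simp: indicator_def)
  qed measurable
  then show ?thesis using set_integral_Icc_Ioo(1) by blast
qed

lemma L2_on_subset:
  assumes "L2_on \<alpha> \<beta> u" "\<alpha> \<le> \<gamma>" "\<delta> \<le> \<beta>" shows "L2_on \<gamma> \<delta> u"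
  unfolding L2_on_def
proof
  have "(\<lambda>z. indicator {\<gamma><..<\<delta>} z *\<^sub>R (indicator {\<alpha><..<\<beta>} z *\<^sub>R u z)) \<in> borel_measurable borel"
    by (rule borel_measurable_scaleR[OF borel_measurable_indicator])
      (use assms in \<open>auto simp: L2_on_def set_borel_measurable_def\<close>)
  also have "(\<lambda>z. indicator {\<gamma><..<\<delta>} z *\<^sub>R (indicator {\<alpha><..<\<beta>} z *\<^sub>R u z)) = (\<lambda>z. indicator {\<gamma><..<\<delta>} z *\<^sub>R u z)"
    using assms by (auto simp: indicator_def)
  finally show "set_borel_measurable lborel {\<gamma><..<\<delta>} u" by (simp add: set_borel_measurable_def)
  show "set_integrable lborel {\<gamma><..<\<delta>} (\<lambda>z. (u z)\<^sup>2)"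
    using assms by (auto simp: L2_on_def intro: set_integrable_subset)
qed

lemma test_function_indef:
  assumes "test_function \<alpha> \<beta> \<phi> \<phi>'"
  shows "indef_integral \<alpha> \<beta> \<phi> \<phi>'" "\<phi> \<alpha> = 0" "\<phi> \<beta> = 0"
proof -
  have *: "\<And>z. (\<phi> has_real_derivative \<phi>' z) (at z)" "continuous_on UNIV \<phi>'"
    using assms by (auto simp: test_function_def)
  then show "indef_integral \<alpha> \<beta> \<phi> \<phi>'"
    by (intro indef_C1) (auto simp: has_real_derivative_iff_has_vector_derivative intro: has_vector_derivative_at_within continuous_on_subset)
  show "\<phi> \<alpha> = 0" "\<phi> \<beta> = 0"
    using assms by (auto simp: test_function_def)
qed

text \<open>The product rule without boundary terms, since a test function vanishes at both
  ends.\<close>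

lemma indef_test_function:
  assumes F: "indef_integral \<alpha> \<beta> F f" and \<phi>: "test_function \<alpha> \<beta> \<phi> \<phi>'" and "\<alpha> \<le> \<beta>"
  shows "(LINT z:{\<alpha>..\<beta>}|lborel. F z * \<phi>' z) = - (LINT z:{\<alpha>..\<beta>}|lborel. f z * \<phi> z)"
    and "set_integrable lborel {\<alpha>..\<beta>} (\<lambda>z. F z * \<phi>' z)"
proof -
  note \<phi>i = test_function_indef[OF \<phi>]
  have i1: "set_integrable lborel {\<alpha>..\<beta>} (\<lambda>z. F z * \<phi>' z)"
    by (rule set_integrable_indef_mult[OF F indef_integrable[OF \<phi>i(1)]])
  have i2: "set_integrable lborel {\<alpha>..\<beta>} (\<lambda>z. \<phi> z * f z)"
    by (rule set_integrable_indef_mult[OF \<phi>i(1) indef_integrable[OF F]])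
  have "0 = (LINT z:{\<alpha>..\<beta>}|lborel. F z * \<phi>' z + \<phi> z * f z)"
    using integral_product_rule[OF F \<phi>i(1) \<open>\<alpha> \<le> \<beta>\<close>] \<phi>i by simp
  also have "\<dots> = (LINT z:{\<alpha>..\<beta>}|lborel. F z * \<phi>' z) + (LINT z:{\<alpha>..\<beta>}|lborel. \<phi> z * f z)"
    by (rule set_integral_add(2)[OF i1 i2])
  finally show "(LINT z:{\<alpha>..\<beta>}|lborel. F z * \<phi>' z) = - (LINT z:{\<alpha>..\<beta>}|lborel. f z * \<phi> z)"
    by (simp add: mult.commute)
  show "set_integrable lborel {\<alpha>..\<beta>} (\<lambda>z. F z * \<phi>' z)" by (rule i1)
qed

lemma indefI:
  assumes "set_integrable lborel {\<alpha>..\<beta>} f"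
  shows "indef_integral \<alpha> \<beta> (\<lambda>z. c + (LINT s:{\<alpha>..z}|lborel. f s)) f"
proof -
  have "(\<lambda>s. indicator {\<alpha>} s * f s) = (\<lambda>s. f \<alpha> * indicator {\<alpha>} s)"
    by (auto simp: indicator_def)
  then have "(LINT s:{\<alpha>..\<alpha>}|lborel. f s) = 0"
    by (simp add: set_lebesgue_integral_def)
  then show ?thesis
    unfolding indef_integral_def using assms by simp
qed

text \<open>Subtracting the primitive of \<open>g\<close> leaves a function that integrates to zero
  against the derivative of every test function; by \<open>du_Bois_Reymond\<close> it is
  constant.\<close>

lemma weak_deriv_indef:
  assumes u: "L2_on \<alpha> \<beta> u" and g: "has_weak_deriv \<alpha> \<beta> u g" and ab: "\<alpha> < \<beta>"
  obtains F where "indef_integral \<alpha> \<beta> F g" "AE z in lborel. z \<in> {\<alpha>..\<beta>} \<longrightarrow> u z = F z"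
proof -
  have gi: "set_integrable lborel {\<alpha>..\<beta>} g"
    using g by (intro L2_on_integrable) (simp add: has_weak_deriv_def)
  define G where "G z = 0 + (LINT s:{\<alpha>..z}|lborel. g s)" for z
  have G: "indef_integral \<alpha> \<beta> G g"
    unfolding G_def by (rule indefI[OF gi])
  have ui: "set_integrable lborel {\<alpha>..\<beta>} u" by (rule L2_on_integrable[OF u])
  have Gi: "set_integrable lborel {\<alpha>..\<beta>} G"
    unfolding set_integrable_def by (intro borel_integrable_compact indef_continuous[OF G]) simp
  have test: "(LINT z:{\<alpha>..\<beta>}|lborel. (u z - G z) * \<phi>' z) = 0" if \<phi>: "test_function \<alpha> \<beta> \<phi> \<phi>'" for \<phi> \<phi>'
  proof -
    have cont: "continuous_on {\<alpha>..\<beta>} \<phi>'"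
      using \<phi> continuous_on_subset[of UNIV \<phi>' "{\<alpha>..\<beta>}"] by (simp add: test_function_def)
    have iu: "set_integrable lborel {\<alpha>..\<beta>} (\<lambda>z. u z * \<phi>' z)"
      using set_integrable_continuous_mult[OF cont ui] by (simp add: mult.commute)
    have "(LINT z:{\<alpha>..\<beta>}|lborel. u z * \<phi>' z) = - (LINT z:{\<alpha>..\<beta>}|lborel. g z * \<phi> z)"
      using g \<phi> by (auto simp: has_weak_deriv_def set_integral_Icc_Ioo)
    then have "(LINT z:{\<alpha>..\<beta>}|lborel. u z * \<phi>' z) - (LINT z:{\<alpha>..\<beta>}|lborel. G z * \<phi>' z) = 0"
      using indef_test_function(1)[OF G \<phi>] ab by simp
    then show ?thesis
      using set_integral_diff(2)[OF iu indef_test_function(2)[OF G \<phi>]] ab by (simp add: left_diff_distrib)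
  qed
  obtain c where c: "AE z in lborel. z \<in> {\<alpha>..\<beta>} \<longrightarrow> u z - G z = c"
    by (rule du_Bois_Reymond[OF set_integral_diff(1)[OF ui Gi] ab test])
  have "indef_integral \<alpha> \<beta> (\<lambda>z. c + (LINT s:{\<alpha>..z}|lborel. g s)) g"
    by (rule indefI[OF gi])
  moreover have "AE z in lborel. z \<in> {\<alpha>..\<beta>} \<longrightarrow> u z = c + (LINT s:{\<alpha>..z}|lborel. g s)"
    using c by eventually_elim (auto simp: G_def)
  ultimately show ?thesis by (rule that)
qed

lemma indef_weak_deriv:
  assumes F: "indef_integral \<alpha> \<beta> F f" and f: "L2_on \<alpha> \<beta> f" and u: "L2_on \<alpha> \<beta> u"
    and ae: "AE z in lborel. z \<in> {\<alpha><..<\<beta>} \<longrightarrow> u z = F z" and ab: "\<alpha> < \<beta>"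
  shows "has_weak_deriv \<alpha> \<beta> u f"
  unfolding has_weak_deriv_def
proof (intro conjI allI impI f)
  fix \<phi> \<phi>' assume \<phi>: "test_function \<alpha> \<beta> \<phi> \<phi>'"
  have [measurable]: "(\<lambda>z. indicator {\<alpha>..\<beta>} z * u z) \<in> borel_measurable borel"
    using L2_on_integrable[OF u] by (auto simp: set_integrable_def)
  have [measurable]: "\<phi>' \<in> borel_measurable borel"
    using \<phi> by (auto simp: test_function_def intro: borel_measurable_continuous_onI)
  have [measurable]: "(\<lambda>z. indicator {\<alpha>..\<beta>} z * (F z * \<phi>' z)) \<in> borel_measurable borel"
    using indef_test_function(2)[OF F \<phi>] ab by (auto simp: set_integrable_def)
  have "(\<lambda>z. indicator {\<alpha>..\<beta>} z * u z * \<phi>' z) \<in> borel_measurable borel" by measurable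
  then have [measurable]: "(\<lambda>z. indicator {\<alpha>..\<beta>} z * (u z * \<phi>' z)) \<in> borel_measurable borel"
    by (simp add: mult.assoc)
  have "(LINT z:{\<alpha>..\<beta>}|lborel. u z * \<phi>' z) = (LINT z:{\<alpha>..\<beta>}|lborel. F z * \<phi>' z)"
    unfolding set_lebesgue_integral_def real_scaleR_def
  proof (rule integral_cong_AE)
    show "AE z in lborel. indicator {\<alpha>..\<beta>} z * (u z * \<phi>' z) = indicator {\<alpha>..\<beta>} z * (F z * \<phi>' z)"
      using ae AE_lborel_singleton[of \<alpha>] AE_lborel_singleton[of \<beta>]
      by eventually_elim (auto simp: indicator_def)
  qed measurable
  then show "(LINT z:{\<alpha><..<\<beta>}|lborel. u z * \<phi>' z) = - (LINT z:{\<alpha><..<\<beta>}|lborel. f z * \<phi> z)"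
    using indef_test_function(1)[OF F \<phi>] ab by (simp add: set_integral_Icc_Ioo)
qed

text \<open>\<open>weak_deriv\<close> is an arbitrary choice among the weak derivatives. Any two of
  them have primitives that agree with \<open>u\<close> almost everywhere, hence with each other
  everywhere by continuity, and densities with equal primitives agree almost everywhere.\<close>

lemma weak_deriv_eq:
  assumes F: "indef_integral \<alpha> \<beta> F f" and f: "L2_on \<alpha> \<beta> f" and u: "L2_on \<alpha> \<beta> u"
    and ae: "AE z in lborel. z \<in> {\<alpha><..<\<beta>} \<longrightarrow> u z = F z" and ab: "\<alpha> < \<beta>"
  shows "u \<in> H1 \<alpha> \<beta>" "AE z in lborel. z \<in> {\<alpha><..<\<beta>} \<longrightarrow> weak_deriv \<alpha> \<beta> u z = f z"
    "L2_on \<alpha> \<beta> (weak_deriv \<alpha> \<beta> u)"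
proof -
  have wf: "has_weak_deriv \<alpha> \<beta> u f" by (rule indef_weak_deriv[OF assms])
  then show "u \<in> H1 \<alpha> \<beta>" using u by (auto simp: H1_def)
  define g where "g = weak_deriv \<alpha> \<beta> u"
  have g: "has_weak_deriv \<alpha> \<beta> u g"
    unfolding g_def weak_deriv_def by (rule someI[where P = "has_weak_deriv \<alpha> \<beta> u", OF wf])
  then show "L2_on \<alpha> \<beta> (weak_deriv \<alpha> \<beta> u)" by (simp add: g_def has_weak_deriv_def)
  obtain G where G: "indef_integral \<alpha> \<beta> G g" "AE z in lborel. z \<in> {\<alpha>..\<beta>} \<longrightarrow> u z = G z"
    by (rule weak_deriv_indef[OF u g ab])
  have ae': "AE z in lborel. z \<in> {\<alpha><..<\<beta>} \<longrightarrow> G z = F z"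
    using G(2) ae by eventually_elim auto
  have GF: "G z = F z" if "z \<in> {\<alpha>..\<beta>}" for z
    by (rule continuous_AE_unique[OF indef_continuous[OF G(1)] indef_continuous[OF F] ae' ab that])
  have gi: "set_integrable lborel {\<alpha>..\<beta>} g" "set_integrable lborel {\<alpha>..\<beta>} f"
    using indef_integrable[OF G(1)] indef_integrable[OF F] .
  have "AE z in lborel. z \<in> {\<alpha>..\<beta>} \<longrightarrow> g z - f z = 0"
  proof (rule AE_zero_if_integrals_zero)
    show "set_integrable lborel {\<alpha>..\<beta>} (\<lambda>z. g z - f z)" by (rule set_integral_diff(1)[OF gi])
    fix z assume z: "z \<in> {\<alpha>..\<beta>}"
    have "(LINT s:{\<alpha>..z}|lborel. g s - f s) = (LINT s:{\<alpha>..z}|lborel. g s) - (LINT s:{\<alpha>..z}|lborel. f s)"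
      using z by (intro set_integral_diff(2) set_integrable_subset[OF gi(1)] set_integrable_subset[OF gi(2)]) auto
    also have "\<dots> = (G z - G \<alpha>) - (F z - F \<alpha>)"
      using indef_eq[OF G(1) z] indef_eq[OF F z] by linarith
    also have "\<dots> = 0" using GF[OF z] GF[of \<alpha>] ab by simp
    finally show "(LINT s:{\<alpha>..z}|lborel. g s - f s) = 0" .
  qed
  then show "AE z in lborel. z \<in> {\<alpha><..<\<beta>} \<longrightarrow> weak_deriv \<alpha> \<beta> u z = f z"
    by eventually_elim (auto simp: g_def)
qed

section \<open>Diagonal multiplication operators\<close>

lemma norm_vec2_sq: "(norm v)\<^sup>2 = (v $ 1)\<^sup>2 + (v $ 2)\<^sup>2" for v :: "real^2"
  unfolding power2_norm_eq_inner by (simp add: inner_vec_def sum_2 power2_eq_square)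

lemma inner_vec2: "v \<bullet> w = v $ 1 * w $ 1 + v $ 2 * w $ 2" for v w :: "real^2"
  by (simp add: inner_vec_def sum_2)

lemma mat2_mult_vec: "(A *v v) $ i = A $ i $ 1 * v $ 1 + A $ i $ 2 * v $ 2" for A :: "real^2^2"
  by (simp add: matrix_vector_mult_def sum_2)

lemma borel_measurable_cart_iff:
  "f \<in> borel_measurable F \<longleftrightarrow> (\<forall>i. (\<lambda>z. f z $ i) \<in> borel_measurable F)" for f :: "'b \<Rightarrow> real^'n"
  by (auto simp: borel_measurable_euclidean_space[of f] Basis_vec_def inner_axis)

lemma borel_measurable_cart_nth:
  "f \<in> borel_measurable F \<Longrightarrow> (\<lambda>z. f z $ i) \<in> borel_measurable F" for f :: "'b \<Rightarrow> real^'n"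
  using borel_measurable_cart_iff[of f F] by simp

lemma measurable_rep_nth [measurable]: "(\<lambda>z. rep_L2 x z $ i) \<in> borel_measurable borel"
  by (rule borel_measurable_cart_nth) measurable

lemma sq_integrable_iff:
  "sq_integrable f \<longleftrightarrow> (\<forall>i. (\<lambda>z. f z $ i) \<in> borel_measurable borel \<and> integrable lborel (\<lambda>z. (f z $ i)\<^sup>2))"
proof
  assume f: "sq_integrable f"
  then have [measurable]: "f \<in> borel_measurable borel" by (simp add: sq_integrable_def)
  have [measurable]: "(\<lambda>z. f z $ i) \<in> borel_measurable borel" for i
    by (rule borel_measurable_cart_nth) measurable
  have "integrable lborel (\<lambda>z. (f z $ i)\<^sup>2)" for i
  proof (rule Bochner_Integration.integrable_bound)
    show "integrable lborel (\<lambda>z. (norm (f z))\<^sup>2)" using f by (simp add: sq_integrable_def)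
    show "AE z in lborel. norm ((f z $ i)\<^sup>2) \<le> norm ((norm (f z))\<^sup>2)"
      using component_le_norm_cart by (intro AE_I2) (simp add: abs_le_square_iff[symmetric])
  qed measurable
  then show "\<forall>i. (\<lambda>z. f z $ i) \<in> borel_measurable borel \<and> integrable lborel (\<lambda>z. (f z $ i)\<^sup>2)"
    by auto
next
  assume f: "\<forall>i. (\<lambda>z. f z $ i) \<in> borel_measurable borel \<and> integrable lborel (\<lambda>z. (f z $ i)\<^sup>2)"
  then have "f \<in> borel_measurable borel" by (subst borel_measurable_cart_iff) simp
  then show "sq_integrable f"
    using f by (simp add: sq_integrable_def norm_vec2_sq)
qed

text \<open>Required at all points of the line and not only on [a,b], so that multiplication acts on
  all of \<open>L2\<close>; \<open>Q_at\<close> fits because it is zero outside [a,b].\<close>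

definition diag_mult :: "real \<Rightarrow> (real \<Rightarrow> real^2^2) \<Rightarrow> bool" where
  "diag_mult M S \<longleftrightarrow> (\<forall>i. (\<lambda>z. S z $ i $ i) \<in> borel_measurable borel) \<and>
     (\<forall>z. S z $ 1 $ 2 = 0 \<and> S z $ 2 $ 1 = 0) \<and> (\<forall>z i. 0 \<le> S z $ i $ i \<and> S z $ i $ i \<le> M)"

lemma diag_mult_nth:
  assumes "diag_mult M S" shows "(S z *v v) $ i = S z $ i $ i * v $ i"
  using assms exhaust_2[of i] by (auto simp: diag_mult_def mat2_mult_vec)

lemma diag_mult_sq_integrable:
  assumes S: "diag_mult M S" and x: "sq_integrable f"
  shows "sq_integrable (\<lambda>z. S z *v f z)"
  unfolding sq_integrable_iff diag_mult_nth[OF S]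
proof (intro allI conjI)
  fix i
  have [measurable]: "(\<lambda>z. S z $ i $ i) \<in> borel_measurable borel" "(\<lambda>z. f z $ i) \<in> borel_measurable borel"
    using S x by (auto simp: diag_mult_def sq_integrable_iff)
  show "(\<lambda>z. S z $ i $ i * f z $ i) \<in> borel_measurable borel" by measurable
  show "integrable lborel (\<lambda>z. (S z $ i $ i * f z $ i)\<^sup>2)"
  proof (rule Bochner_Integration.integrable_bound)
    show "integrable lborel (\<lambda>z. M\<^sup>2 * (f z $ i)\<^sup>2)" using x by (simp add: sq_integrable_iff)
    show "AE z in lborel. norm ((S z $ i $ i * f z $ i)\<^sup>2) \<le> norm (M\<^sup>2 * (f z $ i)\<^sup>2)"
      using S by (intro AE_I2) (auto simp: diag_mult_def power_mult_distrib intro!: mult_right_mono power_mono)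
  qed measurable
qed

lemma rep_mult_op:
  assumes "diag_mult M S" shows "AE z in lborel. rep_L2 (mult_op S x) z = S z *v rep_L2 x z"
  unfolding mult_op_def by (intro rep_abs_L2 diag_mult_sq_integrable[OF assms] sq_integrable_rep)

lemma mult_op_linear:
  assumes S: "diag_mult M S"
  shows "mult_op S (x + y) = mult_op S x + mult_op S y" "mult_op S (c *\<^sub>R x) = c *\<^sub>R mult_op S x"
proof -
  show "mult_op S (x + y) = mult_op S x + mult_op S y"
    by (rule L2_eqI)
      (use rep_mult_op[OF S, of x] rep_mult_op[OF S, of y] rep_mult_op[OF S, of "x + y"] rep_plus[of x y]
        rep_plus[of "mult_op S x" "mult_op S y"] in eventually_elim, simp add: matrix_vector_right_distrib)
  show "mult_op S (c *\<^sub>R x) = c *\<^sub>R mult_op S x"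
    by (rule L2_eqI)
      (use rep_mult_op[OF S, of x] rep_mult_op[OF S, of "c *\<^sub>R x"] rep_scaleR[of c x]
        rep_scaleR[of c "mult_op S x"] in eventually_elim, simp add: matrix_vector_mult_scaleR)
qed

lemma norm_sq_le:
  assumes "AE z in lborel. (norm (rep_L2 x z))\<^sup>2 \<le> c * (norm (rep_L2 y z))\<^sup>2"
  shows "(norm x)\<^sup>2 \<le> c * (norm y)\<^sup>2"
proof -
  have "(norm x)\<^sup>2 \<le> (LINT z|lborel. c * (norm (rep_L2 y z))\<^sup>2)"
    unfolding norm_rep using integrable_norm_rep assms by (intro integral_mono_AE) auto
  then show ?thesis by (simp add: norm_rep)
qed

lemma norm_mult_op:
  assumes S: "diag_mult M S" shows "norm (mult_op S x) \<le> M * norm x"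
proof -
  have "0 \<le> S 0 $ 1 $ 1" "S 0 $ 1 $ 1 \<le> M" using S by (auto simp: diag_mult_def)
  then have M: "0 \<le> M" by simp
  have "(norm (mult_op S x))\<^sup>2 \<le> M\<^sup>2 * (norm x)\<^sup>2"
  proof (rule norm_sq_le)
    show "AE z in lborel. (norm (rep_L2 (mult_op S x) z))\<^sup>2 \<le> M\<^sup>2 * (norm (rep_L2 x z))\<^sup>2"
      using rep_mult_op[OF S, of x]
    proof eventually_elim
      case (elim z)
      have "(S z $ i $ i)\<^sup>2 \<le> M\<^sup>2" for i
        using S by (auto simp: diag_mult_def intro: power_mono)
      then have "(S z $ i $ i)\<^sup>2 * (rep_L2 x z $ i)\<^sup>2 \<le> M\<^sup>2 * (rep_L2 x z $ i)\<^sup>2" for i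
        by (intro mult_right_mono) auto
      then show ?case
        unfolding elim norm_vec2_sq diag_mult_nth[OF S] power_mult_distrib distrib_left
        by (intro add_mono)
    qed
  qed
  then show ?thesis using M
    by (metis mult_nonneg_nonneg norm_ge_zero power2_le_imp_le power_mult_distrib)
qed

lemma mult_op_bounded_linear:
  assumes S: "diag_mult M S" shows "bounded_linear (mult_op S)"
  using mult_op_linear[OF S] norm_mult_op[OF S]
  by (intro bounded_linear_intro[of _ M]) (auto simp: mult.commute)

lemma mult_op_sym:
  assumes S: "diag_mult M S" shows "mult_op S x \<bullet> y = mult_op S y \<bullet> x"
  unfolding inner_rep
  by (rule integral_cong_AE)
    (measurable, use rep_mult_op[OF S, of x] rep_mult_op[OF S, of y] in eventually_elim, 
      simp add: inner_vec2 diag_mult_nth[OF S])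

text \<open>\<open>S\<close> vanishes outside [a,b], so the weighted form is an inner product over
  the whole line; its bilinearity, symmetry and bounds are then inherited from the multiplication
  operator.\<close>

lemma inner_Q_eq:
  assumes S: "diag_mult M S" and supp: "\<forall>z. z \<notin> {a..b} \<longrightarrow> S z = 0"
  shows "inner_Q a b S x y = 1 / 2 * (mult_op S x \<bullet> y)"
proof -
  have [measurable]: "(\<lambda>z. S z $ i $ i) \<in> borel_measurable borel" for i
    using S by (simp add: diag_mult_def)
  have e: "indicator {a..b} z *\<^sub>R (rep_L2 y z \<bullet> (S z *v rep_L2 x z)) = 
     rep_L2 y z $ 1 * (S z $ 1 $ 1 * rep_L2 x z $ 1) + rep_L2 y z $ 2 * (S z $ 2 $ 2 * rep_L2 x z $ 2)" for z
    using supp by (cases "z \<in> {a..b}") (auto simp: inner_vec2 diag_mult_nth[OF S])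
  have "(LINT z|lborel. rep_L2 y z $ 1 * (S z $ 1 $ 1 * rep_L2 x z $ 1) + rep_L2 y z $ 2 * (S z $ 2 $ 2 * rep_L2 x z $ 2))
     = mult_op S x \<bullet> y"
    unfolding inner_rep
    by (rule integral_cong_AE)
      (measurable, use rep_mult_op[OF S, of x] in eventually_elim, simp add: inner_vec2 diag_mult_nth[OF S])
  then show ?thesis
    by (simp add: inner_Q_def set_lebesgue_integral_def e del: real_scaleR_def)
qed

lemma inner_Q_bilinear:
  assumes S: "diag_mult M S" and supp: "\<forall>z. z \<notin> {a..b} \<longrightarrow> S z = 0"
  shows "bounded_bilinear (inner_Q a b S)"
proof -
  have "bounded_bilinear (\<lambda>x y. (1 / 2 * (mult_op S x \<bullet> y)))"
    using bounded_bilinear.comp[OF bounded_bilinear_inner mult_op_bounded_linear[OF S] bounded_linear_scaleR_right[of "1/2"]]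
    by simp
  moreover have "inner_Q a b S = (\<lambda>x y. (1 / 2 * (mult_op S x \<bullet> y)))"
    using inner_Q_eq[OF assms] by (intro ext) auto
  ultimately show ?thesis by simp
qed

lemma inner_Q_sym:
  assumes S: "diag_mult M S" and supp: "\<forall>z. z \<notin> {a..b} \<longrightarrow> S z = 0"
  shows "inner_Q a b S x y = inner_Q a b S y x"
  unfolding inner_Q_eq[OF assms] by (simp add: mult_op_sym[OF S, of x y])

lemma inner_mult_op_self:
  assumes S: "diag_mult M S"
  shows "mult_op S x \<bullet> x = (LINT z|lborel. S z $ 1 $ 1 * (rep_L2 x z $ 1)\<^sup>2 + S z $ 2 $ 2 * (rep_L2 x z $ 2)\<^sup>2)"
proof -
  have [measurable]: "(\<lambda>z. S z $ i $ i) \<in> borel_measurable borel" for i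
    using S by (simp add: diag_mult_def)
  show ?thesis
    unfolding inner_rep
    by (rule integral_cong_AE)
      (measurable, use rep_mult_op[OF S, of x] in eventually_elim,
       simp add: inner_vec2 diag_mult_nth[OF S] power2_eq_square)
qed

lemma inner_Q_nonneg:
  assumes S: "diag_mult M S" and supp: "\<forall>z. z \<notin> {a..b} \<longrightarrow> S z = 0"
  shows "0 \<le> inner_Q a b S x x"
  unfolding inner_Q_eq[OF assms] inner_mult_op_self[OF S] using S
  by (auto simp: diag_mult_def intro!: mult_nonneg_nonneg integral_nonneg add_nonneg_nonneg)

text \<open>The lower bound on \<open>S\<close> is demanded almost everywhere, because
  \<open>Q_at\<close> is zero at the interface point itself.\<close>

lemma inner_Q_lower:
  assumes S: "diag_mult M S" and supp: "\<forall>z. z \<notin> {a..b} \<longrightarrow> S z = 0"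
    and m: "AE z in lborel. z \<in> {a..b} \<longrightarrow> m \<le> S z $ 1 $ 1 \<and> m \<le> S z $ 2 $ 2"
    and x: "x \<in> L2_interval a b"
  shows "m / 2 * (norm x)\<^sup>2 \<le> inner_Q a b S x x"
proof -
  have "m * (norm x)\<^sup>2 = (LINT z|lborel. m * (norm (rep_L2 x z))\<^sup>2)"
    by (simp add: norm_rep)
  also have "\<dots> \<le> (LINT z|lborel. rep_L2 (mult_op S x) z \<bullet> rep_L2 x z)"
  proof (rule integral_mono_AE)
    show "integrable lborel (\<lambda>z. m * (norm (rep_L2 x z))\<^sup>2)"
      using integrable_norm_rep by simp
    show "integrable lborel (\<lambda>z. rep_L2 (mult_op S x) z \<bullet> rep_L2 x z)"
      by (intro sq_integrable_inner sq_integrable_rep)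
    have "AE z in lborel. z \<notin> {a..b} \<longrightarrow> rep_L2 x z = 0" using x by (simp add: L2_interval_iff)
    then show "AE z in lborel. m * (norm (rep_L2 x z))\<^sup>2 \<le> rep_L2 (mult_op S x) z \<bullet> rep_L2 x z"
      using rep_mult_op[OF S, of x] m
    proof eventually_elim
      case (elim z)
      show ?case
      proof (cases "z \<in> {a..b}")
        case True
        then have "m * (rep_L2 x z $ 1)\<^sup>2 \<le> S z $ 1 $ 1 * (rep_L2 x z $ 1)\<^sup>2" "m * (rep_L2 x z $ 2)\<^sup>2 \<le> S z $ 2 $ 2 * (rep_L2 x z $ 2)\<^sup>2"
          using elim by (auto intro!: mult_right_mono)
        then show ?thesis
          unfolding elim norm_vec2_sq inner_vec2 diag_mult_nth[OF S] by (simp add: power2_eq_square algebra_simps)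
      next
        case False
        then show ?thesis using elim by simp
      qed
    qed
  qed
  finally show ?thesis
    unfolding inner_Q_eq[OF S supp] inner_rep by simp
qed

section \<open>The interface system\<close>

lemma L2_on_rep: "L2_on \<alpha> \<beta> (\<lambda>z. rep_L2 x z $ i)"
  unfolding L2_on_def
proof
  show "set_borel_measurable lborel {\<alpha><..<\<beta>} (\<lambda>z. rep_L2 x z $ i)"
    unfolding set_borel_measurable_def by measurable
  have "integrable lborel (\<lambda>z. (rep_L2 x z $ i)\<^sup>2)"
    using sq_integrable_rep[of x] by (simp add: sq_integrable_iff)
  then show "set_integrable lborel {\<alpha><..<\<beta>} (\<lambda>z. (rep_L2 x z $ i)\<^sup>2)"
    unfolding set_integrable_def by (intro integrable_mult_indicator) auto
qed

lemma L2_on_uminus: "L2_on \<alpha> \<beta> f \<Longrightarrow> L2_on \<alpha> \<beta> (\<lambda>z. - f z)"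
  by (simp add: L2_on_def set_borel_measurable_def)

lemma L2_on_glue:
  assumes f: "L2_on \<alpha> \<gamma> f" and g: "L2_on \<gamma> \<beta> g"
  defines "h \<equiv> \<lambda>z. if z \<in> {\<alpha><..<\<gamma>} then f z else if z \<in> {\<gamma><..<\<beta>} then g z else 0"
  shows "h \<in> borel_measurable borel" "integrable lborel (\<lambda>z. (h z)\<^sup>2)"
proof -
  have h: "h = (\<lambda>z. indicator {\<alpha><..<\<gamma>} z *\<^sub>R f z + indicator {\<gamma><..<\<beta>} z *\<^sub>R g z)"
    by (auto simp: h_def indicator_def)
  have h2: "(\<lambda>z. (h z)\<^sup>2) = (\<lambda>z. indicator {\<alpha><..<\<gamma>} z *\<^sub>R (f z)\<^sup>2 + indicator {\<gamma><..<\<beta>} z *\<^sub>R (g z)\<^sup>2)"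
    by (auto simp: h_def indicator_def)
  show "h \<in> borel_measurable borel"
    unfolding h using f g by (intro borel_measurable_add) (auto simp: L2_on_def set_borel_measurable_def)
  show "integrable lborel (\<lambda>z. (h z)\<^sup>2)"
    unfolding h2 using f g by (intro Bochner_Integration.integrable_add) (auto simp: L2_on_def set_integrable_def)
qed

lemma H1_weak_deriv: "u \<in> H1 \<alpha> \<beta> \<Longrightarrow> L2_on \<alpha> \<beta> u \<and> has_weak_deriv \<alpha> \<beta> u (weak_deriv \<alpha> \<beta> u)"
  unfolding H1_def weak_deriv_def using someI_ex[of "has_weak_deriv \<alpha> \<beta> u"] by auto

text \<open>Densities coming from \<open>weak_deriv\<close> are controlled on their own interval
  only; this exchanges them for a component of an element of \<open>L2\<close>, which is Borel on
  the whole line.\<close>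

lemma indef_cong:
  assumes F: "indef_integral \<alpha> \<beta> F f" and [measurable]: "g \<in> borel_measurable borel"
    and ae: "AE z in lborel. z \<in> {\<alpha><..<\<beta>} \<longrightarrow> f z = g z"
  shows "indef_integral \<alpha> \<beta> F g"
  unfolding indef_integral_def
proof (intro conjI ballI)
  have int: "set_integrable lborel {\<alpha>..\<beta>} f" by (rule indef_integrable[OF F])
  have ae': "AE z in lborel. z \<in> {\<alpha>..\<beta>} \<longrightarrow> f z = g z"
    using ae AE_lborel_singleton[of \<alpha>] AE_lborel_singleton[of \<beta>] by eventually_elim auto
  have m: "(\<lambda>z. indicator {\<alpha>..t} z *\<^sub>R f z) \<in> borel_measurable lborel" if "t \<le> \<beta>" for t
    using set_integrable_imp_measurable[OF set_integrable_subset[OF int, of "{\<alpha>..t}"]] that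
    by (simp add: set_borel_measurable_def)
  show "set_integrable lborel {\<alpha>..\<beta>} g"
    unfolding set_integrable_def
  proof (rule integrable_cong_AE_imp)
    show "integrable lborel (\<lambda>z. indicator {\<alpha>..\<beta>} z *\<^sub>R f z)" using int by (simp add: set_integrable_def)
    show "AE z in lborel. indicator {\<alpha>..\<beta>} z *\<^sub>R f z = indicator {\<alpha>..\<beta>} z *\<^sub>R g z"
      using ae' by eventually_elim (auto simp: indicator_def)
  qed measurable
  fix z assume z: "z \<in> {\<alpha>..\<beta>}"
  have "(LINT s:{\<alpha>..z}|lborel. f s) = (LINT s:{\<alpha>..z}|lborel. g s)"
    unfolding set_lebesgue_integral_def
  proof (rule integral_cong_AE)
    show "AE s in lborel. indicator {\<alpha>..z} s *\<^sub>R f s = indicator {\<alpha>..z} s *\<^sub>R g s"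
      using ae' z by (auto simp: indicator_def elim!: AE_mp)
    show "(\<lambda>s. indicator {\<alpha>..z} s *\<^sub>R f s) \<in> borel_measurable lborel"
      using m z by simp
  qed measurable
  then show "F z = F \<alpha> + (LINT s:{\<alpha>..z}|lborel. g s)"
    using indef_eq[OF F z] by linarith
qed

lemma P1_mult: "P1 *v v = vector [- v $ 2, - v $ 1]" for v :: "real^2"
  by (simp add: vec_eq_iff forall_2 mat2_mult_vec P1_def)

lemma vec2_eq_iff: "v = vector [p, q] \<longleftrightarrow> v $ 1 = p \<and> v $ 2 = q" for v :: "real^2"
  by (simp add: vec_eq_iff forall_2)

lemma continuous_on_vector2:
  "continuous_on A p \<Longrightarrow> continuous_on A q \<Longrightarrow> continuous_on A (\<lambda>z. vector [p z, q z] :: real^2)"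
proof -
  assume "continuous_on A p" "continuous_on A q"
  then have "continuous_on A (\<lambda>z. (\<chi> i. if i = 1 then p z else q z) :: real^2)"
  proof (intro continuous_on_vec_lambda)
    show "continuous_on A (\<lambda>z. if i = 1 then p z else q z)" for i :: 2
      using \<open>continuous_on A p\<close> \<open>continuous_on A q\<close> by (cases "i = 1") simp_all
  qed
  moreover have "(\<chi> i. if i = 1 then p z else q z) = (vector [p z, q z] :: real^2)" for z
    by (simp add: vec_eq_iff forall_2)
  ultimately show "continuous_on A (\<lambda>z. vector [p z, q z] :: real^2)" by (simp only:)
qed

locale interface_system =
  fixes a b m M r :: real and Qm Qp :: "real \<Rightarrow> real^2^2" and W_B :: "real^4^2"
  assumes ab: "a < 0" "0 < b" and m_pos: "0 < m"
    and Qm_bounds: "\<And>z v. z \<in> {a..b} \<Longrightarrow> m * (v \<bullet> v) \<le> v \<bullet> (Qm z *v v) \<and> v \<bullet> (Qm z *v v) \<le> M * (v \<bullet> v)"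
    and Qp_bounds: "\<And>z v. z \<in> {a..b} \<Longrightarrow> m * (v \<bullet> v) \<le> v \<bullet> (Qp z *v v) \<and> v \<bullet> (Qp z *v v) \<le> M * (v \<bullet> v)"
    and Q_C1: "C1_on {a..b} Qm" "C1_on {a..b} Qp"
    and Q_diag: "\<And>z. z \<in> {a..b} \<Longrightarrow> Qm z $ 1 $ 2 = 0 \<and> Qm z $ 2 $ 1 = 0 \<and> Qp z $ 1 $ 2 = 0 \<and> Qp z $ 2 $ 1 = 0"
begin

lemma C1_on_continuous: "C1_on {a..b} Q \<Longrightarrow> continuous_on {a..b} Q"
  unfolding C1_on_def by (auto intro: continuous_on_vector_derivative)

lemma Q_entry_bounds:
  assumes "z \<in> {a..b}"
  shows "m \<le> Qm z $ i $ i" "Qm z $ i $ i \<le> M" "m \<le> Qp z $ i $ i" "Qp z $ i $ i \<le> M"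
proof -
  have "axis i 1 \<bullet> (A *v axis i 1) = A $ i $ i" for A :: "real^2^2"
    by (simp add: inner_axis' matrix_vector_mult_basis column_def)
  then show "m \<le> Qm z $ i $ i" "Qm z $ i $ i \<le> M" "m \<le> Qp z $ i $ i" "Qp z $ i $ i \<le> M"
    using Qm_bounds[OF assms, of "axis i 1"] Qp_bounds[OF assms, of "axis i 1"]
    by (simp_all add: inner_axis_axis)
qed

lemma Q_entry_pos: "z \<in> {a..b} \<Longrightarrow> 0 < Qm z $ i $ i" "z \<in> {a..b} \<Longrightarrow> 0 < Qp z $ i $ i"
  using Q_entry_bounds(1,3)[of z i] m_pos by auto

lemma Qm_mult: "z \<in> {a..b} \<Longrightarrow> (Qm z *v v) $ i = Qm z $ i $ i * v $ i"
  and Qp_mult: "z \<in> {a..b} \<Longrightarrow> (Qp z *v v) $ i = Qp z $ i $ i * v $ i"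
  using Q_diag[of z] exhaust_2[of i] by (auto simp: mat2_mult_vec)

lemma Q_entry_continuous:
  "continuous_on {a..b} (\<lambda>z. Qm z $ i $ j)" "continuous_on {a..b} (\<lambda>z. Qp z $ i $ j)"
  using C1_on_continuous[OF Q_C1(1)] C1_on_continuous[OF Q_C1(2)]
  by (auto intro!: continuous_intros)

abbreviation "X \<equiv> L2_interval a b"
abbreviation "Q l \<equiv> Q_at a b Qm Qp l"

lemma Q_left: "l \<in> {a<..<b} \<Longrightarrow> z \<in> {a<..<l} \<Longrightarrow> Q l z = Qm z"
  and Q_right: "l \<in> {a<..<b} \<Longrightarrow> z \<in> {l<..<b} \<Longrightarrow> Q l z = Qp z"
  by (auto simp: Q_at_def indicator_def)

lemma M_nonneg: "0 \<le> M"
  using Q_entry_bounds(1,2)[of 0 1] ab m_pos by auto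

lemma Q_diag_mult: 
  assumes l: "l \<in> {a<..<b}" shows "diag_mult M (Q l)"
  unfolding diag_mult_def
proof (intro conjI allI)
  fix i :: 2
  have "(\<lambda>z. indicator {a..<l} z *\<^sub>R (Qm z $ i $ i) + indicator {l<..b} z *\<^sub>R (Qp z $ i $ i)) \<in> borel_measurable borel"
    using l by (intro borel_measurable_add borel_measurable_continuous_on_indicator)
      (auto intro: continuous_on_subset[OF Q_entry_continuous(1)] continuous_on_subset[OF Q_entry_continuous(2)])
  then show "(\<lambda>z. Q l z $ i $ i) \<in> borel_measurable borel"
    by (simp add: Q_at_def)
next
  fix z and i :: 2
  show "Q l z $ 1 $ 2 = 0" "Q l z $ 2 $ 1 = 0"
    using l Q_diag[of z] by (auto simp: Q_at_def indicator_def)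
  show "0 \<le> Q l z $ i $ i" "Q l z $ i $ i \<le> M"
    using l Q_entry_bounds[of z i] m_pos M_nonneg by (auto simp: Q_at_def indicator_def)
qed

lemma Q_supp: "l \<in> {a<..<b} \<Longrightarrow> \<forall>z. z \<notin> {a..b} \<longrightarrow> Q l z = 0"
  by (auto simp: Q_at_def indicator_def)

lemma Q_lower:
  assumes l: "l \<in> {a<..<b}"
  shows "AE z in lborel. z \<in> {a..b} \<longrightarrow> m \<le> Q l z $ 1 $ 1 \<and> m \<le> Q l z $ 2 $ 2"
  using AE_lborel_singleton[of l]
proof eventually_elim
  case (elim z)
  then show ?case
    using l Q_entry_bounds(1,3)[of z] by (auto simp: Q_at_def indicator_def)
qed

definition effort :: "real \<Rightarrow> L2 \<Rightarrow> L2" where "effort l x = mult_op (Q l) x"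

lemma rep_effort:
  assumes l: "l \<in> {a<..<b}"
  shows "AE z in lborel. (z \<in> {a<..<l} \<longrightarrow> rep_L2 (effort l x) z = Qm z *v rep_L2 x z) \<and>
     (z \<in> {l<..<b} \<longrightarrow> rep_L2 (effort l x) z = Qp z *v rep_L2 x z) \<and>
     (z \<notin> {a..b} \<longrightarrow> rep_L2 (effort l x) z = 0)"
  unfolding effort_def using rep_mult_op[OF Q_diag_mult[OF l], of x]
proof eventually_elim
  case (elim z)
  then show ?case
    using Q_left[OF l, of z] Q_right[OF l, of z] Q_supp[OF l] by (auto simp: matrix_vector_mult_0)
qed

text \<open>\<open>trajectory l x y u v w\<close> says that \<open>u\<close>, \<open>v\<close>, \<open>w\<close> are the absolutely continuous representatives
  of the first component of \<open>\<Q>\<^sub>l x\<close> on the left and on the right of the interface and of the second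
  component, and that \<open>y = \<J>\<^sub>l (\<Q>\<^sub>l x)\<close>.\<close>

definition trajectory where
  "trajectory l x y u v w \<longleftrightarrow>
     indef_integral a l u (\<lambda>z. - rep_L2 y z $ 2) \<and> indef_integral l b v (\<lambda>z. - rep_L2 y z $ 2) \<and>
     indef_integral a b w (\<lambda>z. - rep_L2 y z $ 1) \<and>
     (AE z in lborel. z \<in> {a<..<l} \<longrightarrow> Qm z *v rep_L2 x z = vector [u z, w z]) \<and>
     (AE z in lborel. z \<in> {l<..<b} \<longrightarrow> Qp z *v rep_L2 x z = vector [v z, w z])"

definition boundary_f :: "real \<Rightarrow> real \<Rightarrow> real \<Rightarrow> real \<Rightarrow> real^2" where
  "boundary_f ua wa vb wb = (1 / sqrt 2) *\<^sub>R (P1 *v vector [vb, wb] - P1 *v vector [ua, wa])"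

definition boundary_e :: "real \<Rightarrow> real \<Rightarrow> real \<Rightarrow> real \<Rightarrow> real^2" where
  "boundary_e ua wa vb wb = (1 / sqrt 2) *\<^sub>R (vector [vb, wb] + vector [ua, wa])"

text \<open>A function of the four boundary values alone: \<open>l\<close> does not enter, so the
  boundary condition is the same for every position of the interface.\<close>

definition boundary :: "real \<Rightarrow> real \<Rightarrow> real \<Rightarrow> real \<Rightarrow> real^2" where
  "boundary ua wa vb wb = W_B *v stack (boundary_f ua wa vb wb) (boundary_e ua wa vb wb)"

lemma trajectory_effort:
  assumes l: "l \<in> {a<..<b}" and t: "trajectory l x y u v w"
  shows "AE z in lborel. z \<in> {a<..<l} \<longrightarrow> rep_L2 (effort l x) z = vector [u z, w z]"
    "AE z in lborel. z \<in> {l<..<b} \<longrightarrow> rep_L2 (effort l x) z = vector [v z, w z]"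
proof -
  have "AE z in lborel. z \<in> {a<..<l} \<longrightarrow> Qm z *v rep_L2 x z = vector [u z, w z]"
    "AE z in lborel. z \<in> {l<..<b} \<longrightarrow> Qp z *v rep_L2 x z = vector [v z, w z]"
    using t by (auto simp: trajectory_def)
  then show "AE z in lborel. z \<in> {a<..<l} \<longrightarrow> rep_L2 (effort l x) z = vector [u z, w z]"
    "AE z in lborel. z \<in> {l<..<b} \<longrightarrow> rep_L2 (effort l x) z = vector [v z, w z]"
    using rep_effort[OF l, of x] by (eventually_elim, auto)+
qed

lemma trajectory_effort2:
  assumes l: "l \<in> {a<..<b}" and t: "trajectory l x y u v w"
  shows "AE z in lborel. z \<in> {a<..<b} \<longrightarrow> rep_L2 (effort l x) z $ 2 = w z"
  using trajectory_effort[OF assms] AE_lborel_singleton[of l] by eventually_elim auto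

lemma trajectory_continuous:
  assumes l: "l \<in> {a<..<b}" and t: "trajectory l x y u v w"
  shows "continuous_on {a..l} u" "continuous_on {l..b} v" "continuous_on {a..b} w"
    "continuous_on {a..l} (\<lambda>z. vector [u z, w z] :: real^2)" "continuous_on {l..b} (\<lambda>z. vector [v z, w z] :: real^2)"
proof -
  show c: "continuous_on {a..l} u" "continuous_on {l..b} v" "continuous_on {a..b} w"
    using t by (auto simp: trajectory_def intro: indef_continuous)
  show "continuous_on {a..l} (\<lambda>z. vector [u z, w z] :: real^2)" "continuous_on {l..b} (\<lambda>z. vector [v z, w z] :: real^2)"
    using l by (intro continuous_on_vector2 c continuous_on_subset[OF c(3)]; auto)+
qed

lemma trajectory_traces:
  assumes l: "l \<in> {a<..<b}" and t: "trajectory l x y u v w"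
  shows "f_boundary a b l (effort l x) = boundary_f (u a) (w a) (v b) (w b)"
    "e_boundary a b l (effort l x) = boundary_e (u a) (w a) (v b) (w b)"
    "f_interface a b l (effort l x) = w l"
    "e_interface a b l (effort l x) = u l - v l"
    "trace_at a l (rep_L2 (effort l x)) a = vector [u a, w a]"
    "trace_at l b (rep_L2 (effort l x)) b = vector [v b, w b]"
    "trace_at a l (\<lambda>z. Qm z *v rep_L2 x z) a = vector [u a, w a]"
    "trace_at l b (\<lambda>z. Qp z *v rep_L2 x z) b = vector [v b, w b]"
proof -
  note e = trajectory_effort[OF l t]
  note c = trajectory_continuous[OF l t]
  have l': "a < l" "l < b" "a < b" using l by auto
  show ta: "trace_at a l (rep_L2 (effort l x)) a = vector [u a, w a]"
    using trace_at_eq[OF c(4) e(1) l'(1), of a] l' by simp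
  show tb: "trace_at l b (rep_L2 (effort l x)) b = vector [v b, w b]"
    using trace_at_eq[OF c(5) e(2) l'(2), of b] l' by simp
  show "f_boundary a b l (effort l x) = boundary_f (u a) (w a) (v b) (w b)"
    "e_boundary a b l (effort l x) = boundary_e (u a) (w a) (v b) (w b)"
    by (simp_all add: f_boundary_def e_boundary_def boundary_f_def boundary_e_def ta tb)
  show "f_interface a b l (effort l x) = w l"
    unfolding f_interface_def
    using trace_at_eq[OF c(3) trajectory_effort2[OF l t] l'(3), of l] l' by simp
  have "AE z in lborel. z \<in> {a<..<l} \<longrightarrow> rep_L2 (effort l x) z $ 1 = u z"
    "AE z in lborel. z \<in> {l<..<b} \<longrightarrow> rep_L2 (effort l x) z $ 1 = v z"
    using e by (eventually_elim, auto)+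
  from trace_at_eq[OF c(1) this(1) l'(1), of l] trace_at_eq[OF c(2) this(2) l'(2), of l]
  show "e_interface a b l (effort l x) = u l - v l"
    using l' by (simp add: e_interface_def)
  have "AE z in lborel. z \<in> {a<..<l} \<longrightarrow> Qm z *v rep_L2 x z = vector [u z, w z]"
    "AE z in lborel. z \<in> {l<..<b} \<longrightarrow> Qp z *v rep_L2 x z = vector [v z, w z]"
    using t by (auto simp: trajectory_def)
  from trace_at_eq[OF c(4) this(1) l'(1), of a] trace_at_eq[OF c(5) this(2) l'(2), of b]
  show "trace_at a l (\<lambda>z. Qm z *v rep_L2 x z) a = vector [u a, w a]"
    "trace_at l b (\<lambda>z. Qp z *v rep_L2 x z) b = vector [v b, w b]"
    using l' by auto
qed

text \<open>The state has a continuous version on either side, obtained by dividing the effort by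
  the positive continuous diagonal entries; multiplying back at \<open>l\<close> gives the effort
  again.\<close>

lemma trajectory_traces_state:
  assumes l: "l \<in> {a<..<b}" and t: "trajectory l x y u v w"
  shows "Qm l *v trace_at a l (rep_L2 x) l = vector [u l, w l]"
    "Qp l *v trace_at l b (rep_L2 x) l = vector [v l, w l]"
proof -
  note c = trajectory_continuous[OF l t]
  have l': "a < l" "l < b" "a < b" using l by auto
  have sub: "{a..l} \<subseteq> {a..b}" "{l..b} \<subseteq> {a..b}" using l' by auto
  have nz: "Qm z $ i $ i \<noteq> 0" "Qp z $ i $ i \<noteq> 0" if "z \<in> {a..b}" for z i
    using Q_entry_pos[OF that, of i] by auto
  have c1: "continuous_on {a..l} (\<lambda>z. vector [u z / Qm z $ 1 $ 1, w z / Qm z $ 2 $ 2] :: real^2)"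
    using nz sub by (intro continuous_on_vector2 continuous_on_divide c continuous_on_subset[OF Q_entry_continuous(1) sub(1)]
      continuous_on_subset[OF c(3) sub(1)]) auto
  have c2: "continuous_on {l..b} (\<lambda>z. vector [v z / Qp z $ 1 $ 1, w z / Qp z $ 2 $ 2] :: real^2)"
    using nz sub by (intro continuous_on_vector2 continuous_on_divide c continuous_on_subset[OF Q_entry_continuous(2) sub(2)]
      continuous_on_subset[OF c(3) sub(2)]) auto
  have "AE z in lborel. z \<in> {a<..<l} \<longrightarrow> Qm z *v rep_L2 x z = vector [u z, w z]"
    "AE z in lborel. z \<in> {l<..<b} \<longrightarrow> Qp z *v rep_L2 x z = vector [v z, w z]"
    using t by (auto simp: trajectory_def)
  then have "AE z in lborel. z \<in> {a<..<l} \<longrightarrow> rep_L2 x z = vector [u z / Qm z $ 1 $ 1, w z / Qm z $ 2 $ 2]"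
    "AE z in lborel. z \<in> {l<..<b} \<longrightarrow> rep_L2 x z = vector [v z / Qp z $ 1 $ 1, w z / Qp z $ 2 $ 2]"
    by (eventually_elim, use nz l' in \<open>auto simp: vec2_eq_iff Qm_mult Qp_mult field_simps\<close>)+
  from trace_at_eq[OF c1 this(1) l'(1), of l] trace_at_eq[OF c2 this(2) l'(2), of l]
  show "Qm l *v trace_at a l (rep_L2 x) l = vector [u l, w l]"
    "Qp l *v trace_at l b (rep_L2 x) l = vector [v l, w l]"
    using nz[of l] l' by (auto simp: vec2_eq_iff Qm_mult Qp_mult)
qed

lemma J_dom_sq_integrable:
  assumes e1: "(\<lambda>z. rep_L2 e z $ 1) \<in> H1 a l" "(\<lambda>z. rep_L2 e z $ 1) \<in> H1 l b"
    and e2: "(\<lambda>z. rep_L2 e z $ 2) \<in> H1 a l" "(\<lambda>z. rep_L2 e z $ 2) \<in> H1 l b"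
  shows "sq_integrable (\<lambda>z. if z \<in> {a<..<l} then P1 *v weak_deriv_vec a l (rep_L2 e) z
     else if z \<in> {l<..<b} then P1 *v weak_deriv_vec l b (rep_L2 e) z else 0)" (is "sq_integrable ?h")
  unfolding sq_integrable_iff
proof
  fix i :: 2
  \<comment> \<open>\<open>P1\<close> exchanges the two components up to sign, so component
    \<open>i\<close> of the image is a derivative of the other component.\<close>
  define j :: 2 where "j = (if i = 1 then 2 else 1)"
  have "L2_on a l (\<lambda>z. - weak_deriv a l (\<lambda>z. rep_L2 e z $ j) z)" 
    "L2_on l b (\<lambda>z. - weak_deriv l b (\<lambda>z. rep_L2 e z $ j) z)"
    using H1_weak_deriv[OF e1(1)] H1_weak_deriv[OF e1(2)] H1_weak_deriv[OF e2(1)] H1_weak_deriv[OF e2(2)]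
    by (auto simp: has_weak_deriv_def j_def intro!: L2_on_uminus)
  note g = L2_on_glue[OF this]
  have "?h z $ i = (if z \<in> {a<..<l} then - weak_deriv a l (\<lambda>z. rep_L2 e z $ j) z
      else if z \<in> {l<..<b} then - weak_deriv l b (\<lambda>z. rep_L2 e z $ j) z else 0)" for z
    using exhaust_2[of i] by (auto simp: P1_mult weak_deriv_vec_def j_def)
  then show "(\<lambda>z. ?h z $ i) \<in> borel_measurable borel \<and> integrable lborel (\<lambda>z. (?h z $ i)\<^sup>2)"
    using g by (simp only: simp_thms)
qed

text \<open>The domain provides a weak derivative of the second component on all of [a,b], whereas
  \<open>J_op\<close> differentiates it on each side separately; uniqueness of weak derivatives
  identifies the two almost everywhere.\<close>

lemma pH_dom_trajectory:
  assumes l: "l \<in> {a<..<b}" and x: "x \<in> pH_dom a b Qm Qp r W_B l"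
  obtains u v w where "trajectory l x (pH_op a b Qm Qp l x) u v w" "w l = r * (u l - v l)"
    "boundary (u a) (w a) (v b) (w b) = 0" "pH_op a b Qm Qp l x \<in> X"
proof -
  define e where "e = effort l x"
  define y where "y = pH_op a b Qm Qp l x"
  have l': "a < l" "l < b" "a < b" using l by auto
  have H: "(\<lambda>z. rep_L2 e z $ 1) \<in> H1 a l" "(\<lambda>z. rep_L2 e z $ 1) \<in> H1 l b" "(\<lambda>z. rep_L2 e z $ 2) \<in> H1 a b"
    using x by (auto simp: pH_dom_def J_dom_def e_def effort_def Let_def)
  define g1 where "g1 = weak_deriv a l (\<lambda>z. rep_L2 e z $ 1)"
  define g2 where "g2 = weak_deriv l b (\<lambda>z. rep_L2 e z $ 1)"
  define g where "g = weak_deriv a b (\<lambda>z. rep_L2 e z $ 2)"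
  have wd: "has_weak_deriv a l (\<lambda>z. rep_L2 e z $ 1) g1" "has_weak_deriv l b (\<lambda>z. rep_L2 e z $ 1) g2"
      "has_weak_deriv a b (\<lambda>z. rep_L2 e z $ 2) g"
    using H[THEN H1_weak_deriv] by (auto simp: g1_def g2_def g_def)
  obtain u where u: "indef_integral a l u g1" "AE z in lborel. z \<in> {a..l} \<longrightarrow> rep_L2 e z $ 1 = u z"
    by (rule weak_deriv_indef[OF L2_on_rep wd(1) l'(1)])
  obtain v where v: "indef_integral l b v g2" "AE z in lborel. z \<in> {l..b} \<longrightarrow> rep_L2 e z $ 1 = v z"
    by (rule weak_deriv_indef[OF L2_on_rep wd(2) l'(2)])
  obtain w where w: "indef_integral a b w g" "AE z in lborel. z \<in> {a..b} \<longrightarrow> rep_L2 e z $ 2 = w z"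
    by (rule weak_deriv_indef[OF L2_on_rep wd(3) l'(3)])
  have w_l: "indef_integral a l w g" and w_r: "indef_integral l b w g"
    by (rule indef_sub[OF w(1)]; use l' in simp)+
  have g_l: "L2_on a l g" and g_r: "L2_on l b g"
    using wd(3) l' by (auto simp: has_weak_deriv_def intro: L2_on_subset)
  have ae_l: "AE z in lborel. z \<in> {a<..<l} \<longrightarrow> rep_L2 e z $ 2 = w z"
    and ae_r: "AE z in lborel. z \<in> {l<..<b} \<longrightarrow> rep_L2 e z $ 2 = w z"
    using w(2) by (eventually_elim, use l' in auto)+
  note d_l = weak_deriv_eq[OF w_l g_l L2_on_rep ae_l l'(1)]
  note d_r = weak_deriv_eq[OF w_r g_r L2_on_rep ae_r l'(2)]
  define h where "h z = (if z \<in> {a<..<l} then P1 *v weak_deriv_vec a l (rep_L2 e) z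
     else if z \<in> {l<..<b} then P1 *v weak_deriv_vec l b (rep_L2 e) z else 0)" for z
  have h: "sq_integrable h"
    unfolding h_def by (rule J_dom_sq_integrable[OF H(1,2) d_l(1) d_r(1)])
  have "y = abs_L2 h"
    unfolding y_def pH_op_def J_op_def h_def[abs_def] e_def effort_def ..
  then have y: "AE z in lborel. rep_L2 y z = h z"
    using rep_abs_L2[OF h] by simp
  have "AE z in lborel. z \<in> {a<..<l} \<longrightarrow> g1 z = - rep_L2 y z $ 2"
    using y by eventually_elim (simp add: h_def P1_mult weak_deriv_vec_def g1_def)
  from indef_cong[OF u(1) _ this] have 1: "indef_integral a l u (\<lambda>z. - rep_L2 y z $ 2)" by measurable
  have "AE z in lborel. z \<in> {l<..<b} \<longrightarrow> g2 z = - rep_L2 y z $ 2"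
    using y by eventually_elim (auto simp: h_def P1_mult weak_deriv_vec_def g2_def)
  from indef_cong[OF v(1) _ this] have 2: "indef_integral l b v (\<lambda>z. - rep_L2 y z $ 2)" by measurable
  have "AE z in lborel. z \<in> {a<..<b} \<longrightarrow> g z = - rep_L2 y z $ 1"
    using y d_l(2) d_r(2) AE_lborel_singleton[of l]
    by eventually_elim (auto simp: h_def P1_mult weak_deriv_vec_def)
  from indef_cong[OF w(1) _ this] have 3: "indef_integral a b w (\<lambda>z. - rep_L2 y z $ 1)" by measurable
  have 4: "AE z in lborel. z \<in> {a<..<l} \<longrightarrow> Qm z *v rep_L2 x z = vector [u z, w z]"
    using rep_effort[OF l, of x] u(2) w(2) by eventually_elim (use l' in \<open>auto simp: vec2_eq_iff e_def\<close>)
  have 5: "AE z in lborel. z \<in> {l<..<b} \<longrightarrow> Qp z *v rep_L2 x z = vector [v z, w z]"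
    using rep_effort[OF l, of x] v(2) w(2) by eventually_elim (use l' in \<open>auto simp: vec2_eq_iff e_def\<close>)
  have t: "trajectory l x y u v w"
    unfolding trajectory_def using 1 2 3 4 5 by blast
  have "y \<in> X"
    unfolding L2_interval_iff using y by eventually_elim (use l' in \<open>auto simp: h_def\<close>)
  moreover have "w l = r * (u l - v l)" "boundary (u a) (w a) (v b) (w b) = 0"
    using x trajectory_traces[OF l t] by (auto simp: pH_dom_def Let_def boundary_def effort_def)
  ultimately show ?thesis
    using that t by (simp add: y_def)
qed

text \<open>Converse of \<open>pH_dom_trajectory\<close>: an element is placed in the domain, and
  its image is identified, by exhibiting a trajectory. Linearity, surjectivity and the attained
  boundary data all go this way.\<close>

lemma trajectory_pH_dom:
  assumes l: "l \<in> {a<..<b}" and t: "trajectory l x y u v w" and bc: "w l = r * (u l - v l)"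
    "boundary (u a) (w a) (v b) (w b) = 0" and x: "x \<in> X" and y: "y \<in> X"
  shows "x \<in> pH_dom a b Qm Qp r W_B l" "pH_op a b Qm Qp l x = y"
proof -
  define e where "e = effort l x"
  have l': "a < l" "l < b" "a < b" using l by auto
  have t': "indef_integral a l u (\<lambda>z. - rep_L2 y z $ 2)" "indef_integral l b v (\<lambda>z. - rep_L2 y z $ 2)"
     "indef_integral a b w (\<lambda>z. - rep_L2 y z $ 1)"
    using t by (auto simp: trajectory_def)
  have w_l: "indef_integral a l w (\<lambda>z. - rep_L2 y z $ 1)" and w_r: "indef_integral l b w (\<lambda>z. - rep_L2 y z $ 1)"
    by (rule indef_sub[OF t'(3)]; use l' in simp)+
  have ae: "AE z in lborel. z \<in> {a<..<l} \<longrightarrow> rep_L2 e z $ 1 = u z" "AE z in lborel. z \<in> {a<..<l} \<longrightarrow> rep_L2 e z $ 2 = w z"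
    "AE z in lborel. z \<in> {l<..<b} \<longrightarrow> rep_L2 e z $ 1 = v z" "AE z in lborel. z \<in> {l<..<b} \<longrightarrow> rep_L2 e z $ 2 = w z"
    using trajectory_effort[OF l t] by (eventually_elim, auto simp: e_def)+
  have L: "L2_on \<alpha> \<beta> (\<lambda>z. - rep_L2 y z $ i)" for \<alpha> \<beta> i
    by (intro L2_on_uminus L2_on_rep)
  note d1 = weak_deriv_eq[OF t'(1) L L2_on_rep ae(1) l'(1)]
  note d2 = weak_deriv_eq[OF w_l L L2_on_rep ae(2) l'(1)]
  note d3 = weak_deriv_eq[OF t'(2) L L2_on_rep ae(3) l'(2)]
  note d4 = weak_deriv_eq[OF w_r L L2_on_rep ae(4) l'(2)]
  note d5 = weak_deriv_eq[OF t'(3) L L2_on_rep trajectory_effort2[OF l t, folded e_def] l'(3)]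
  have "e \<in> X"
    unfolding L2_interval_iff using rep_effort[OF l, of x] by eventually_elim (simp add: e_def)
  then have "e \<in> J_dom a b l"
    using d1(1) d3(1) d5(1) by (simp add: J_dom_def)
  then show "x \<in> pH_dom a b Qm Qp r W_B l"
    using trajectory_traces[OF l t] bc x by (simp add: pH_dom_def Let_def boundary_def e_def effort_def)
  have "pH_op a b Qm Qp l x = abs_L2 (\<lambda>z. if z \<in> {a<..<l} then P1 *v weak_deriv_vec a l (rep_L2 e) z
     else if z \<in> {l<..<b} then P1 *v weak_deriv_vec l b (rep_L2 e) z else 0)"
    unfolding pH_op_def J_op_def e_def effort_def ..
  also have "\<dots> = y"
  proof (rule abs_L2_eqI[OF J_dom_sq_integrable[OF d1(1) d3(1) d2(1) d4(1)]])
    have "AE z in lborel. z \<notin> {a..b} \<longrightarrow> rep_L2 y z = 0" using y by (simp add: L2_interval_iff)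
    then show "AE z in lborel. (if z \<in> {a<..<l} then P1 *v weak_deriv_vec a l (rep_L2 e) z
     else if z \<in> {l<..<b} then P1 *v weak_deriv_vec l b (rep_L2 e) z else 0) = rep_L2 y z"
      using d1(2) d2(2) d3(2) d4(2) AE_lborel_singleton[of a] AE_lborel_singleton[of b] AE_lborel_singleton[of l]
    proof eventually_elim
      case (elim z)
      consider "z \<in> {a<..<l}" | "z \<in> {l<..<b}" | "z \<notin> {a..b}" using elim l' by fastforce
      then show ?case
      proof cases
        case 1
        then show ?thesis using elim by (simp add: P1_mult weak_deriv_vec_def vec_eq_iff forall_2)
      next
        case 2
        then show ?thesis using elim by (simp add: P1_mult weak_deriv_vec_def vec_eq_iff forall_2)
      next
        case 3
        then have n: "z \<notin> {a<..<l}" "z \<notin> {l<..<b}" using l' by auto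
        show ?thesis unfolding if_not_P[OF n(1)] if_not_P[OF n(2)] using elim(1) 3 by simp
      qed
    qed
  qed
  finally show "pH_op a b Qm Qp l x = y" .
qed

end

section \<open>Energy identities\<close>

lemma set_integral_cong_AE_weak:
  fixes f g :: "real \<Rightarrow> real"
  assumes f: "set_integrable lborel A f" and g: "set_integrable lborel A g"
    and ae: "AE z in lborel. z \<in> A \<longrightarrow> f z = g z"
  shows "(LINT z:A|lborel. f z) = (LINT z:A|lborel. g z)"
  unfolding set_lebesgue_integral_def
proof (rule integral_cong_AE)
  show "AE z in lborel. indicator A z *\<^sub>R f z = indicator A z *\<^sub>R g z"
    using ae by eventually_elim (auto simp: indicator_def)
qed (use f g in \<open>auto simp: set_integrable_def\<close>)

lemma indef_glue:
  assumes f: "indef_integral \<alpha> \<gamma> F f" and g: "indef_integral \<gamma> \<beta> F g" and le: "\<alpha> \<le> \<gamma>" "\<gamma> \<le> \<beta>"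
  shows "indef_integral \<alpha> \<beta> F (\<lambda>z. if z \<le> \<gamma> then f z else g z)" (is "indef_integral _ _ _ ?h")
proof -
  have h1: "set_integrable lborel {\<alpha>..z} ?h" if "z \<le> \<gamma>" for z
    using set_integrable_subset[OF indef_integrable[OF f], of "{\<alpha>..z}"] that
    by (subst set_integrable_cong[OF refl refl, of _ _ f]) auto
  have h2: "set_integrable lborel {\<gamma><..z} ?h" if "z \<le> \<beta>" for z
    using set_integrable_subset[OF indef_integrable[OF g], of "{\<gamma><..z}"] that
    by (subst set_integrable_cong[OF refl refl, of _ _ g]) (auto simp: subset_iff)
  have split: "set_integrable lborel {\<alpha>..z} ?h \<and> F z = F \<alpha> + (LINT s:{\<alpha>..z}|lborel. ?h s)"
    if z: "\<gamma> \<le> z" "z \<le> \<beta>" for z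
  proof
    have e: "{\<alpha>..z} = {\<alpha>..\<gamma>} \<union> {\<gamma><..z}" using z le by auto
    show int: "set_integrable lborel {\<alpha>..z} ?h"
      unfolding e using h1[of \<gamma>] h2[OF z(2)] by (intro set_integrable_Un) auto
    have "(LINT s:{\<alpha>..z}|lborel. ?h s) = (LINT s:{\<alpha>..\<gamma>}|lborel. ?h s) + (LINT s:{\<gamma>..z}|lborel. ?h s)"
      using set_integral_split[OF int, of \<gamma> z] z le by simp
    also have "(LINT s:{\<alpha>..\<gamma>}|lborel. ?h s) = (LINT s:{\<alpha>..\<gamma>}|lborel. f s)"
      by (intro set_lebesgue_integral_cong) auto
    also have "(LINT s:{\<gamma>..z}|lborel. ?h s) = (LINT s:{\<gamma>..z}|lborel. g s)"
    proof (rule set_integral_cong_AE_weak)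
      show "set_integrable lborel {\<gamma>..z} ?h" by (rule set_integrable_subset[OF int]) (use le in auto)
      show "set_integrable lborel {\<gamma>..z} g"
        by (rule set_integrable_subset[OF indef_integrable[OF g]]) (use z in auto)
      show "AE s in lborel. s \<in> {\<gamma>..z} \<longrightarrow> ?h s = g s"
        using AE_lborel_singleton[of \<gamma>] by eventually_elim auto
    qed
    finally show "F z = F \<alpha> + (LINT s:{\<alpha>..z}|lborel. ?h s)"
      using indef_diff[OF f, of \<alpha> \<gamma>] indef_diff[OF g, of \<gamma> z] z le by simp
  qed
  show ?thesis
    unfolding indef_integral_def
  proof (intro conjI ballI)
    show "set_integrable lborel {\<alpha>..\<beta>} ?h" using split le by blast
    fix z assume z: "z \<in> {\<alpha>..\<beta>}"
    show "F z = F \<alpha> + (LINT s:{\<alpha>..z}|lborel. ?h s)"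
    proof (cases "\<gamma> \<le> z")
      case True
      then show ?thesis using conjunct2[OF split[OF True]] z by simp
    next
      case False
      then have "(LINT s:{\<alpha>..z}|lborel. ?h s) = (LINT s:{\<alpha>..z}|lborel. f s)"
        by (intro set_lebesgue_integral_cong) auto
      then show ?thesis using indef_diff[OF f, of \<alpha> z] z False by simp
    qed
  qed
qed

lemma indef_const: "indef_integral \<alpha> \<beta> (\<lambda>_. c) (\<lambda>_. 0)"
  by (rule indef_C1) (auto intro: derivative_eq_intros)

lemma indef_transform:
  assumes "indef_integral \<alpha> \<beta> F f" "\<And>z. z \<in> {\<alpha>..\<beta>} \<Longrightarrow> F z = G z" "\<alpha> \<le> \<beta>"
  shows "indef_integral \<alpha> \<beta> G f"
  unfolding indef_integral_def
proof (intro conjI ballI)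
  show "set_integrable lborel {\<alpha>..\<beta>} f" by (rule indef_integrable[OF assms(1)])
  fix z assume z: "z \<in> {\<alpha>..\<beta>}"
  show "G z = G \<alpha> + (LINT s:{\<alpha>..z}|lborel. f s)"
    using indef_eq[OF assms(1) z] assms(2)[OF z] assms(2)[of \<alpha>] assms(3) by simp
qed

text \<open>Since u' = -f and w' = -g, the integrand is minus the weight times (u w)', and the
  product rule for \<open>\<rho>\<close> and \<open>u * w\<close> applies.\<close>

lemma weighted_parts:
  assumes \<rho>: "indef_integral \<alpha> \<beta> \<rho> \<rho>'" and u: "indef_integral \<alpha> \<beta> u (\<lambda>z. - f z)"
    and w: "indef_integral \<alpha> \<beta> w (\<lambda>z. - g z)" and le: "\<alpha> \<le> \<beta>"
  shows "set_integrable lborel {\<alpha>..\<beta>} (\<lambda>z. \<rho> z * (u z * g z + w z * f z))"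
    and "set_integrable lborel {\<alpha>..\<beta>} (\<lambda>z. \<rho>' z * (u z * w z))"
    and "(LINT z:{\<alpha>..\<beta>}|lborel. \<rho> z * (u z * g z + w z * f z)) =
      (LINT z:{\<alpha>..\<beta>}|lborel. \<rho>' z * (u z * w z)) - (\<rho> \<beta> * (u \<beta> * w \<beta>) - \<rho> \<alpha> * (u \<alpha> * w \<alpha>))"
proof -
  note uw = indef_mult[OF u w]
  have i1: "set_integrable lborel {\<alpha>..\<beta>} (\<lambda>z. \<rho> z * (u z * - g z + w z * - f z))"
    by (rule set_integrable_indef_mult[OF \<rho> indef_integrable[OF uw]])
  have i2: "set_integrable lborel {\<alpha>..\<beta>} (\<lambda>z. (u z * w z) * \<rho>' z)"
    by (rule set_integrable_indef_mult[OF uw indef_integrable[OF \<rho>]])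
  have e1: "(\<lambda>z. \<rho> z * (u z * - g z + w z * - f z)) = (\<lambda>z. - (\<rho> z * (u z * g z + w z * f z)))"
    by (auto simp: algebra_simps)
  have e2: "(\<lambda>z. (u z * w z) * \<rho>' z) = (\<lambda>z. \<rho>' z * (u z * w z))" by (auto simp: mult.commute)
  have "set_integrable lborel {\<alpha>..\<beta>} (\<lambda>z. - 1 * (- (\<rho> z * (u z * g z + w z * f z))))"
    using i1 unfolding e1 by (rule set_integrable_mult_right)
  then show j1: "set_integrable lborel {\<alpha>..\<beta>} (\<lambda>z. \<rho> z * (u z * g z + w z * f z))" by simp
  show "set_integrable lborel {\<alpha>..\<beta>} (\<lambda>z. \<rho>' z * (u z * w z))" using i2 unfolding e2 .
  have "\<rho> \<beta> * (u \<beta> * w \<beta>) - \<rho> \<alpha> * (u \<alpha> * w \<alpha>)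
     = (LINT z:{\<alpha>..\<beta>}|lborel. \<rho> z * (u z * - g z + w z * - f z) + (u z * w z) * \<rho>' z)"
    by (rule integral_product_rule[OF \<rho> uw le])
  also have "\<dots> = (LINT z:{\<alpha>..\<beta>}|lborel. \<rho> z * (u z * - g z + w z * - f z)) + (LINT z:{\<alpha>..\<beta>}|lborel. (u z * w z) * \<rho>' z)"
    by (rule set_integral_add(2)[OF i1 i2])
  also have "(LINT z:{\<alpha>..\<beta>}|lborel. \<rho> z * (u z * - g z + w z * - f z)) = - (LINT z:{\<alpha>..\<beta>}|lborel. \<rho> z * (u z * g z + w z * f z))"
    unfolding e1 by (rule set_integral_uminus[OF j1])
  finally show "(LINT z:{\<alpha>..\<beta>}|lborel. \<rho> z * (u z * g z + w z * f z)) =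
      (LINT z:{\<alpha>..\<beta>}|lborel. \<rho>' z * (u z * w z)) - (\<rho> \<beta> * (u \<beta> * w \<beta>) - \<rho> \<alpha> * (u \<alpha> * w \<alpha>))"
    unfolding e2 by simp
qed

lemma weighted_parts_bound:
  fixes u w \<rho>' :: "real \<Rightarrow> real"
  assumes u: "continuous_on {\<alpha>..\<beta>} u" and w: "continuous_on {\<alpha>..\<beta>} w"
    and int: "set_integrable lborel {\<alpha>..\<beta>} (\<lambda>z. \<rho>' z * (u z * w z))"
    and K: "\<And>z. z \<in> {\<alpha>..\<beta>} \<Longrightarrow> \<bar>\<rho>' z\<bar> \<le> K"
  shows "\<bar>LINT z:{\<alpha>..\<beta>}|lborel. \<rho>' z * (u z * w z)\<bar> \<le> K * (LINT z:{\<alpha>..\<beta>}|lborel. (u z)\<^sup>2 + (w z)\<^sup>2)"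
    and "set_integrable lborel {\<alpha>..\<beta>} (\<lambda>z. (u z)\<^sup>2 + (w z)\<^sup>2)"
proof -
  show i: "set_integrable lborel {\<alpha>..\<beta>} (\<lambda>z. (u z)\<^sup>2 + (w z)\<^sup>2)"
    unfolding set_integrable_def by (intro borel_integrable_compact continuous_intros u w) auto
  have "norm (LINT z:{\<alpha>..\<beta>}|lborel. \<rho>' z * (u z * w z)) \<le> (LINT z:{\<alpha>..\<beta>}|lborel. norm (\<rho>' z * (u z * w z)))"
    by (rule set_integral_norm_bound[OF int])
  also have "\<dots> \<le> (LINT z:{\<alpha>..\<beta>}|lborel. K * ((u z)\<^sup>2 + (w z)\<^sup>2))"
  proof (rule set_integral_mono)
    show "set_integrable lborel {\<alpha>..\<beta>} (\<lambda>z. norm (\<rho>' z * (u z * w z)))"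
      using set_integrable_abs[OF int] by simp
    show "set_integrable lborel {\<alpha>..\<beta>} (\<lambda>z. K * ((u z)\<^sup>2 + (w z)\<^sup>2))"
      using i by (rule set_integrable_mult_right)
    fix z assume z: "z \<in> {\<alpha>..\<beta>}"
    have "\<bar>u z * w z\<bar> \<le> (u z)\<^sup>2 + (w z)\<^sup>2"
      using sum_squares_bound[of "\<bar>u z\<bar>" "\<bar>w z\<bar>"] mult_nonneg_nonneg[of "\<bar>u z\<bar>" "\<bar>w z\<bar>"]
      by (simp add: abs_mult del: mult_nonneg_nonneg)
    then have "\<bar>\<rho>' z\<bar> * \<bar>u z * w z\<bar> \<le> K * ((u z)\<^sup>2 + (w z)\<^sup>2)"
      using K[OF z] by (intro mult_mono) auto
    then show "norm (\<rho>' z * (u z * w z)) \<le> K * ((u z)\<^sup>2 + (w z)\<^sup>2)" by (simp add: abs_mult)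
  qed
  finally show "\<bar>LINT z:{\<alpha>..\<beta>}|lborel. \<rho>' z * (u z * w z)\<bar> \<le> K * (LINT z:{\<alpha>..\<beta>}|lborel. (u z)\<^sup>2 + (w z)\<^sup>2)"
    by simp
qed

context interface_system begin

lemma norm_effort:
  assumes l: "l \<in> {a<..<b}" and t: "trajectory l x y u v w"
  shows "(norm (effort l x))\<^sup>2 = (LINT z:{a..l}|lborel. (u z)\<^sup>2 + (w z)\<^sup>2) + (LINT z:{l..b}|lborel. (v z)\<^sup>2 + (w z)\<^sup>2)"
proof -
  have l': "a < l" "l < b" "a < b" using l by auto
  note c = trajectory_continuous[OF l t]
  have int: "integrable lborel (\<lambda>z. (norm (rep_L2 (effort l x) z))\<^sup>2)" by (rule integrable_norm_rep)
  have iA: "set_integrable lborel A (\<lambda>z. (norm (rep_L2 (effort l x) z))\<^sup>2)" if "A \<in> sets borel" for A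
    using integrable_mult_indicator[OF _ int, of A] that by (simp add: set_integrable_def)
  have "(norm (effort l x))\<^sup>2 = (LINT z:{a..b}|lborel. (norm (rep_L2 (effort l x) z))\<^sup>2)"
    unfolding norm_rep set_lebesgue_integral_def
  proof (rule integral_cong_AE)
    show "AE z in lborel. (norm (rep_L2 (effort l x) z))\<^sup>2 = indicator {a..b} z *\<^sub>R (norm (rep_L2 (effort l x) z))\<^sup>2"
      using rep_effort[OF l, of x] by eventually_elim (auto simp: indicator_def)
  qed measurable
  also have "\<dots> = (LINT z:{a..l}|lborel. (norm (rep_L2 (effort l x) z))\<^sup>2) + (LINT z:{l..b}|lborel. (norm (rep_L2 (effort l x) z))\<^sup>2)"
    using l' by (intro set_integral_split[OF iA]) auto
  also have "(LINT z:{a..l}|lborel. (norm (rep_L2 (effort l x) z))\<^sup>2) = (LINT z:{a..l}|lborel. (u z)\<^sup>2 + (w z)\<^sup>2)"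
  proof (rule set_integral_cong_AE_weak[OF iA])
    show "set_integrable lborel {a..l} (\<lambda>z. (u z)\<^sup>2 + (w z)\<^sup>2)"
      unfolding set_integrable_def using l'
      by (intro borel_integrable_compact continuous_intros c continuous_on_subset[OF c(3)]) auto
    show "AE z in lborel. z \<in> {a..l} \<longrightarrow> (norm (rep_L2 (effort l x) z))\<^sup>2 = (u z)\<^sup>2 + (w z)\<^sup>2"
      using trajectory_effort(1)[OF l t] AE_lborel_singleton[of a] AE_lborel_singleton[of l]
      by eventually_elim (auto simp: norm_vec2_sq)
  qed simp
  also have "(LINT z:{l..b}|lborel. (norm (rep_L2 (effort l x) z))\<^sup>2) = (LINT z:{l..b}|lborel. (v z)\<^sup>2 + (w z)\<^sup>2)"
  proof (rule set_integral_cong_AE_weak[OF iA])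
    show "set_integrable lborel {l..b} (\<lambda>z. (v z)\<^sup>2 + (w z)\<^sup>2)"
      unfolding set_integrable_def using l'
      by (intro borel_integrable_compact continuous_intros c continuous_on_subset[OF c(3)]) auto
    show "AE z in lborel. z \<in> {l..b} \<longrightarrow> (norm (rep_L2 (effort l x) z))\<^sup>2 = (v z)\<^sup>2 + (w z)\<^sup>2"
      using trajectory_effort(2)[OF l t] AE_lborel_singleton[of b] AE_lborel_singleton[of l]
      by eventually_elim (auto simp: norm_vec2_sq)
  qed simp
  finally show ?thesis .
qed

text \<open>If \<open>S\<close> is a scalar weight times Q_l on either side, then
  \<open>x . S y\<close> is the weight times the effort paired with \<open>y\<close>, a total
  derivative up to the weight. \<open>S = Q l\<close> gives the energy balance of the operator,
  \<open>S = Q 0\<close> the one in the fixed norm; \<open>K\<close> bounds the slope of the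
  weight.\<close>

lemma weighted_energy:
  assumes l: "l \<in> {a<..<b}" and t: "trajectory l x y u v w" and S: "diag_mult M S"
    and \<rho>: "indef_integral a l \<rho> \<rho>'" and \<sigma>: "indef_integral l b \<sigma> \<sigma>'"
    and S_l: "AE z in lborel. z \<in> {a<..<l} \<longrightarrow> S z = \<rho> z *\<^sub>R Qm z"
    and S_r: "AE z in lborel. z \<in> {l<..<b} \<longrightarrow> S z = \<sigma> z *\<^sub>R Qp z"
    and K: "\<And>z. z \<in> {a..l} \<Longrightarrow> \<bar>\<rho>' z\<bar> \<le> K" "\<And>z. z \<in> {l..b} \<Longrightarrow> \<bar>\<sigma>' z\<bar> \<le> K"
  shows "\<bar>inner_Q a b S y x + 1 / 2 * (\<rho> l * (u l * w l) - \<rho> a * (u a * w a))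
      + 1 / 2 * (\<sigma> b * (v b * w b) - \<sigma> l * (v l * w l))\<bar> \<le> K * (norm (effort l x))\<^sup>2"
proof -
  have l': "a < l" "l < b" "a < b" using l by auto
  note c = trajectory_continuous[OF l t]
  have t': "indef_integral a l u (\<lambda>z. - rep_L2 y z $ 2)" "indef_integral l b v (\<lambda>z. - rep_L2 y z $ 2)"
     "indef_integral a b w (\<lambda>z. - rep_L2 y z $ 1)"
     "AE z in lborel. z \<in> {a<..<l} \<longrightarrow> Qm z *v rep_L2 x z = vector [u z, w z]"
     "AE z in lborel. z \<in> {l<..<b} \<longrightarrow> Qp z *v rep_L2 x z = vector [v z, w z]"
    using t by (auto simp: trajectory_def)
  have w_l: "indef_integral a l w (\<lambda>z. - rep_L2 y z $ 1)" and w_r: "indef_integral l b w (\<lambda>z. - rep_L2 y z $ 1)"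
    by (rule indef_sub[OF t'(3)]; use l' in simp)+
  note P = weighted_parts[OF \<rho> t'(1) w_l less_imp_le[OF l'(1)]]
  note R = weighted_parts[OF \<sigma> t'(2) w_r less_imp_le[OF l'(2)]]
  have w_lc: "continuous_on {a..l} w" and w_rc: "continuous_on {l..b} w"
    by (rule continuous_on_subset[OF c(3)]; use l' in auto)+
  note PB = weighted_parts_bound[OF c(1) w_lc P(2) K(1)]
  note RB = weighted_parts_bound[OF c(2) w_rc R(2) K(2)]
  define I where "I z = rep_L2 x z \<bullet> (S z *v rep_L2 y z)" for z
  have int: "integrable lborel I"
    unfolding I_def by (intro sq_integrable_inner diag_mult_sq_integrable[OF S] sq_integrable_rep)
  have iA: "set_integrable lborel A I" if "A \<in> sets borel" for A
    using integrable_mult_indicator[OF _ int, of A] that by (simp add: set_integrable_def)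
  have "inner_Q a b S y x = 1 / 2 * (LINT z:{a..b}|lborel. I z)"
    by (simp add: inner_Q_def I_def)
  also have "(LINT z:{a..b}|lborel. I z) = (LINT z:{a..l}|lborel. I z) + (LINT z:{l..b}|lborel. I z)"
    using l' by (intro set_integral_split[OF iA]) auto
  also have "(LINT z:{a..l}|lborel. I z) = (LINT z:{a..l}|lborel. \<rho> z * (u z * rep_L2 y z $ 1 + w z * rep_L2 y z $ 2))"
  proof (rule set_integral_cong_AE_weak[OF iA P(1)])
    show "AE z in lborel. z \<in> {a..l} \<longrightarrow> I z = \<rho> z * (u z * rep_L2 y z $ 1 + w z * rep_L2 y z $ 2)"
      using S_l t'(4) AE_lborel_singleton[of a] AE_lborel_singleton[of l]
    proof eventually_elim
      case (elim z)
      show ?case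
      proof
        assume "z \<in> {a..l}"
        then have z: "z \<in> {a<..<l}" "z \<in> {a..b}" using elim l' by auto
        have "u z = Qm z $ 1 $ 1 * rep_L2 x z $ 1" "w z = Qm z $ 2 $ 2 * rep_L2 x z $ 2"
          using elim(2) z by (auto simp: vec2_eq_iff Qm_mult)
        then show "I z = \<rho> z * (u z * rep_L2 y z $ 1 + w z * rep_L2 y z $ 2)"
          unfolding I_def inner_vec2 diag_mult_nth[OF S] using elim(1) z by (simp add: algebra_simps)
      qed
    qed
  qed simp
  also have "(LINT z:{l..b}|lborel. I z) = (LINT z:{l..b}|lborel. \<sigma> z * (v z * rep_L2 y z $ 1 + w z * rep_L2 y z $ 2))"
  proof (rule set_integral_cong_AE_weak[OF iA R(1)])
    show "AE z in lborel. z \<in> {l..b} \<longrightarrow> I z = \<sigma> z * (v z * rep_L2 y z $ 1 + w z * rep_L2 y z $ 2)"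
      using S_r t'(5) AE_lborel_singleton[of b] AE_lborel_singleton[of l]
    proof eventually_elim
      case (elim z)
      show ?case
      proof
        assume "z \<in> {l..b}"
        then have z: "z \<in> {l<..<b}" "z \<in> {a..b}" using elim l' by auto
        have "v z = Qp z $ 1 $ 1 * rep_L2 x z $ 1" "w z = Qp z $ 2 $ 2 * rep_L2 x z $ 2"
          using elim(2) z by (auto simp: vec2_eq_iff Qp_mult)
        then show "I z = \<sigma> z * (v z * rep_L2 y z $ 1 + w z * rep_L2 y z $ 2)"
          unfolding I_def inner_vec2 diag_mult_nth[OF S] using elim(1) z by (simp add: algebra_simps)
      qed
    qed
  qed simp
  finally have "inner_Q a b S y x + 1 / 2 * (\<rho> l * (u l * w l) - \<rho> a * (u a * w a))
      + 1 / 2 * (\<sigma> b * (v b * w b) - \<sigma> l * (v l * w l))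
      = 1 / 2 * (LINT z:{a..l}|lborel. \<rho>' z * (u z * w z)) + 1 / 2 * (LINT z:{l..b}|lborel. \<sigma>' z * (v z * w z))"
    unfolding P(3) R(3) by (simp add: algebra_simps)
  also have "\<bar>\<dots>\<bar> \<le> \<bar>LINT z:{a..l}|lborel. \<rho>' z * (u z * w z)\<bar> + \<bar>LINT z:{l..b}|lborel. \<sigma>' z * (v z * w z)\<bar>"
    by linarith
  also have "\<dots> \<le> K * (LINT z:{a..l}|lborel. (u z)\<^sup>2 + (w z)\<^sup>2) + K * (LINT z:{l..b}|lborel. (v z)\<^sup>2 + (w z)\<^sup>2)"
    by (rule add_mono[OF PB(1) RB(1)])
  also have "\<dots> = K * (norm (effort l x))\<^sup>2"
    unfolding norm_effort[OF l t] by (simp add: distrib_left)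
  finally show ?thesis .
qed

text \<open>Both weights are 1 and \<open>K\<close> is 0, so the estimate of
  \<open>weighted_energy\<close> becomes an identity.\<close>

lemma energy:
  assumes l: "l \<in> {a<..<b}" and t: "trajectory l x y u v w"
  shows "inner_Q a b (Q l) y x = - 1 / 2 * (v b * w b - u a * w a) - 1 / 2 * w l * (u l - v l)"
proof -
  have "\<bar>inner_Q a b (Q l) y x + 1 / 2 * (1 * (u l * w l) - 1 * (u a * w a))
      + 1 / 2 * (1 * (v b * w b) - 1 * (v l * w l))\<bar> \<le> 0 * (norm (effort l x))\<^sup>2"
    by (rule weighted_energy[OF l t Q_diag_mult[OF l] indef_const indef_const])
      (use Q_left[OF l] Q_right[OF l] in auto)
  then have "inner_Q a b (Q l) y x = - (1 / 2 * (u l * w l - u a * w a)) - 1 / 2 * (v b * w b - v l * w l)"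
    by simp
  then show ?thesis by (simp add: algebra_simps diff_divide_distrib add_divide_distrib)
qed

end

lemma L2_on_continuous:
  assumes "continuous_on {\<alpha>..\<beta>} f" shows "L2_on \<alpha> \<beta> f"
  unfolding L2_on_def
proof
  show "set_borel_measurable lborel {\<alpha><..<\<beta>} f"
  proof -
    have "continuous_on {\<alpha><..<\<beta>} f" by (rule continuous_on_subset[OF assms]) auto
    from borel_measurable_continuous_on_indicator[OF _ this] show ?thesis
      by (simp add: set_borel_measurable_def)
  qed
  have "set_integrable lborel {\<alpha>..\<beta>} (\<lambda>z. (f z)\<^sup>2)"
    unfolding set_integrable_def by (intro borel_integrable_compact continuous_intros assms) auto
  then show "set_integrable lborel {\<alpha><..<\<beta>} (\<lambda>z. (f z)\<^sup>2)"
    by (rule set_integrable_subset) auto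
qed

lemma vector_4:
  "(vector [x, y, z, w] :: real^4) $ 1 = x" "(vector [x, y, z, w] :: real^4) $ 2 = y"
  "(vector [x, y, z, w] :: real^4) $ 3 = z" "(vector [x, y, z, w] :: real^4) $ 4 = w"
  unfolding vector_def by simp_all

text \<open>If \<open>s\<close> exceeded the bound, then \<open>t <= s\<close>, so one factor
  \<open>t\<close> of the last term could be replaced by \<open>s\<close>; dividing by
  \<open>s\<close> gives a contradiction.\<close>

lemma square_le_imp_le:
  fixes s t P R :: real
  assumes "s\<^sup>2 \<le> P * (t * s) + R * t\<^sup>2" and "0 \<le> s" "0 \<le> t" "0 \<le> P" "0 \<le> R"
  shows "s \<le> (P + R + 1) * t"
proof (rule ccontr)
  assume "\<not> ?thesis"
  then have gt: "(P + R + 1) * t < s" by simp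
  have "t \<le> (P + R + 1) * t" using assms by (simp add: mult_le_cancel_right1)
  then have ts: "t \<le> s" and s: "0 < s" using gt assms by (auto intro: le_less_trans)
  have "R * (t * t) \<le> R * (t * s)" using ts assms by (intro mult_left_mono) auto
  then have "s * s \<le> ((P + R) * t) * s" using assms(1) by (simp add: power2_eq_square algebra_simps)
  then have "s \<le> (P + R) * t" using s by simp
  also have "\<dots> \<le> (P + R + 1) * t" using assms by (intro mult_right_mono) auto
  finally show False using gt by simp
qed

lemma L1_le_norm:
  assumes x: "x \<in> L2_interval a b" and ab: "a \<le> b"
  shows "(LINT z|lborel. norm (rep_L2 x z)) \<le> (b - a + 1) * norm x"
proof (cases "x = 0")
  case True
  have "(LINT z|lborel. norm (rep_L2 x z)) = (LINT z::real|lborel. 0 :: real)"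
    by (rule integral_cong_AE) (measurable, use rep_zero True in \<open>auto elim!: AE_mp\<close>)
  then show ?thesis using True by simp
next
  case False
  then have "(LINT z|lborel. norm (rep_L2 x z)) \<le> norm x * (b - a) + (norm x)\<^sup>2 / norm x"
    by (intro L1_le_L2[OF x _ ab]) simp
  then show ?thesis using False by (simp add: power2_eq_square algebra_simps)
qed

lemma indef_add:
  assumes F: "indef_integral \<alpha> \<beta> F f" and G: "indef_integral \<alpha> \<beta> G g"
  shows "indef_integral \<alpha> \<beta> (\<lambda>z. F z + G z) (\<lambda>z. f z + g z)"
  unfolding indef_integral_def
proof (intro conjI ballI)
  note i = indef_integrable[OF F] indef_integrable[OF G]
  show "set_integrable lborel {\<alpha>..\<beta>} (\<lambda>z. f z + g z)" using i by (rule set_integral_add)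
  fix z assume z: "z \<in> {\<alpha>..\<beta>}"
  have "(LINT s:{\<alpha>..z}|lborel. f s + g s) = (LINT s:{\<alpha>..z}|lborel. f s) + (LINT s:{\<alpha>..z}|lborel. g s)"
    using z by (intro set_integral_add(2) set_integrable_subset[OF i(1)] set_integrable_subset[OF i(2)]) auto
  then show "F z + G z = F \<alpha> + G \<alpha> + (LINT s:{\<alpha>..z}|lborel. f s + g s)"
    using indef_eq[OF F z] indef_eq[OF G z] by linarith
qed

lemma indef_cmult:
  assumes F: "indef_integral \<alpha> \<beta> F f" shows "indef_integral \<alpha> \<beta> (\<lambda>z. c * F z) (\<lambda>z. c * f z)"
  using indef_mult[OF indef_const[of _ _ c] F] by simp

context interface_system begin

text \<open>The state is recovered from the effort by dividing by the diagonal entries; these are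
  continuous and nonzero on the closed sides, so the quotients are square integrable.\<close>

lemma trajectory_exists:
  assumes l: "l \<in> {a<..<b}"
    and u: "indef_integral a l u (\<lambda>z. - rep_L2 y z $ 2)" and v: "indef_integral l b v (\<lambda>z. - rep_L2 y z $ 2)"
    and w: "indef_integral a b w (\<lambda>z. - rep_L2 y z $ 1)"
  obtains x where "x \<in> X" "trajectory l x y u v w"
proof -
  have l': "a < l" "l < b" "a < b" using l by auto
  have sub: "{a..l} \<subseteq> {a..b}" "{l..b} \<subseteq> {a..b}" using l' by auto
  have nz: "Qm z $ i $ i \<noteq> 0" "Qp z $ i $ i \<noteq> 0" if "z \<in> {a..b}" for z i
    using Q_entry_pos[OF that, of i] by auto
  define f where "f z = (if z \<in> {a<..<l} then vector [u z / Qm z $ 1 $ 1, w z / Qm z $ 2 $ 2]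
     else if z \<in> {l<..<b} then vector [v z / Qp z $ 1 $ 1, w z / Qp z $ 2 $ 2] else (0::real^2))" for z
  have c: "continuous_on {a..l} u" "continuous_on {l..b} v" "continuous_on {a..l} w" "continuous_on {l..b} w"
    using indef_continuous[OF u] indef_continuous[OF v] continuous_on_subset[OF indef_continuous[OF w]] sub by auto
  have q: "continuous_on {a..l} (\<lambda>z. Qm z $ i $ i)" "continuous_on {l..b} (\<lambda>z. Qp z $ i $ i)" for i
    by (rule continuous_on_subset[OF Q_entry_continuous(1) sub(1)] continuous_on_subset[OF Q_entry_continuous(2) sub(2)])+
  have f: "sq_integrable f"
    unfolding sq_integrable_iff
  proof
    fix i :: 2
    define p where "p z = (if i = 1 then u z else w z)" for z
    define s where "s z = (if i = 1 then v z else w z)" for z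
    have "continuous_on {a..l} p" "continuous_on {l..b} s"
      using c by (cases "i = 1"; simp add: p_def[abs_def] s_def[abs_def])+
    then have "L2_on a l (\<lambda>z. p z / Qm z $ i $ i)" "L2_on l b (\<lambda>z. s z / Qp z $ i $ i)"
      using nz sub by (intro L2_on_continuous continuous_on_divide q; auto)+
    note g = L2_on_glue[OF this]
    have "f z $ i = (if z \<in> {a<..<l} then p z / Qm z $ i $ i else if z \<in> {l<..<b} then s z / Qp z $ i $ i else 0)" for z
      using exhaust_2[of i] by (auto simp: f_def p_def s_def)
    then show "(\<lambda>z. f z $ i) \<in> borel_measurable borel \<and> integrable lborel (\<lambda>z. (f z $ i)\<^sup>2)"
      using g by (simp only: simp_thms)
  qed
  note rep = rep_abs_L2[OF f]
  have "abs_L2 f \<in> X"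
    unfolding L2_interval_iff using rep by eventually_elim (use l' in \<open>auto simp: f_def\<close>)
  moreover have "trajectory l (abs_L2 f) y u v w"
    unfolding trajectory_def
  proof (intro conjI u v w)
    show "AE z in lborel. z \<in> {a<..<l} \<longrightarrow> Qm z *v rep_L2 (abs_L2 f) z = vector [u z, w z]"
      using rep by eventually_elim (use l' nz in \<open>auto simp: f_def vec2_eq_iff Qm_mult\<close>)
    show "AE z in lborel. z \<in> {l<..<b} \<longrightarrow> Qp z *v rep_L2 (abs_L2 f) z = vector [v z, w z]"
      using rep by eventually_elim (use l' nz in \<open>auto simp: f_def vec2_eq_iff Qp_mult\<close>)
  qed
  ultimately show ?thesis by (rule that)
qed

lemma boundary_eq:
  "boundary ua wa vb wb = (1 / sqrt 2) *\<^sub>R (W_B *v vector [wa - wb, ua - vb, vb + ua, wb + wa])"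
proof -
  have "stack (boundary_f ua wa vb wb) (boundary_e ua wa vb wb) = (1 / sqrt 2) *\<^sub>R vector [wa - wb, ua - vb, vb + ua, wb + wa]"
    by (simp add: stack_def boundary_f_def boundary_e_def P1_mult vec_eq_iff forall_4 vector_4)
  then show ?thesis by (simp add: boundary_def matrix_vector_mult_scaleR)
qed

lemma boundary_add: "boundary (ua + ua') (wa + wa') (vb + vb') (wb + wb') = boundary ua wa vb wb + boundary ua' wa' vb' wb'"
proof -
  have "vector [wa + wa' - (wb + wb'), ua + ua' - (vb + vb'), vb + vb' + (ua + ua'), wb + wb' + (wa + wa')]
    = (vector [wa - wb, ua - vb, vb + ua, wb + wa] + vector [wa' - wb', ua' - vb', vb' + ua', wb' + wa'] :: real^4)"
    by (simp add: vec_eq_iff forall_4 vector_4)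
  then show ?thesis
    by (simp add: boundary_eq matrix_vector_right_distrib scaleR_add_right)
qed

lemma boundary_scale: "boundary (c * ua) (c * wa) (c * vb) (c * wb) = c *\<^sub>R boundary ua wa vb wb"
proof -
  have "vector [c * wa - c * wb, c * ua - c * vb, c * vb + c * ua, c * wb + c * wa]
    = (c *\<^sub>R vector [wa - wb, ua - vb, vb + ua, wb + wa] :: real^4)"
    by (simp add: vec_eq_iff forall_4 vector_4 algebra_simps)
  then show ?thesis
    by (simp add: boundary_eq matrix_vector_mult_scaleR)
qed

lemma trajectory_add:
  assumes t: "trajectory l x y u v w" and t': "trajectory l x' y' u' v' w'"
  shows "trajectory l (x + x') (y + y') (\<lambda>z. u z + u' z) (\<lambda>z. v z + v' z) (\<lambda>z. w z + w' z)"
proof -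
  have *: "indef_integral \<alpha> \<beta> (\<lambda>z. F z + G z) (\<lambda>z. - rep_L2 (y + y') z $ i)"
    if F: "indef_integral \<alpha> \<beta> F (\<lambda>z. - rep_L2 y z $ i)" and G: "indef_integral \<alpha> \<beta> G (\<lambda>z. - rep_L2 y' z $ i)" for \<alpha> \<beta> F G i
  proof (rule indef_cong)
    show "AE z in lborel. z \<in> {\<alpha><..<\<beta>} \<longrightarrow> - rep_L2 y z $ i + - rep_L2 y' z $ i = - rep_L2 (y + y') z $ i"
      using rep_plus[of y y'] by eventually_elim simp
    show "indef_integral \<alpha> \<beta> (\<lambda>z. F z + G z) (\<lambda>z. - rep_L2 y z $ i + - rep_L2 y' z $ i)"
      by (rule indef_add[OF F G])
  qed measurable
  have m: "AE z in lborel. z \<in> A \<longrightarrow> P z *v rep_L2 (x + x') z = vector [p z + p' z, w z + w' z]"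
    if "AE z in lborel. z \<in> A \<longrightarrow> P z *v rep_L2 x z = vector [p z, w z]"
      "AE z in lborel. z \<in> A \<longrightarrow> P z *v rep_L2 x' z = vector [p' z, w' z]" for A p p' and P :: "real \<Rightarrow> real^2^2"
    using that rep_plus[of x x'] by eventually_elim (auto simp: matrix_vector_right_distrib vec2_eq_iff)
  show ?thesis
    using t t' unfolding trajectory_def by (intro conjI * m) (simp_all only:)
qed

lemma trajectory_scale:
  assumes t: "trajectory l x y u v w"
  shows "trajectory l (c *\<^sub>R x) (c *\<^sub>R y) (\<lambda>z. c * u z) (\<lambda>z. c * v z) (\<lambda>z. c * w z)"
proof -
  have *: "indef_integral \<alpha> \<beta> (\<lambda>z. c * F z) (\<lambda>z. - rep_L2 (c *\<^sub>R y) z $ i)"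
    if F: "indef_integral \<alpha> \<beta> F (\<lambda>z. - rep_L2 y z $ i)" for \<alpha> \<beta> F i
  proof (rule indef_cong)
    show "AE z in lborel. z \<in> {\<alpha><..<\<beta>} \<longrightarrow> c * (- rep_L2 y z $ i) = - rep_L2 (c *\<^sub>R y) z $ i"
      using rep_scaleR[of c y] by eventually_elim simp
    show "indef_integral \<alpha> \<beta> (\<lambda>z. c * F z) (\<lambda>z. c * (- rep_L2 y z $ i))"
      by (rule indef_cmult[OF F])
  qed measurable
  have m: "AE z in lborel. z \<in> A \<longrightarrow> P z *v rep_L2 (c *\<^sub>R x) z = vector [c * p z, c * w z]"
    if "AE z in lborel. z \<in> A \<longrightarrow> P z *v rep_L2 x z = vector [p z, w z]" for A p and P :: "real \<Rightarrow> real^2^2"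
    using that rep_scaleR[of c x] by eventually_elim (auto simp: matrix_vector_mult_scaleR vec2_eq_iff)
  show ?thesis
    using t unfolding trajectory_def by (intro conjI * m) (simp_all only:)
qed

end

section \<open>Dissipation and bounded invertibility of the operators\<close>

locale dissipative_interface_system = interface_system +
  fixes k :: real
  assumes r_pos: "0 < r" and k_pos: "0 < k"
    and k_dissip: "\<And>x. x \<in> pH_dom a b Qm Qp r W_B 0 \<Longrightarrow>
       inner_Q a b (Q_at a b Qm Qp 0) (pH_op a b Qm Qp 0 x) x
         \<le> - k * ((norm (trace_at a 0 (rep_L2 (mult_op (Q_at a b Qm Qp 0) x)) a))\<^sup>2
                + (norm (trace_at 0 b (rep_L2 (mult_op (Q_at a b Qm Qp 0) x)) b))\<^sup>2)"
begin

lemma pH_dom_add: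
  assumes l: "l \<in> {a<..<b}" and x: "x \<in> pH_dom a b Qm Qp r W_B l" and x': "x' \<in> pH_dom a b Qm Qp r W_B l"
  shows "x + x' \<in> pH_dom a b Qm Qp r W_B l"
    "pH_op a b Qm Qp l (x + x') = pH_op a b Qm Qp l x + pH_op a b Qm Qp l x'"
proof -
  obtain u v w where t: "trajectory l x (pH_op a b Qm Qp l x) u v w" "w l = r * (u l - v l)"
    "boundary (u a) (w a) (v b) (w b) = 0" "pH_op a b Qm Qp l x \<in> X"
    by (rule pH_dom_trajectory[OF l x])
  obtain u' v' w' where t': "trajectory l x' (pH_op a b Qm Qp l x') u' v' w'" "w' l = r * (u' l - v' l)"
    "boundary (u' a) (w' a) (v' b) (w' b) = 0" "pH_op a b Qm Qp l x' \<in> X"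
    by (rule pH_dom_trajectory[OF l x'])
  have X: "x \<in> X" "x' \<in> X" using x x' by (auto simp: pH_dom_def)
  show "x + x' \<in> pH_dom a b Qm Qp r W_B l"
    "pH_op a b Qm Qp l (x + x') = pH_op a b Qm Qp l x + pH_op a b Qm Qp l x'"
    by (rule trajectory_pH_dom[OF l trajectory_add[OF t(1) t'(1)]],
      use t t' X in \<open>auto simp: algebra_simps boundary_add intro: subspace_add[OF subspace_L2_interval]\<close>)+
qed

lemma pH_dom_scale:
  assumes l: "l \<in> {a<..<b}" and x: "x \<in> pH_dom a b Qm Qp r W_B l"
  shows "c *\<^sub>R x \<in> pH_dom a b Qm Qp r W_B l" "pH_op a b Qm Qp l (c *\<^sub>R x) = c *\<^sub>R pH_op a b Qm Qp l x"
proof -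
  obtain u v w where t: "trajectory l x (pH_op a b Qm Qp l x) u v w" "w l = r * (u l - v l)"
    "boundary (u a) (w a) (v b) (w b) = 0" "pH_op a b Qm Qp l x \<in> X"
    by (rule pH_dom_trajectory[OF l x])
  have X: "x \<in> X" using x by (auto simp: pH_dom_def)
  show "c *\<^sub>R x \<in> pH_dom a b Qm Qp r W_B l" "pH_op a b Qm Qp l (c *\<^sub>R x) = c *\<^sub>R pH_op a b Qm Qp l x"
    by (rule trajectory_pH_dom[OF l trajectory_scale[OF t(1)]],
      use t(2-) X in \<open>simp_all add: boundary_scale subspace_scale[OF subspace_L2_interval] right_diff_distrib mult.left_commute\<close>)+
qed

text \<open>The dissipation estimate for \<open>A\<^bsub>\<Q>\<^sub>0\<^esub>\<close> only involves the boundary values: every admissible boundary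
  datum is attained by a piecewise affine effort that vanishes at the interface.\<close>

lemma boundary_dissipation:
  assumes bc: "boundary ua wa vb wb = 0"
  shows "- 1 / 2 * (vb * wb - ua * wa) \<le> - k * (ua\<^sup>2 + wa\<^sup>2 + vb\<^sup>2 + wb\<^sup>2)"
proof -
  have l: "0 \<in> {a<..<b}" using ab by simp
  \<comment> \<open>The image \<open>P1 e'\<close> of the effort that is linear on either side,
    vanishes at 0 and takes the values \<open>(ua, wa)\<close> at \<open>a\<close> and
    \<open>(vb, wb)\<close> at \<open>b\<close>.\<close>
  define f where "f z = (if z \<in> {a<..<0} then vector [- wa / a, - ua / a]
     else if z \<in> {0<..<b} then vector [- wb / b, - vb / b] else (0::real^2))" for z
  have f: "sq_integrable f"
    unfolding sq_integrable_iff
  proof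
    fix i :: 2
    define p where "p = (if i = 1 then - wa / a else - ua / a)"
    define s where "s = (if i = 1 then - wb / b else - vb / b)"
    have "L2_on a 0 (\<lambda>_. p)" "L2_on 0 b (\<lambda>_. s)"
      by (intro L2_on_continuous continuous_on_const)+
    note g = L2_on_glue[OF this]
    have "f z $ i = (if z \<in> {a<..<0} then p else if z \<in> {0<..<b} then s else 0)" for z
      using exhaust_2[of i] by (auto simp: f_def p_def s_def)
    then show "(\<lambda>z. f z $ i) \<in> borel_measurable borel \<and> integrable lborel (\<lambda>z. (f z $ i)\<^sup>2)"
      using g by (simp only: simp_thms)
  qed
  define y where "y = abs_L2 f"
  have y: "AE z in lborel. rep_L2 y z = f z" unfolding y_def by (rule rep_abs_L2[OF f])
  have yX: "y \<in> X"
    unfolding L2_interval_iff using y by eventually_elim (use ab in \<open>auto simp: f_def\<close>)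
  have lin: "indef_integral \<alpha> \<beta> (\<lambda>z. c * z / d) (\<lambda>_. c / d)" for \<alpha> \<beta> c d
  proof (rule indef_C1)
    fix z assume "z \<in> {\<alpha>..\<beta>}"
    have "((\<lambda>z. c * z / d) has_real_derivative c * 1 / d) (at z within {\<alpha>..\<beta>})"
      by (intro DERIV_cdivide DERIV_cmult DERIV_ident)
    then show "((\<lambda>z. c * z / d) has_vector_derivative c / d) (at z within {\<alpha>..\<beta>})"
      by (simp add: has_real_derivative_iff_has_vector_derivative)
  qed (rule continuous_on_const)
  have u: "indef_integral a 0 (\<lambda>z. ua * z / a) (\<lambda>z. - rep_L2 y z $ 2)"
    by (rule indef_cong[OF lin]) (measurable, use y in eventually_elim, auto simp: f_def)
  have v: "indef_integral 0 b (\<lambda>z. vb * z / b) (\<lambda>z. - rep_L2 y z $ 2)"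
    by (rule indef_cong[OF lin]) (measurable, use y in eventually_elim, auto simp: f_def)
  define w where "w z = (if z \<le> 0 then wa * z / a else wb * z / b)" for z
  have "indef_integral a b w (\<lambda>z. if z \<le> 0 then wa / a else wb / b)"
  proof (rule indef_glue)
    show "indef_integral a 0 w (\<lambda>_. wa / a)"
      by (rule indef_transform[OF lin]) (use ab in \<open>auto simp: w_def\<close>)
    show "indef_integral 0 b w (\<lambda>_. wb / b)"
      by (rule indef_transform[OF lin]) (use ab in \<open>auto simp: w_def\<close>)
  qed (use ab in auto)
  then have w: "indef_integral a b w (\<lambda>z. - rep_L2 y z $ 1)"
    by (rule indef_cong) (measurable, use y AE_lborel_singleton[of 0] in eventually_elim, auto simp: f_def)
  obtain x where x: "x \<in> X" and t: "trajectory 0 x y (\<lambda>z. ua * z / a) (\<lambda>z. vb * z / b) w"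
    by (rule trajectory_exists[OF l u v w])
  \<comment> \<open>All efforts vanish at the interface: the interface condition holds and the
    interface power is zero, so only boundary terms are left in the energy balance.\<close>
  have wv: "w 0 = 0" "w a = wa" "w b = wb" using ab by (auto simp: w_def)
  have dom: "x \<in> pH_dom a b Qm Qp r W_B 0" "pH_op a b Qm Qp 0 x = y"
    by (rule trajectory_pH_dom[OF l t]; use wv bc x yX ab in simp)+
  have "inner_Q a b (Q 0) y x = - 1 / 2 * (vb * wb - ua * wa)"
    using energy[OF l t] wv ab by simp
  moreover have "inner_Q a b (Q 0) y x \<le> - k * (ua\<^sup>2 + wa\<^sup>2 + (vb\<^sup>2 + wb\<^sup>2))"
    using k_dissip[OF dom(1)] trajectory_traces(5,6)[OF l t] wv ab
    unfolding dom(2) effort_def by (simp add: norm_vec2_sq)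
  ultimately show ?thesis by (simp add: add.assoc)
qed

lemma dissipation:
  assumes l: "l \<in> {a<..<b}" and t: "trajectory l x y u v w" and bc: "w l = r * (u l - v l)"
    "boundary (u a) (w a) (v b) (w b) = 0"
  shows "inner_Q a b (Q l) y x \<le> - k * ((u a)\<^sup>2 + (w a)\<^sup>2 + (v b)\<^sup>2 + (w b)\<^sup>2)"
proof -
  have "1 / 2 * w l * (u l - v l) = r / 2 * (u l - v l)\<^sup>2"
    by (simp add: bc(1) power2_eq_square)
  then have "0 \<le> 1 / 2 * w l * (u l - v l)" using r_pos by simp
  then show ?thesis
    using energy[OF l t] boundary_dissipation[OF bc(2)] by linarith
qed

text \<open>Integrating \<open>y\<close> leaves three free constants: the values of the first effort
  component at both ends and of the second at \<open>a\<close>. The interface condition contributes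
  one equation and the boundary condition two.\<close>

lemma onto:
  assumes l: "l \<in> {a<..<b}" and y: "y \<in> X"
  shows "\<exists>x\<in>pH_dom a b Qm Qp r W_B l. pH_op a b Qm Qp l x = y"
proof -
  have l': "a < l" "l < b" "a < b" using l by auto
  \<comment> \<open>The homogeneous system, for \<open>y = 0\<close>: the efforts are piecewise
    constant and the second component has the same value at both ends.\<close>
  define \<Lambda> :: "real^3 \<Rightarrow> real^3" where "\<Lambda> p = vector [p $ 2 - r * (p $ 1 - p $ 3),
     boundary (p $ 1) (p $ 2) (p $ 3) (p $ 2) $ 1, boundary (p $ 1) (p $ 2) (p $ 3) (p $ 2) $ 2]" for p
  have lin: "linear \<Lambda>"
    by (rule linearI) (simp_all add: \<Lambda>_def vec_eq_iff forall_3 boundary_add boundary_scale algebra_simps)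
  have "inj \<Lambda>"
    unfolding linear_injective_0[OF lin]
  proof (intro allI impI)
    fix p assume zero: "\<Lambda> p = 0"
    have comp: "\<Lambda> p $ 1 = p $ 2 - r * (p $ 1 - p $ 3)" "\<Lambda> p $ 2 = boundary (p $ 1) (p $ 2) (p $ 3) (p $ 2) $ 1"
      "\<Lambda> p $ 3 = boundary (p $ 1) (p $ 2) (p $ 3) (p $ 2) $ 2"
      by (simp_all add: \<Lambda>_def)
    have *: "p $ 2 = r * (p $ 1 - p $ 3)" using comp(1) zero by simp
    have b: "boundary (p $ 1) (p $ 2) (p $ 3) (p $ 2) $ 1 = 0" "boundary (p $ 1) (p $ 2) (p $ 3) (p $ 2) $ 2 = 0"
      using comp(2,3) zero by simp_all
    have bz: "boundary (p $ 1) (p $ 2) (p $ 3) (p $ 2) = 0"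
      by (simp add: vec_eq_iff forall_2 b)
    \<comment> \<open>In the homogeneous case the boundary power equals the interface dissipation
      and is nonnegative, while \<open>boundary_dissipation\<close> bounds it by \<open>- k\<close>
      times the sum of the squares; so all three constants vanish.\<close>
    have eq: "- 1 / 2 * (p $ 3 * p $ 2 - p $ 1 * p $ 2) = r / 2 * (p $ 1 - p $ 3)\<^sup>2"
      unfolding * by (simp add: power2_eq_square algebra_simps)
    have "0 \<le> r / 2 * (p $ 1 - p $ 3)\<^sup>2" using r_pos by simp
    then have "0 \<le> - 1 / 2 * (p $ 3 * p $ 2 - p $ 1 * p $ 2)" unfolding eq .
    with boundary_dissipation[OF bz] have "k * ((p $ 1)\<^sup>2 + (p $ 2)\<^sup>2 + (p $ 3)\<^sup>2 + (p $ 2)\<^sup>2) \<le> 0" by simp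
    then have "(p $ 1)\<^sup>2 + (p $ 2)\<^sup>2 + (p $ 3)\<^sup>2 + (p $ 2)\<^sup>2 \<le> 0" using k_pos by (simp add: mult_le_0_iff)
    then have "(p $ 1)\<^sup>2 = 0 \<and> (p $ 2)\<^sup>2 = 0 \<and> (p $ 3)\<^sup>2 = 0"
      using zero_le_power2[of "p $ 1"] zero_le_power2[of "p $ 2"] zero_le_power2[of "p $ 3"] by linarith
    then show "p = 0" by (simp add: vec_eq_iff forall_3)
  qed
  then have "surj \<Lambda>" by (intro linear_injective_imp_surjective lin refl)
  have int: "set_integrable lborel {\<alpha>..\<beta>} (\<lambda>z. - rep_L2 y z $ i)" for \<alpha> \<beta> i
    by (intro L2_on_integrable L2_on_uminus L2_on_rep)
  define U where "U = (LINT s:{a..l}|lborel. - rep_L2 y s $ 2)"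
  define V where "V = (LINT s:{l..b}|lborel. - rep_L2 y s $ 2)"
  define W where "W z = (LINT s:{a..z}|lborel. - rep_L2 y s $ 1)" for z
  obtain p where p: "\<Lambda> p = vector [r * (U + V) - W l, - boundary 0 0 0 (W b) $ 1, - boundary 0 0 0 (W b) $ 2]"
    using \<open>surj \<Lambda>\<close> by (metis surjD)
  have p1: "p $ 2 - r * (p $ 1 - p $ 3) = r * (U + V) - W l"
    and p2: "boundary (p $ 1) (p $ 2) (p $ 3) (p $ 2) = - boundary 0 0 0 (W b)"
    using p by (simp_all add: \<Lambda>_def vec_eq_iff forall_3 forall_2)
  define u where "u z = p $ 1 + (LINT s:{a..z}|lborel. - rep_L2 y s $ 2)" for z
  \<comment> \<open>Normalised at \<open>b\<close>, where the unknown \<open>p $ 3\<close> is the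
    boundary value; hence the correction by \<open>V\<close>.\<close>
  define v where "v z = p $ 3 - V + (LINT s:{l..z}|lborel. - rep_L2 y s $ 2)" for z
  define w where "w z = p $ 2 + (LINT s:{a..z}|lborel. - rep_L2 y s $ 1)" for z
  have u: "indef_integral a l u (\<lambda>z. - rep_L2 y z $ 2)"
    unfolding u_def by (rule indefI[OF int])
  have v: "indef_integral l b v (\<lambda>z. - rep_L2 y z $ 2)"
    unfolding v_def by (rule indefI[OF int])
  have w: "indef_integral a b w (\<lambda>z. - rep_L2 y z $ 1)"
    unfolding w_def by (rule indefI[OF int])
  have null: "(LINT s:{z..z}|lborel. - rep_L2 y s $ i) = 0" for z i
    using indefI[OF int[of z z i], of 0] by (simp add: indef_integral_def)
  have vals: "u a = p $ 1" "w a = p $ 2" "v b = p $ 3" "w b = p $ 2 + W b" "u l = p $ 1 + U" "v l = p $ 3 - V" "w l = p $ 2 + W l"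
    by (auto simp only: u_def v_def w_def null U_def V_def W_def)
  obtain x where x: "x \<in> X" "trajectory l x y u v w"
    by (rule trajectory_exists[OF l u v w])
  have bc1: "w l = r * (u l - v l)"
    using p1 by (simp add: vals algebra_simps)
  have bc2: "boundary (u a) (w a) (v b) (w b) = 0"
    using boundary_add[of "p $ 1" 0 "p $ 2" 0 "p $ 3" 0 "p $ 2" "W b"] p2 by (simp add: vals)
  show ?thesis
    using trajectory_pH_dom[OF l x(2) bc1 bc2 x(1) y] by blast
qed

lemma norm_state_le_effort:
  assumes l: "l \<in> {a<..<b}" and x: "x \<in> X" shows "m * norm x \<le> norm (effort l x)"
proof -
  have "m / 2 * (norm x)\<^sup>2 \<le> inner_Q a b (Q l) x x"
    by (rule inner_Q_lower[OF Q_diag_mult[OF l] Q_supp[OF l] Q_lower[OF l] x])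
  also have "\<dots> = 1 / 2 * (effort l x \<bullet> x)"
    unfolding effort_def by (rule inner_Q_eq[OF Q_diag_mult[OF l] Q_supp[OF l]])
  also have "\<dots> \<le> 1 / 2 * (norm (effort l x) * norm x)"
    using norm_cauchy_schwarz[of "effort l x" x] by simp
  finally have "(m * norm x) * norm x \<le> norm (effort l x) * norm x"
    by (simp add: power2_eq_square)
  then show ?thesis by (cases "x = 0") (auto simp: mult_le_cancel_right)
qed

text \<open>The dissipation inequality controls the boundary values by the product of the norms of
  \<open>x\<close> and its image, and the effort deviates from them by at most the L1 norm of the
  image. This gives a quadratic inequality, resolved by \<open>square_le_imp_le\<close>.\<close>

lemma coercive:
  assumes l: "l \<in> {a<..<b}"
  obtains K where "\<And>x. x \<in> pH_dom a b Qm Qp r W_B l \<Longrightarrow> norm x \<le> K * norm (pH_op a b Qm Qp l x)"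
proof -
  have l': "a < l" "l < b" "a < b" using l by auto
  define c where "c = b - a + 1"
  \<comment> \<open>From \<open>m^2 * norm x^2 <= T * (b - a)\<close> with
    \<open>T = 4 * s + 4 * (c * norm y)^2\<close>: the first summand yields \<open>P\<close> through
    the bound on \<open>s\<close>, the second yields \<open>R\<close>; \<open>c\<close> is the
    constant of \<open>L1_le_norm\<close>.\<close>
  define P where "P = 4 * (b - a) / m\<^sup>2 * (M / (2 * k))"
  define R where "R = 4 * (b - a) / m\<^sup>2 * c\<^sup>2"
  have nonneg: "0 \<le> P" "0 \<le> R" "0 \<le> 4 * (b - a) / m\<^sup>2" "0 \<le> c"
    using l' M_nonneg k_pos by (auto simp: P_def R_def c_def)
  have "norm x \<le> (P + R + 1) * norm (pH_op a b Qm Qp l x)" if x: "x \<in> pH_dom a b Qm Qp r W_B l" for x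
  proof -
    define y where "y = pH_op a b Qm Qp l x"
    obtain u v w where t: "trajectory l x y u v w" and bc: "w l = r * (u l - v l)"
      "boundary (u a) (w a) (v b) (w b) = 0" and y: "y \<in> X"
      unfolding y_def by (rule pH_dom_trajectory[OF l x])
    have xX: "x \<in> X" using x by (auto simp: pH_dom_def)
    note cont = trajectory_continuous[OF l t]
    have t': "indef_integral a l u (\<lambda>z. - rep_L2 y z $ 2)" "indef_integral l b v (\<lambda>z. - rep_L2 y z $ 2)"
     "indef_integral a b w (\<lambda>z. - rep_L2 y z $ 1)"
      using t by (auto simp: trajectory_def)
    define s where "s = (u a)\<^sup>2 + (w a)\<^sup>2 + (v b)\<^sup>2 + (w b)\<^sup>2"
    have s0: "0 \<le> s" by (simp add: s_def)
    have "k * s \<le> - inner_Q a b (Q l) y x"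
      using dissipation[OF l t bc] by (simp add: s_def)
    also have "\<dots> = 1 / 2 * (mult_op (Q l) y \<bullet> (- x))"
      by (simp add: inner_Q_eq[OF Q_diag_mult[OF l] Q_supp[OF l]])
    also have "\<dots> \<le> 1 / 2 * (norm (mult_op (Q l) y) * norm x)"
      using norm_cauchy_schwarz[of "mult_op (Q l) y" "- x"] by simp
    also have "\<dots> \<le> 1 / 2 * (M * norm y * norm x)"
      using norm_mult_op[OF Q_diag_mult[OF l], of y] by (intro mult_left_mono mult_right_mono) auto
    finally have s_le: "s \<le> M / (2 * k) * (norm y * norm x)"
      using k_pos by (simp add: field_simps)
    define L where "L = (LINT z|lborel. norm (rep_L2 y z))"
    have L: "L \<le> c * norm y"
      unfolding L_def c_def using L1_le_norm[OF y] l' by simp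
    have var: "\<bar>F z - F z'\<bar> \<le> L" if F: "indef_integral \<alpha> \<beta> F (\<lambda>z. - rep_L2 y z $ i)" and z: "z \<in> {\<alpha>..\<beta>}" "z' \<in> {\<alpha>..\<beta>}" for F \<alpha> \<beta> z z' i
    proof -
      have "\<bar>F z - F z'\<bar> \<le> (LINT s:{\<alpha>..\<beta>}|lborel. \<bar>- rep_L2 y s $ i\<bar>)"
        by (rule indef_bound[OF F z(2,1)])
      also have "\<dots> \<le> L"
        unfolding L_def set_lebesgue_integral_def
      proof (rule integral_mono)
        show "integrable lborel (\<lambda>s. indicator {\<alpha>..\<beta>} s *\<^sub>R \<bar>- rep_L2 y s $ i\<bar>)"
          using set_integrable_abs[OF indef_integrable[OF F]] by (simp add: set_integrable_def)
        show "integrable lborel (\<lambda>z. norm (rep_L2 y z))"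
          using integrable_rep_interval[OF y] by simp
        show "indicator {\<alpha>..\<beta>} s *\<^sub>R \<bar>- rep_L2 y s $ i\<bar> \<le> norm (rep_L2 y s)" for s
          using component_le_norm_cart[of "rep_L2 y s" i] by (simp add: indicator_def)
      qed
      finally show ?thesis .
    qed
    have sq: "p\<^sup>2 \<le> 2 * s + 2 * (c * norm y)\<^sup>2" if "\<bar>p - p0\<bar> \<le> L" "p0\<^sup>2 \<le> s" for p p0
    proof -
      have "\<bar>p - p0\<bar> \<le> \<bar>c * norm y\<bar>" using that L nonneg by simp
      then have "(p - p0)\<^sup>2 \<le> (c * norm y)\<^sup>2" by (simp add: abs_le_square_iff)
      moreover have "p\<^sup>2 \<le> 2 * p0\<^sup>2 + 2 * (p - p0)\<^sup>2"
        using zero_le_power2[of "2 * p0 - p"] by (simp add: power2_eq_square algebra_simps)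
      ultimately show ?thesis using that by linarith
    qed
    define T where "T = 4 * s + 4 * (c * norm y)\<^sup>2"
    \<comment> \<open>Each side is compared with its own outer end point, so \<open>w\<close> is
      compared with its value at \<open>a\<close> on the left and with its value at \<open>b\<close>
      on the right.\<close>
    have uT: "(u z)\<^sup>2 + (w z)\<^sup>2 \<le> T" if "z \<in> {a..l}" for z
    proof -
      have "(u z)\<^sup>2 \<le> 2 * s + 2 * (c * norm y)\<^sup>2" "(w z)\<^sup>2 \<le> 2 * s + 2 * (c * norm y)\<^sup>2"
        using that l' by (intro sq[OF var[OF t'(1), of z a]] sq[OF var[OF t'(3), of z a]]; simp add: s_def)+
      then show ?thesis by (simp add: T_def)
    qed
    have vT: "(v z)\<^sup>2 + (w z)\<^sup>2 \<le> T" if "z \<in> {l..b}" for z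
    proof -
      have "(v z)\<^sup>2 \<le> 2 * s + 2 * (c * norm y)\<^sup>2" "(w z)\<^sup>2 \<le> 2 * s + 2 * (c * norm y)\<^sup>2"
        using that l' by (intro sq[OF var[OF t'(2), of z b]] sq[OF var[OF t'(3), of z b]]; simp add: s_def)+
      then show ?thesis by (simp add: T_def)
    qed
    have const: "(LINT z:{\<alpha>..\<beta>}|lborel. T) = T * (\<beta> - \<alpha>)" if "\<alpha> \<le> \<beta>" for \<alpha> \<beta> :: real
      using that by (simp add: set_lebesgue_integral_def)
    have iT: "set_integrable lborel {\<alpha>..\<beta>} (\<lambda>_. T)" for \<alpha> \<beta> :: real
      unfolding set_integrable_def by (intro borel_integrable_compact) auto
    have "(norm (effort l x))\<^sup>2 \<le> T * (l - a) + T * (b - l)"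
      unfolding norm_effort[OF l t] const[OF less_imp_le[OF l'(1)], symmetric] const[OF less_imp_le[OF l'(2)], symmetric]
    proof (intro add_mono set_integral_mono iT uT vT)
      show "set_integrable lborel {a..l} (\<lambda>z. (u z)\<^sup>2 + (w z)\<^sup>2)" "set_integrable lborel {l..b} (\<lambda>z. (v z)\<^sup>2 + (w z)\<^sup>2)"
        unfolding set_integrable_def using l'
        by (intro borel_integrable_compact continuous_intros cont continuous_on_subset[OF cont(3)]; auto)+
    qed auto
    also have "\<dots> = T * (b - a)" by (simp add: algebra_simps)
    finally have eT: "(norm (effort l x))\<^sup>2 \<le> T * (b - a)" .
    have "(m * norm x)\<^sup>2 \<le> (norm (effort l x))\<^sup>2"
      using norm_state_le_effort[OF l xX] m_pos by (intro power_mono) auto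
    then have "m\<^sup>2 * (norm x)\<^sup>2 \<le> T * (b - a)"
      using eT by (simp add: power_mult_distrib)
    then have "(norm x)\<^sup>2 \<le> T * (b - a) / m\<^sup>2"
      using m_pos by (simp add: field_simps)
    also have "\<dots> = 4 * (b - a) / m\<^sup>2 * s + R * (norm y)\<^sup>2"
      using m_pos by (simp add: T_def R_def power_mult_distrib field_simps)
    also have "\<dots> \<le> 4 * (b - a) / m\<^sup>2 * (M / (2 * k) * (norm y * norm x)) + R * (norm y)\<^sup>2"
      using nonneg s_le by (intro add_right_mono mult_left_mono) auto
    also have "\<dots> = P * (norm y * norm x) + R * (norm y)\<^sup>2"
      by (simp add: P_def)
    finally show ?thesis
      unfolding y_def[symmetric] using nonneg by (intro square_le_imp_le) auto
  qed
  then show ?thesis by (rule that)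
qed

end

section \<open>Stability\<close>

lemma op_norm_le:
  assumes "0 \<in> X" "N 0 = 0" "\<And>x. x \<in> X \<Longrightarrow> N (T x) \<le> c * N x" "0 \<le> c"
  shows "op_norm X N T \<le> c"
  unfolding op_norm_def
proof (rule cSUP_least)
  show "{x \<in> X. N x \<le> 1} \<noteq> {}" using assms(1,2) by auto
  fix x assume "x \<in> {x \<in> X. N x \<le> 1}"
  then have "N (T x) \<le> c * N x" "c * N x \<le> c * 1"
    using assms(3,4) mult_left_mono[of "N x" 1 c] by auto
  then show "N (T x) \<le> c" by simp
qed

text \<open>A common lower bound in one norm bounds each resolvent by
  \<open>1 / (lam - \<omega>)\<close>, and these bounds multiply along the list; hence
  \<open>M = 1\<close>. Bijectivity is a separate hypothesis because it is going to be derived in a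
  different norm.\<close>

lemma stable_family_dissipative:
  assumes X: "subspace X" and N0: "N 0 = 0"
    and gen: "\<And>t. t \<in> {0..\<tau>} \<Longrightarrow> infinitesimal_generator X N (D t) (A t)"
    and D: "\<And>t. t \<in> {0..\<tau>} \<Longrightarrow> subspace (D t)" "\<And>t. t \<in> {0..\<tau>} \<Longrightarrow> D t \<subseteq> X"
    and A_add: "\<And>t x y. t \<in> {0..\<tau>} \<Longrightarrow> x \<in> D t \<Longrightarrow> y \<in> D t \<Longrightarrow> A t (x + y) = A t x + A t y"
    and A_scale: "\<And>t x c. t \<in> {0..\<tau>} \<Longrightarrow> x \<in> D t \<Longrightarrow> A t (c *\<^sub>R x) = c *\<^sub>R A t x"
    and bij: "\<And>t lam. t \<in> {0..\<tau>} \<Longrightarrow> \<omega> < lam \<Longrightarrow> bij_betw (\<lambda>x. lam *\<^sub>R x - A t x) (D t) X"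
    and dissip: "\<And>t lam x. t \<in> {0..\<tau>} \<Longrightarrow> \<omega> < lam \<Longrightarrow> x \<in> D t \<Longrightarrow> (lam - \<omega>) * N x \<le> N (lam *\<^sub>R x - A t x)"
  shows "stable_family X N \<tau> D A"
proof -
  define R where "R t lam = resolvent (D t) (A t) lam" for t lam
  have R: "R t lam y \<in> D t" "lam *\<^sub>R R t lam y - A t (R t lam y) = y" if "t \<in> {0..\<tau>}" "\<omega> < lam" "y \<in> X" for t lam y
    using bij[OF that(1,2)] that(3) inv_into_into[of y "\<lambda>x. lam *\<^sub>R x - A t x" "D t"]
      f_inv_into_f[of y "\<lambda>x. lam *\<^sub>R x - A t x" "D t"]
    by (auto simp: R_def resolvent_def bij_betw_def)
  have R_eqI: "R t lam y = x" if "t \<in> {0..\<tau>}" "\<omega> < lam" "x \<in> D t" "lam *\<^sub>R x - A t x = y" for t lam x y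
    using bij[OF that(1,2)] that(3,4) inv_into_f_f[of "\<lambda>x. lam *\<^sub>R x - A t x" "D t" x]
    by (auto simp: R_def resolvent_def bij_betw_def)
  have R_N: "N (R t lam y) \<le> 1 / (lam - \<omega>) * N y" if "t \<in> {0..\<tau>}" "\<omega> < lam" "y \<in> X" for t lam y
    using dissip[OF that(1,2) R(1)[OF that]] R(2)[OF that] that(2) by (simp add: field_simps)
  have R_bounded: "bounded_op X N (R t lam)" if t: "t \<in> {0..\<tau>}" "\<omega> < lam" for t lam
    unfolding bounded_op_def
  proof (intro conjI ballI allI exI[of _ "1 / (lam - \<omega>)"] R_N t)
    fix x y c assume x: "x \<in> X"
    show "R t lam x \<in> X" using R(1)[OF t x] D(2)[OF t(1)] by auto
    show "R t lam (c *\<^sub>R x) = c *\<^sub>R R t lam x"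
      using R[OF t x] t subspace_scale[OF D(1)[OF t(1)]]
      by (intro R_eqI) (auto simp: A_scale scaleR_diff_right[symmetric] scaleR_left_commute[of lam c] simp del: scaleR_scaleR)
    assume y: "y \<in> X"
    show "R t lam (x + y) = R t lam x + R t lam y"
      using R[OF t x] R[OF t y] t subspace_add[OF D(1)[OF t(1)]]
      by (intro R_eqI) (auto simp: A_add scaleR_add_right add_diff_add)
  qed
  have fold: "fold (\<lambda>t. R t lam) ts x \<in> X \<and> N (fold (\<lambda>t. R t lam) ts x) \<le> 1 / (lam - \<omega>) ^ length ts * N x"
    if "set ts \<subseteq> {0..\<tau>}" "\<omega> < lam" "x \<in> X" for ts lam x
    using that
  proof (induction ts arbitrary: x)
    case (Cons t ts)
    have t: "t \<in> {0..\<tau>}" using Cons.prems by auto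
    have Rx: "R t lam x \<in> X" using R(1)[OF t Cons.prems(2,3)] D(2)[OF t] by auto
    have "N (fold (\<lambda>t. R t lam) ts (R t lam x)) \<le> 1 / (lam - \<omega>) ^ length ts * N (R t lam x)"
      using Cons.IH[of "R t lam x"] Cons.prems Rx by simp
    also have "\<dots> \<le> 1 / (lam - \<omega>) ^ length ts * (1 / (lam - \<omega>) * N x)"
      using Cons.prems by (intro mult_left_mono R_N[OF t]) auto
    finally show ?case
      using Cons.IH[of "R t lam x"] Cons.prems Rx by (simp add: mult.commute)
  qed simp
  show ?thesis
    unfolding stable_family_def
  proof (intro conjI)
    show "\<forall>t\<in>{0..\<tau>}. infinitesimal_generator X N (D t) (A t)" using gen by blast
    show "\<exists>M \<omega>. 1 \<le> M \<and> (\<forall>t\<in>{0..\<tau>}. {\<omega><..} \<subseteq> resolvent_set X N (D t) (A t)) \<and>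
      (\<forall>ts. sorted ts \<and> set ts \<subseteq> {0..\<tau>} \<longrightarrow>
        (\<forall>lam>\<omega>. op_norm X N (fold (\<lambda>t. resolvent (D t) (A t) lam) ts) \<le> M / (lam - \<omega>) ^ length ts))"
    proof (rule exI[of _ 1], rule exI[of _ \<omega>], intro conjI ballI allI impI subsetI)
      fix t lam assume t: "t \<in> {0..\<tau>}" and lam: "lam \<in> {\<omega><..}"
      then show "lam \<in> resolvent_set X N (D t) (A t)"
        using bij[of t lam] R_bounded[of t lam] by (simp add: resolvent_set_def R_def[abs_def])
    next
      fix ts lam assume ts: "sorted ts \<and> set ts \<subseteq> {0..\<tau>}" and lam: "\<omega> < lam"
      show "op_norm X N (fold (\<lambda>t. resolvent (D t) (A t) lam) ts) \<le> 1 / (lam - \<omega>) ^ length ts"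
        using fold[of ts lam] ts lam subspace_0[OF X] N0 by (intro op_norm_le) (auto simp: R_def[abs_def])
    qed simp
  qed
qed

lemma C1_entry:
  fixes Q :: "real \<Rightarrow> real^'n^'m"
  assumes "C1_on S Q"
  obtains d where "\<forall>z\<in>S. ((\<lambda>z. Q z $ i $ j) has_real_derivative d z) (at z within S)" "continuous_on S d"
proof -
  obtain Q' where Q': "\<forall>z\<in>S. (Q has_vector_derivative Q' z) (at z within S)" "continuous_on S Q'"
    using assms by (auto simp: C1_on_def)
  have "\<forall>z\<in>S. ((\<lambda>z. Q z $ i $ j) has_real_derivative Q' z $ i $ j) (at z within S)"
  proof
    fix z assume z: "z \<in> S"
    have "((\<lambda>z. Q z $ i $ j) has_vector_derivative Q' z $ i $ j) (at z within S)"
      using Q'(1) z by (intro bounded_linear.has_vector_derivative[OF bounded_linear_vec_nth]) auto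
    then show "((\<lambda>z. Q z $ i $ j) has_real_derivative Q' z $ i $ j) (at z within S)" by (simp add: has_real_derivative_iff_has_vector_derivative)
  qed
  moreover have "continuous_on S (\<lambda>z. Q' z $ i $ j)" by (intro continuous_intros Q'(2))
  ultimately show ?thesis by (rule that)
qed

lemma indef_quotient:
  fixes p q :: "real \<Rightarrow> real"
  assumes p: "\<forall>z\<in>{\<alpha>..\<beta>}. (p has_real_derivative p' z) (at z within {\<alpha>..\<beta>})" "continuous_on {\<alpha>..\<beta>} p'"
    and q: "\<forall>z\<in>{\<alpha>..\<beta>}. (q has_real_derivative q' z) (at z within {\<alpha>..\<beta>})" "continuous_on {\<alpha>..\<beta>} q'"
    and nz: "\<forall>z\<in>{\<alpha>..\<beta>}. q z \<noteq> 0"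
  obtains h' K where "indef_integral \<alpha> \<beta> (\<lambda>z. p z / q z) h'" "0 \<le> K" "\<forall>z\<in>{\<alpha>..\<beta>}. \<bar>h' z\<bar> \<le> K"
proof -
  define h' where "h' z = (p' z * q z - p z * q' z) / (q z * q z)" for z
  have "continuous_on {\<alpha>..\<beta>} p" "continuous_on {\<alpha>..\<beta>} q"
    by (rule DERIV_continuous_on[of _ _ p'] DERIV_continuous_on[of _ _ q'], use p(1) q(1) in blast)+
  then have c: "continuous_on {\<alpha>..\<beta>} h'"
    unfolding h'_def using nz by (intro continuous_intros p q) auto
  have "indef_integral \<alpha> \<beta> (\<lambda>z. p z / q z) h'"
  proof (rule indef_C1)
    fix z assume z: "z \<in> {\<alpha>..\<beta>}"
    show "((\<lambda>z. p z / q z) has_vector_derivative h' z) (at z within {\<alpha>..\<beta>})"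
      unfolding has_real_derivative_iff_has_vector_derivative[symmetric] h'_def
      by (rule DERIV_divide[OF bspec[OF p(1) z] bspec[OF q(1) z] bspec[OF nz z]])
  qed (rule c)
  moreover have "bounded (h' ` {\<alpha>..\<beta>})"
    using c by (intro compact_imp_bounded compact_continuous_image compact_Icc)
  then obtain K where K: "\<forall>y\<in>h' ` {\<alpha>..\<beta>}. norm y \<le> K" unfolding bounded_iff by blast
  have "\<forall>z\<in>{\<alpha>..\<beta>}. \<bar>h' z\<bar> \<le> \<bar>K\<bar>"
  proof
    fix z assume "z \<in> {\<alpha>..\<beta>}"
    then have "norm (h' z) \<le> K" using K by blast
    then show "\<bar>h' z\<bar> \<le> \<bar>K\<bar>" by simp
  qed
  ultimately show ?thesis using that[of h' "\<bar>K\<bar>"] by simp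
qed

text \<open>The gap is \<open>r / 4 * (1 + \<eta>) * (A - B)\<^sup>2\<close> in both cases; the
  terms with \<open>w\<^sup>2\<close> cancel. \<open>A\<close> and \<open>B\<close> stand for the
  one-sided values of the first effort component and \<open>\<eta>\<close> for the weight at the
  interface.\<close>

lemma interface_quadratic:
  fixes r \<eta> A B w :: real
  assumes r: "0 < r" and \<eta>: "0 < \<eta>" and w: "w = r * (A - B)"
  shows "- 1 / 2 * w * (A - \<eta> * B) \<le> r / 4 * ((\<eta> - 1) * (A\<^sup>2 + w\<^sup>2) + (1 - \<eta>) * (B\<^sup>2 + w\<^sup>2))"
    and "- 1 / 2 * w * (\<eta> * A - B) \<le> r / 4 * ((1 - \<eta>) * (A\<^sup>2 + w\<^sup>2) + (\<eta> - 1) * (B\<^sup>2 + w\<^sup>2))"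
proof -
  have n: "0 \<le> r / 4 * (1 + \<eta>) * (A - B)\<^sup>2" using r \<eta> by simp
  have "r / 4 * ((\<eta> - 1) * (A\<^sup>2 + w\<^sup>2) + (1 - \<eta>) * (B\<^sup>2 + w\<^sup>2)) - - 1 / 2 * (r * (A - B)) * (A - \<eta> * B)
     = r / 4 * (1 + \<eta>) * (A - B)\<^sup>2"
    by (simp add: power2_eq_square field_simps)
  then show "- 1 / 2 * w * (A - \<eta> * B) \<le> r / 4 * ((\<eta> - 1) * (A\<^sup>2 + w\<^sup>2) + (1 - \<eta>) * (B\<^sup>2 + w\<^sup>2))"
    using n unfolding w by linarith
  have "r / 4 * ((1 - \<eta>) * (A\<^sup>2 + w\<^sup>2) + (\<eta> - 1) * (B\<^sup>2 + w\<^sup>2)) - - 1 / 2 * (r * (A - B)) * (\<eta> * A - B)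
     = r / 4 * (1 + \<eta>) * (A - B)\<^sup>2"
    by (simp add: power2_eq_square field_simps)
  then show "- 1 / 2 * w * (\<eta> * A - B) \<le> r / 4 * ((1 - \<eta>) * (A\<^sup>2 + w\<^sup>2) + (\<eta> - 1) * (B\<^sup>2 + w\<^sup>2))"
    using n unfolding w by linarith
qed

section \<open>The operators as generators in the norm of Q_0\<close>

context dissipative_interface_system begin

abbreviation "Dom l \<equiv> pH_dom a b Qm Qp r W_B l"
abbreviation "Gen l \<equiv> pH_op a b Qm Qp l"

lemma zero_mem: "0 \<in> {a<..<b}" using ab by simp

lemma dom_sub: "Dom l \<subseteq> X" by (auto simp: pH_dom_def)

lemma subspace_dom:
  assumes l: "l \<in> {a<..<b}" shows "subspace (Dom l)"
proof (rule subspaceI)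
  obtain x where "x \<in> Dom l" using onto[OF l subspace_0[OF subspace_L2_interval]] by blast
  from pH_dom_scale(1)[OF l this, of 0] show "0 \<in> Dom l" by simp
qed (use pH_dom_add[OF l] pH_dom_scale[OF l] in auto)

lemma op_mem: "l \<in> {a<..<b} \<Longrightarrow> x \<in> Dom l \<Longrightarrow> Gen l x \<in> X"
  by (rule pH_dom_trajectory)

lemma hilbert:
  assumes l: "l \<in> {a<..<b}"
  obtains K where "hilbert_dissipative X (inner_Q a b (Q l)) (m / 2) (Dom l) (Gen l) K"
proof -
  obtain K where K: "\<And>x. x \<in> Dom l \<Longrightarrow> norm x \<le> K * norm (Gen l x)" 
    using coercive[OF l] by blast
  note S = Q_diag_mult[OF l] Q_supp[OF l]
  have "hilbert_dissipative X (inner_Q a b (Q l)) (m / 2) (Dom l) (Gen l) K"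
  proof (rule hilbert_dissipative.intro)
    show "complete X" using ab by (intro complete_L2_interval) simp
    show "inner_Q a b (Q l) (Gen l x) x \<le> 0" if x: "x \<in> Dom l" for x
    proof -
      obtain u v w where t: "trajectory l x (Gen l x) u v w" "w l = r * (u l - v l)"
        "boundary (u a) (w a) (v b) (w b) = 0"
        by (rule pH_dom_trajectory[OF l x])
      have "0 \<le> k * ((u a)\<^sup>2 + (w a)\<^sup>2 + (v b)\<^sup>2 + (w b)\<^sup>2)"
        using k_pos by (intro mult_nonneg_nonneg add_nonneg_nonneg) auto
      then show ?thesis using dissipation[OF l t] by simp
    qed
    show "\<exists>x\<in>Dom l. Gen l x = y" if "y \<in> X" for y by (rule onto[OF l that])
    show "subspace X" by (rule subspace_L2_interval)
    show "bounded_bilinear (inner_Q a b (Q l))" by (rule inner_Q_bilinear[OF S])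
    show "inner_Q a b (Q l) x y = inner_Q a b (Q l) y x" for x y by (rule inner_Q_sym[OF S])
    show "0 \<le> inner_Q a b (Q l) x x" for x by (rule inner_Q_nonneg[OF S])
    show "0 < m / 2" using m_pos by simp
    show "m / 2 * (norm x)\<^sup>2 \<le> inner_Q a b (Q l) x x" if "x \<in> X" for x
      by (rule inner_Q_lower[OF S Q_lower[OF l] that])
    show "subspace (Dom l)" by (rule subspace_dom[OF l])
    show "Dom l \<subseteq> X" by (rule dom_sub)
    show "Gen l x \<in> X" if "x \<in> Dom l" for x by (rule op_mem[OF l that])
    show "Gen l (x + y) = Gen l x + Gen l y" if "x \<in> Dom l" "y \<in> Dom l" for x y by (rule pH_dom_add(2)[OF l that])
    show "Gen l (s *\<^sub>R x) = s *\<^sub>R Gen l x" if "x \<in> Dom l" for x s by (rule pH_dom_scale(2)[OF l that])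
    show "norm x \<le> K * norm (Gen l x)" if "x \<in> Dom l" for x by (rule K[OF that])
  qed
  then show ?thesis by (rule that)
qed

lemma norm_Q_bounds:
  assumes l: "l \<in> {a<..<b}" and x: "x \<in> X"
  shows "sqrt (m / 2) * norm x \<le> norm_Q a b (Q l) x \<and> norm_Q a b (Q l) x \<le> sqrt (M / 2) * norm x"
proof
  note S = Q_diag_mult[OF l] Q_supp[OF l]
  show "sqrt (m / 2) * norm x \<le> norm_Q a b (Q l) x"
    using real_sqrt_le_mono[OF inner_Q_lower[OF S Q_lower[OF l] x]]
    by (simp only: norm_Q_def real_sqrt_mult real_sqrt_abs abs_norm_cancel)
  have "inner_Q a b (Q l) x x \<le> 1 / 2 * (norm (mult_op (Q l) x) * norm x)"
    unfolding inner_Q_eq[OF S] using norm_cauchy_schwarz[of "mult_op (Q l) x" x] by simp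
  also have "\<dots> \<le> 1 / 2 * ((M * norm x) * norm x)"
    by (intro mult_left_mono mult_right_mono norm_mult_op[OF S(1)]) auto
  finally have "inner_Q a b (Q l) x x \<le> M / 2 * (norm x)\<^sup>2" by (simp add: power2_eq_square)
  then show "norm_Q a b (Q l) x \<le> sqrt (M / 2) * norm x"
    using real_sqrt_le_mono[of "inner_Q a b (Q l) x x" "M / 2 * (norm x)\<^sup>2"]
    by (simp only: norm_Q_def real_sqrt_mult real_sqrt_abs abs_norm_cancel)
qed

text \<open>The semigroup is constructed as a contraction semigroup in the norm of
  \<open>Q l\<close>; comparability of the norm of \<open>Q 0\<close> with the L2 norm transfers the
  generator property.\<close>

lemma generator:
  assumes l: "l \<in> {a<..<b}"
  shows "infinitesimal_generator X (norm_Q a b (Q 0)) (Dom l) (Gen l)"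
proof -
  obtain K where K: "hilbert_dissipative X (inner_Q a b (Q l)) (m / 2) (Dom l) (Gen l) K"
    by (rule hilbert[OF l])
  show ?thesis
    by (rule hilbert_dissipative.generator[OF K _ norm_Q_bounds[OF zero_mem]]) (use m_pos in auto)
qed

text \<open>Pairing \<open>lam x - A x\<close> with \<open>x\<close> in the form of
  \<open>Q 0\<close> gives at least \<open>lam - \<omega>\<close> times the squared norm;
  Cauchy-Schwarz bounds the pairing from above, and one factor cancels.\<close>

lemma quasi_dissipative_norm:
  assumes l: "l \<in> {a<..<b}" and x: "x \<in> Dom l" 
    and q: "inner_Q a b (Q 0) (Gen l x) x \<le> \<omega> * inner_Q a b (Q 0) x x"
  shows "(lam - \<omega>) * norm_Q a b (Q 0) x \<le> norm_Q a b (Q 0) (lam *\<^sub>R x - Gen l x)"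
proof -
  \<comment> \<open>The instance with the interface at 0 supplies Cauchy-Schwarz for the form of
    \<open>Q 0\<close>; the operator under consideration is still that of \<open>l\<close>.\<close>
  obtain K where K: "hilbert_dissipative X (inner_Q a b (Q 0)) (m / 2) (Dom 0) (Gen 0) K"
    by (rule hilbert[OF zero_mem])
  interpret B: bounded_bilinear "inner_Q a b (Q 0)"
    by (rule inner_Q_bilinear[OF Q_diag_mult[OF zero_mem] Q_supp[OF zero_mem]])
  let ?N = "norm_Q a b (Q 0)"
  have N: "hilbert_dissipative.N (inner_Q a b (Q 0)) = ?N"
    using hilbert_dissipative.N_def[OF K] by (auto simp: norm_Q_def)
  have sq: "?N x * ?N x = inner_Q a b (Q 0) x x" "0 \<le> ?N x"
    using hilbert_dissipative.B_nonneg[OF K, of x] by (auto simp: norm_Q_def)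
  have "(lam - \<omega>) * (?N x * ?N x) \<le> inner_Q a b (Q 0) (lam *\<^sub>R x - Gen l x) x"
    using q by (simp add: sq B.diff_left B.scaleR_left left_diff_distrib)
  also have "\<dots> \<le> ?N (lam *\<^sub>R x - Gen l x) * ?N x"
    using hilbert_dissipative.form_le[OF K] by (simp add: N)
  finally have le: "((lam - \<omega>) * ?N x) * ?N x \<le> ?N (lam *\<^sub>R x - Gen l x) * ?N x" by simp
  show ?thesis
  proof (cases "?N x = 0")
    case True
    then show ?thesis
      using hilbert_dissipative.B_nonneg[OF K] by (simp add: norm_Q_def)
  next
    case False
    then show ?thesis using le sq(2) by (simp add: mult_le_cancel_right)
  qed
qed

text \<open>Converts remainders measured by the L2 norm of the effort, the form in which (i) and
  (ii) are given, into the squared norm of \<open>Q 0\<close>: \<open>M\<close> bounds the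
  multiplication by \<open>Q l\<close>, and \<open>m / 2\<close> is the lower bound of the
  form.\<close>

lemma effort_le:
  assumes l: "l \<in> {a<..<b}" and x: "x \<in> X"
  shows "(norm (effort l x))\<^sup>2 \<le> 2 * M\<^sup>2 / m * inner_Q a b (Q 0) x x"
proof -
  have "norm (effort l x) \<le> M * norm x"
    unfolding effort_def by (rule norm_mult_op[OF Q_diag_mult[OF l]])
  then have "(norm (effort l x))\<^sup>2 \<le> (M * norm x)\<^sup>2" by (intro power_mono) auto
  also have "\<dots> = 2 * M\<^sup>2 / m * (m / 2 * (norm x)\<^sup>2)"
    using m_pos by (simp add: power_mult_distrib)
  also have "\<dots> \<le> 2 * M\<^sup>2 / m * inner_Q a b (Q 0) x x"
    using m_pos by (intro mult_left_mono inner_Q_lower[OF Q_diag_mult[OF zero_mem] Q_supp[OF zero_mem] Q_lower[OF zero_mem] x]) auto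
  finally show ?thesis .
qed

end

section \<open>Energy balance in the fixed norm\<close>

locale moving_interface_system = dissipative_interface_system +
  assumes Q_ratio_0: "Qp 0 $ 1 $ 1 / Qm 0 $ 1 $ 1 = 1"
    and Q_ratio: "\<And>z. z \<in> {a..b} \<Longrightarrow> Qp z $ 1 $ 1 / Qm z $ 1 $ 1 = Qp z $ 2 $ 2 / Qm z $ 2 $ 2"
begin

lemma Q_ratio': "z \<in> {a..b} \<Longrightarrow> Qm z $ 1 $ 1 / Qp z $ 1 $ 1 = Qm z $ 2 $ 2 / Qp z $ 2 $ 2"
  using arg_cong[OF Q_ratio, of z inverse] by (simp add: inverse_divide)

text \<open>Equality of the two diagonal ratios makes the quotient of the matrices a scalar, and
  this lets the weight be pulled out of the pairing of state and image.\<close>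

lemma Qp_eq: "z \<in> {a..b} \<Longrightarrow> Qp z = (Qp z $ 1 $ 1 / Qm z $ 1 $ 1) *\<^sub>R Qm z"
  using Q_ratio[of z] Q_diag[of z] Q_entry_pos[of z 1] Q_entry_pos[of z 2]
  by (auto simp: vec_eq_iff forall_2 field_simps)

lemma Qm_eq: "z \<in> {a..b} \<Longrightarrow> Qm z = (Qm z $ 1 $ 1 / Qp z $ 1 $ 1) *\<^sub>R Qp z"
  using Q_ratio'[of z] Q_diag[of z] Q_entry_pos[of z 1] Q_entry_pos[of z 2]
  by (auto simp: vec_eq_iff forall_2 field_simps)

lemma eta_eq:
  assumes "z \<in> {a..b}"
  shows "eta Qm Qp z = Qm z $ 1 $ 1 / Qp z $ 1 $ 1" "eta Qp Qm z = Qp z $ 1 $ 1 / Qm z $ 1 $ 1"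
  using Q_ratio[OF assms] Q_ratio'[OF assms] by (simp_all add: eta_def)

text \<open>The weight that turns \<open>\<Q>\<^sub>l\<close> into \<open>\<Q>\<^sub>0\<close> is a quotient of \<open>Q\<^sup>-\<^sub>1\<^sub>1\<close> and \<open>Q\<^sup>+\<^sub>1\<^sub>1\<close> between the interface
  and \<open>0\<close> and \<open>1\<close> elsewhere; it jumps at the interface only, because \<open>Q\<^sup>+\<^sub>1\<^sub>1 / Q\<^sup>-\<^sub>1\<^sub>1\<close> is \<open>1\<close> at \<open>0\<close>.\<close>

lemma energy_left:
  obtains K where "0 \<le> K" "\<forall>l\<in>{a<..<0}. \<forall>x y u v w. trajectory l x y u v w \<longrightarrow>
    inner_Q a b (Q 0) y x \<le> - 1 / 2 * (v b * w b - u a * w a) - 1 / 2 * w l * (u l - eta Qm Qp l * v l)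
      + K * (norm (effort l x))\<^sup>2"
proof -
  obtain p' where p': "\<forall>z\<in>{a..b}. ((\<lambda>z. Qm z $ 1 $ 1) has_real_derivative p' z) (at z within {a..b})" "continuous_on {a..b} p'"
    by (rule C1_entry[OF Q_C1(1), of 1 1])
  obtain q' where q': "\<forall>z\<in>{a..b}. ((\<lambda>z. Qp z $ 1 $ 1) has_real_derivative q' z) (at z within {a..b})" "continuous_on {a..b} q'"
    by (rule C1_entry[OF Q_C1(2), of 1 1])
  have nz: "\<forall>z\<in>{a..b}. Qp z $ 1 $ 1 \<noteq> 0" using Q_entry_pos(2)[of _ 1] by (metis less_irrefl)
  \<comment> \<open>The bound is taken on all of [a,b] before \<open>l\<close> is chosen, so
    \<open>K\<close> serves for every position of the interface.\<close>
  obtain h' K where h: "indef_integral a b (\<lambda>z. Qm z $ 1 $ 1 / Qp z $ 1 $ 1) h'" and K: "0 \<le> K" "\<forall>z\<in>{a..b}. \<bar>h' z\<bar> \<le> K"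
    by (rule indef_quotient[OF p' q' nz])
  define \<sigma> where "\<sigma> z = (if z \<le> 0 then Qm z $ 1 $ 1 / Qp z $ 1 $ 1 else 1)" for z
  define \<sigma>' where "\<sigma>' z = (if z \<le> 0 then h' z else 0)" for z
  have one: "Qm 0 $ 1 $ 1 / Qp 0 $ 1 $ 1 = 1" using Q_ratio_0 by (auto simp: field_simps)
  have "inner_Q a b (Q 0) y x \<le> - 1 / 2 * (v b * w b - u a * w a) - 1 / 2 * w l * (u l - eta Qm Qp l * v l)
      + K * (norm (effort l x))\<^sup>2" if l: "l \<in> {a<..<0}" and t: "trajectory l x y u v w" for l x y u v w
  proof -
    have l': "l \<in> {a<..<b}" "l \<in> {a..b}" using l ab by auto
    have \<sigma>: "indef_integral l b \<sigma> \<sigma>'"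
      unfolding \<sigma>'_def
    proof (rule indef_glue)
      show "indef_integral l 0 \<sigma> h'"
        by (rule indef_transform[OF indef_sub[OF h]]) (use l ab in \<open>auto simp: \<sigma>_def\<close>)
      show "indef_integral 0 b \<sigma> (\<lambda>_. 0)"
        by (rule indef_transform[OF indef_const[of _ _ 1]]) (use ab one in \<open>auto simp: \<sigma>_def\<close>)
    qed (use l ab in auto)
    have "\<bar>inner_Q a b (Q 0) y x + 1 / 2 * (1 * (u l * w l) - 1 * (u a * w a))
      + 1 / 2 * (\<sigma> b * (v b * w b) - \<sigma> l * (v l * w l))\<bar> \<le> K * (norm (effort l x))\<^sup>2"
    proof (rule weighted_energy[OF l'(1) t Q_diag_mult[OF zero_mem] indef_const \<sigma>])
      show "AE z in lborel. z \<in> {a<..<l} \<longrightarrow> Q 0 z = 1 *\<^sub>R Qm z"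
        using l Q_left[OF zero_mem] by (intro AE_I2) auto
      show "AE z in lborel. z \<in> {l<..<b} \<longrightarrow> Q 0 z = \<sigma> z *\<^sub>R Qp z"
        using AE_lborel_singleton[of 0]
      proof eventually_elim
        case (elim z)
        show ?case
        proof (cases "z < 0")
          case True
          then show ?thesis using l ab Q_left[OF zero_mem, of z] Qm_eq[of z] by (auto simp: \<sigma>_def)
        next
          case False
          then show ?thesis using elim Q_right[OF zero_mem, of z] by (auto simp: \<sigma>_def)
        qed
      qed
    qed (use K l ab in \<open>auto simp: \<sigma>'_def\<close>)
    moreover have "\<sigma> b = 1" "\<sigma> l = eta Qm Qp l"
      using l ab eta_eq(1)[OF l'(2)] by (auto simp: \<sigma>_def)
    ultimately have "inner_Q a b (Q 0) y x \<le> - (1 / 2 * (u l * w l - u a * w a)) - 1 / 2 * (v b * w b - eta Qm Qp l * (v l * w l)) + K * (norm (effort l x))\<^sup>2"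
      by simp
    then show ?thesis by (simp add: algebra_simps diff_divide_distrib add_divide_distrib)
  qed
  then show ?thesis by (intro that[of K] K(1)) blast
qed

text \<open>Mirror image of \<open>energy_left\<close>: between 0 and the interface
  \<open>Q 0\<close> equals \<open>Qp\<close> while \<open>Q l\<close> equals \<open>Qm\<close>, so
  the nontrivial weight sits to the left of the interface and is the inverse ratio.\<close>

lemma energy_right:
  obtains K where "0 \<le> K" "\<forall>l\<in>{0<..<b}. \<forall>x y u v w. trajectory l x y u v w \<longrightarrow>
    inner_Q a b (Q 0) y x \<le> - 1 / 2 * (v b * w b - u a * w a) - 1 / 2 * w l * (eta Qp Qm l * u l - v l)
      + K * (norm (effort l x))\<^sup>2"
proof -
  obtain p' where p': "\<forall>z\<in>{a..b}. ((\<lambda>z. Qp z $ 1 $ 1) has_real_derivative p' z) (at z within {a..b})" "continuous_on {a..b} p'"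
    by (rule C1_entry[OF Q_C1(2), of 1 1])
  obtain q' where q': "\<forall>z\<in>{a..b}. ((\<lambda>z. Qm z $ 1 $ 1) has_real_derivative q' z) (at z within {a..b})" "continuous_on {a..b} q'"
    by (rule C1_entry[OF Q_C1(1), of 1 1])
  have nz: "\<forall>z\<in>{a..b}. Qm z $ 1 $ 1 \<noteq> 0" using Q_entry_pos(1)[of _ 1] by (metis less_irrefl)
  obtain h' K where h: "indef_integral a b (\<lambda>z. Qp z $ 1 $ 1 / Qm z $ 1 $ 1) h'" and K: "0 \<le> K" "\<forall>z\<in>{a..b}. \<bar>h' z\<bar> \<le> K"
    by (rule indef_quotient[OF p' q' nz])
  define \<rho> where "\<rho> z = (if z \<le> 0 then 1 else Qp z $ 1 $ 1 / Qm z $ 1 $ 1)" for z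
  define \<rho>' where "\<rho>' z = (if z \<le> 0 then 0 else h' z)" for z
  have "inner_Q a b (Q 0) y x \<le> - 1 / 2 * (v b * w b - u a * w a) - 1 / 2 * w l * (eta Qp Qm l * u l - v l)
      + K * (norm (effort l x))\<^sup>2" if l: "l \<in> {0<..<b}" and t: "trajectory l x y u v w" for l x y u v w
  proof -
    have l': "l \<in> {a<..<b}" "l \<in> {a..b}" using l ab by auto
    have \<rho>: "indef_integral a l \<rho> \<rho>'"
      unfolding \<rho>'_def
    proof (rule indef_glue)
      show "indef_integral 0 l \<rho> h'"
        by (rule indef_transform[OF indef_sub[OF h]]) (use l ab Q_ratio_0 in \<open>auto simp: \<rho>_def\<close>)
      show "indef_integral a 0 \<rho> (\<lambda>_. 0)"
        by (rule indef_transform[OF indef_const[of _ _ 1]]) (use ab in \<open>auto simp: \<rho>_def\<close>)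
    qed (use l ab in auto)
    have "\<bar>inner_Q a b (Q 0) y x + 1 / 2 * (\<rho> l * (u l * w l) - \<rho> a * (u a * w a))
      + 1 / 2 * (1 * (v b * w b) - 1 * (v l * w l))\<bar> \<le> K * (norm (effort l x))\<^sup>2"
    proof (rule weighted_energy[OF l'(1) t Q_diag_mult[OF zero_mem] \<rho> indef_const])
      show "AE z in lborel. z \<in> {l<..<b} \<longrightarrow> Q 0 z = 1 *\<^sub>R Qp z"
        using l Q_right[OF zero_mem] by (intro AE_I2) auto
      show "AE z in lborel. z \<in> {a<..<l} \<longrightarrow> Q 0 z = \<rho> z *\<^sub>R Qm z"
        using AE_lborel_singleton[of 0]
      proof eventually_elim
        case (elim z)
        show ?case
        proof (cases "z < 0")
          case True
          then show ?thesis using Q_left[OF zero_mem, of z] by (auto simp: \<rho>_def)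
        next
          case False
          then show ?thesis using elim l ab Q_right[OF zero_mem, of z] Qp_eq[of z] by (auto simp: \<rho>_def)
        qed
      qed
    qed (use K l ab in \<open>auto simp: \<rho>'_def\<close>)
    moreover have "\<rho> a = 1" "\<rho> l = eta Qp Qm l"
      using l ab eta_eq(2)[OF l'(2)] by (auto simp: \<rho>_def)
    ultimately have "inner_Q a b (Q 0) y x \<le> - (1 / 2 * (eta Qp Qm l * (u l * w l) - u a * w a)) - 1 / 2 * (v b * w b - v l * w l) + K * (norm (effort l x))\<^sup>2"
      by simp
    then show ?thesis by (simp add: algebra_simps diff_divide_distrib add_divide_distrib)
  qed
  then show ?thesis by (intro that[of K] K(1)) blast
qed

lemma eta_pos: "z \<in> {a..b} \<Longrightarrow> 0 < eta Qm Qp z" "z \<in> {a..b} \<Longrightarrow> 0 < eta Qp Qm z"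
  using Q_entry_pos[of z 1] by (simp_all add: eta_eq)

text \<open>Off 0, the energy balance in \<open>Q 0\<close> consists of boundary power, interface
  power and a remainder; the first two are majorised by the left-hand side of (i) or (ii). With the
  interface at 0 the norm is the operator's own, and dissipativity is immediate.\<close>

lemma quasi_dissipative:
  assumes w0: "0 \<le> \<omega>\<^sub>1" "0 \<le> \<omega>\<^sub>2" and l_range: "\<forall>t\<in>{0..\<tau>}. l t \<in> {a<..<b}"
    and cond_i: "\<forall>t\<in>{0..\<tau>}. a < l t \<and> l t < 0 \<longrightarrow> (\<forall>x\<in>Dom (l t).
          - k * ((norm (trace_at a (l t) (\<lambda>z. Qm z *v rep_L2 x z) a))\<^sup>2
               + (norm (trace_at (l t) b (\<lambda>z. Qp z *v rep_L2 x z) b))\<^sup>2)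
          + r / 4 * ((eta Qm Qp (l t) - 1) * (norm (Qm (l t) *v trace_at a (l t) (rep_L2 x) (l t)))\<^sup>2
                   + (1 - eta Qm Qp (l t)) * (norm (Qp (l t) *v trace_at (l t) b (rep_L2 x) (l t)))\<^sup>2)
          \<le> \<omega>\<^sub>1 * (norm (mult_op (Q (l t)) x))\<^sup>2)"
    and cond_ii: "\<forall>t\<in>{0..\<tau>}. 0 < l t \<and> l t < b \<longrightarrow> (\<forall>x\<in>Dom (l t).
          - k * ((norm (trace_at a (l t) (\<lambda>z. Qm z *v rep_L2 x z) a))\<^sup>2
               + (norm (trace_at (l t) b (\<lambda>z. Qp z *v rep_L2 x z) b))\<^sup>2)
          + r / 4 * ((1 - eta Qp Qm (l t)) * (norm (Qm (l t) *v trace_at a (l t) (rep_L2 x) (l t)))\<^sup>2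
                   + (eta Qp Qm (l t) - 1) * (norm (Qp (l t) *v trace_at (l t) b (rep_L2 x) (l t)))\<^sup>2)
          \<le> \<omega>\<^sub>2 * (norm (mult_op (Q (l t)) x))\<^sup>2)"
  obtains \<omega> where "0 \<le> \<omega>" "\<forall>t\<in>{0..\<tau>}. \<forall>x\<in>Dom (l t). inner_Q a b (Q 0) (Gen (l t) x) x \<le> \<omega> * inner_Q a b (Q 0) x x"
proof -
  obtain K1 where K1: "0 \<le> K1" "\<forall>l\<in>{a<..<0}. \<forall>x y u v w. trajectory l x y u v w \<longrightarrow>
    inner_Q a b (Q 0) y x \<le> - 1 / 2 * (v b * w b - u a * w a) - 1 / 2 * w l * (u l - eta Qm Qp l * v l)
      + K1 * (norm (effort l x))\<^sup>2"
    by (rule energy_left)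
  obtain K2 where K2: "0 \<le> K2" "\<forall>l\<in>{0<..<b}. \<forall>x y u v w. trajectory l x y u v w \<longrightarrow>
    inner_Q a b (Q 0) y x \<le> - 1 / 2 * (v b * w b - u a * w a) - 1 / 2 * w l * (eta Qp Qm l * u l - v l)
      + K2 * (norm (effort l x))\<^sup>2"
    by (rule energy_right)
  \<comment> \<open>All constants are added up, so that one value serves on both sides of 0; the
    further factor in \<open>\<omega>\<close> is that of \<open>effort_le\<close>.\<close>
  define c where "c = K1 + K2 + \<omega>\<^sub>1 + \<omega>\<^sub>2"
  define \<omega> where "\<omega> = c * (2 * M\<^sup>2 / m)"
  have c0: "0 \<le> c" using K1 K2 w0 by (simp add: c_def)
  have \<omega>: "0 \<le> \<omega>" using c0 m_pos by (simp add: \<omega>_def)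
  have "inner_Q a b (Q 0) (Gen (l t) x) x \<le> \<omega> * inner_Q a b (Q 0) x x" if tt: "t \<in> {0..\<tau>}" and x: "x \<in> Dom (l t)" for t x
  proof -
    have l': "l t \<in> {a<..<b}" "l t \<in> {a..b}" using bspec[OF l_range tt] by auto
    obtain p where p: "l t = p" by simp
    note l' = l'[unfolded p] and x = x[unfolded p]
    have xX: "x \<in> X" using x dom_sub by auto
    obtain u v w where t: "trajectory p x (Gen p x) u v w" and bc: "w p = r * (u p - v p)"
      "boundary (u a) (w a) (v b) (w b) = 0"
      by (rule pH_dom_trajectory[OF l'(1) x])
    define E where "E = (norm (effort p x))\<^sup>2"
    have E: "0 \<le> E" by (simp add: E_def)
    note tr = trajectory_traces(7,8)[OF l'(1) t] trajectory_traces_state[OF l'(1) t]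
    have bd: "- 1 / 2 * (v b * w b - u a * w a) \<le> - k * ((u a)\<^sup>2 + (w a)\<^sup>2 + ((v b)\<^sup>2 + (w b)\<^sup>2))"
      using boundary_dissipation[OF bc(2)] by (simp only: add.assoc)
    consider "p < 0" | "p = 0" | "0 < p" by linarith
    then have "inner_Q a b (Q 0) (Gen p x) x \<le> c * E"
    proof cases
      case 1
      have "- k * ((u a)\<^sup>2 + (w a)\<^sup>2 + ((v b)\<^sup>2 + (w b)\<^sup>2)) + r / 4 * ((eta Qm Qp p - 1) * ((u p)\<^sup>2 + (w p)\<^sup>2)
          + (1 - eta Qm Qp p) * ((v p)\<^sup>2 + (w p)\<^sup>2)) \<le> \<omega>\<^sub>1 * E"
        using bspec[OF cond_i tt] 1 l'(1) x unfolding p by (auto simp: tr E_def effort_def norm_vec2_sq)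
      moreover have "inner_Q a b (Q 0) (Gen p x) x \<le> - 1 / 2 * (v b * w b - u a * w a) - 1 / 2 * w p * (u p - eta Qm Qp p * v p) + K1 * E"
        unfolding E_def using K1(2)[rule_format, OF _ t] l' 1 by simp
      ultimately have "inner_Q a b (Q 0) (Gen p x) x \<le> \<omega>\<^sub>1 * E + K1 * E"
        using bd interface_quadratic(1)[OF r_pos eta_pos(1)[OF l'(2)] bc(1)] by linarith
      also have "\<dots> \<le> c * E"
        using E K2 w0 by (simp add: c_def distrib_right[symmetric] mult_right_mono)
      finally show ?thesis .
    next
      case 2
      have "inner_Q a b (Q p) (Gen p x) x \<le> 0"
      proof -
        have "0 \<le> k * ((u a)\<^sup>2 + (w a)\<^sup>2 + (v b)\<^sup>2 + (w b)\<^sup>2)"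
          using k_pos by (intro mult_nonneg_nonneg add_nonneg_nonneg) auto
        then show ?thesis using dissipation[OF l'(1) t bc] by simp
      qed
      then have "inner_Q a b (Q 0) (Gen p x) x \<le> 0" using 2 by simp
      then show ?thesis by (rule order_trans[OF _ mult_nonneg_nonneg[OF c0 E]])
    next
      case 3
      have "- k * ((u a)\<^sup>2 + (w a)\<^sup>2 + ((v b)\<^sup>2 + (w b)\<^sup>2)) + r / 4 * ((1 - eta Qp Qm p) * ((u p)\<^sup>2 + (w p)\<^sup>2)
          + (eta Qp Qm p - 1) * ((v p)\<^sup>2 + (w p)\<^sup>2)) \<le> \<omega>\<^sub>2 * E"
        using bspec[OF cond_ii tt] 3 l'(1) x unfolding p by (auto simp: tr E_def effort_def norm_vec2_sq)
      moreover have "inner_Q a b (Q 0) (Gen p x) x \<le> - 1 / 2 * (v b * w b - u a * w a) - 1 / 2 * w p * (eta Qp Qm p * u p - v p) + K2 * E"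
        unfolding E_def using K2(2)[rule_format, OF _ t] l' 3 by simp
      ultimately have "inner_Q a b (Q 0) (Gen p x) x \<le> \<omega>\<^sub>2 * E + K2 * E"
        using bd interface_quadratic(2)[OF r_pos eta_pos(2)[OF l'(2)] bc(1)] by linarith
      also have "\<dots> \<le> c * E"
        using E K1 w0 by (simp add: c_def distrib_right[symmetric] mult_right_mono)
      finally show ?thesis .
    qed
    also have "\<dots> \<le> c * (2 * M\<^sup>2 / m * inner_Q a b (Q 0) x x)"
      unfolding E_def by (intro mult_left_mono effort_le[OF l'(1) xX] c0)
    finally show ?thesis unfolding p by (simp add: \<omega>_def)
  qed
  then show ?thesis by (intro that[of \<omega>] \<omega>) blast
qed

text \<open>Two norms meet here. Bijectivity of \<open>lam - A\<close> is taken from the norm of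
  \<open>Q (l t)\<close>, where every nonnegative shift is admissible; this is why
  \<open>\<omega>\<close> is kept nonnegative. The resolvent bound is taken from the norm of
  \<open>Q 0\<close>.\<close>

lemma stable_if_quasi_dissipative:
  assumes l: "\<And>t. t \<in> {0..\<tau>} \<Longrightarrow> l t \<in> {a<..<b}" and \<omega>: "0 \<le> \<omega>"
    and q: "\<And>t x. t \<in> {0..\<tau>} \<Longrightarrow> x \<in> Dom (l t) \<Longrightarrow> inner_Q a b (Q 0) (Gen (l t) x) x \<le> \<omega> * inner_Q a b (Q 0) x x"
  shows "stable_family X (norm_Q a b (Q 0)) \<tau> (\<lambda>t. Dom (l t)) (\<lambda>t. Gen (l t))"
proof (rule stable_family_dissipative[where \<omega> = \<omega>])
  show "subspace X" by (rule subspace_L2_interval)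
  show "norm_Q a b (Q 0) 0 = 0"
    using bounded_bilinear.zero_left[OF inner_Q_bilinear[OF Q_diag_mult[OF zero_mem] Q_supp[OF zero_mem]]]
    by (simp add: norm_Q_def)
  fix t assume t: "t \<in> {0..\<tau>}"
  note lt = l[OF t]
  show "infinitesimal_generator X (norm_Q a b (Q 0)) (Dom (l t)) (Gen (l t))" by (rule generator[OF lt])
  show "subspace (Dom (l t))" by (rule subspace_dom[OF lt])
  show "Dom (l t) \<subseteq> X" by (rule dom_sub)
  show "Gen (l t) (x + y) = Gen (l t) x + Gen (l t) y" if "x \<in> Dom (l t)" "y \<in> Dom (l t)" for x y
    by (rule pH_dom_add(2)[OF lt that])
  show "Gen (l t) (c *\<^sub>R x) = c *\<^sub>R Gen (l t) x" if "x \<in> Dom (l t)" for x c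
    by (rule pH_dom_scale(2)[OF lt that])
  fix lam assume lam: "\<omega> < lam"
  show "bij_betw (\<lambda>x. lam *\<^sub>R x - Gen (l t) x) (Dom (l t)) X"
  proof -
    obtain K where K: "hilbert_dissipative X (inner_Q a b (Q (l t))) (m / 2) (Dom (l t)) (Gen (l t)) K"
      by (rule hilbert[OF lt])
    show ?thesis by (rule hilbert_dissipative.shift_bij[OF K]) (use lam \<omega> in simp)
  qed
  show "(lam - \<omega>) * norm_Q a b (Q 0) x \<le> norm_Q a b (Q 0) (lam *\<^sub>R x - Gen (l t) x)" if x: "x \<in> Dom (l t)" for x
    by (rule quasi_dissipative_norm[OF lt x q[OF t x]])
qed

end

theorem corollary5p26:
  fixes a b m M \<tau> r k :: real
    and Qm Qp :: "real \<Rightarrow> real^2^2"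
    and l :: "real \<Rightarrow> real"
    and W_B :: "real^4^2"
  assumes ab: "a < 0" "0 < b"
    and mM: "0 < m" "m \<le> M"
    and Q_sym: "\<forall>z\<in>{a..b}. transpose (Qm z) = Qm z \<and> transpose (Qp z) = Qp z"
    and Qm_bounds: "\<forall>z\<in>{a..b}. \<forall>v. m * (v \<bullet> v) \<le> v \<bullet> (Qm z *v v) \<and> v \<bullet> (Qm z *v v) \<le> M * (v \<bullet> v)"
    and Qp_bounds: "\<forall>z\<in>{a..b}. \<forall>v. m * (v \<bullet> v) \<le> v \<bullet> (Qp z *v v) \<and> v \<bullet> (Qp z *v v) \<le> M * (v \<bullet> v)"
    and tau: "0 < \<tau>"
    and l_range: "\<forall>t\<in>{0..\<tau>}. l t \<in> {a<..<b}"
    and l_C1: "C1_on {0..\<tau>} l"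
    and Q_C1: "C1_on {a..b} Qm" "C1_on {a..b} Qp"
    and Q_diag: "\<forall>z\<in>{a..b}. Qm z $ 1 $ 2 = 0 \<and> Qm z $ 2 $ 1 = 0 \<and> Qp z $ 1 $ 2 = 0 \<and> Qp z $ 2 $ 1 = 0"
    and Q_ratio_0: "Qp 0 $ 1 $ 1 / Qm 0 $ 1 $ 1 = 1"
    and Q_ratio: "\<forall>z\<in>{a..b}. Qp z $ 1 $ 1 / Qm z $ 1 $ 1 = Qp z $ 2 $ 2 / Qm z $ 2 $ 2"
    and r_pos: "r > 0"
    and W_rank: "rank W_B = 2"
    and W_pos: "pos_def (W_B ** Sigma_mat ** transpose W_B)"
    and k_pos: "k > 0"
    and k_dissip: "\<forall>x\<in>pH_dom a b Qm Qp r W_B 0.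
       inner_Q a b (Q_at a b Qm Qp 0) (pH_op a b Qm Qp 0 x) x
         \<le> - k * ((norm (trace_at a 0 (rep_L2 (mult_op (Q_at a b Qm Qp 0) x)) a))\<^sup>2
                + (norm (trace_at 0 b (rep_L2 (mult_op (Q_at a b Qm Qp 0) x)) b))\<^sup>2)"
    and cond_i: "\<exists>w>0. \<forall>t\<in>{0..\<tau>}. a < l t \<and> l t < 0 \<longrightarrow>
       (\<forall>x\<in>pH_dom a b Qm Qp r W_B (l t).
          - k * ((norm (trace_at a (l t) (\<lambda>z. Qm z *v rep_L2 x z) a))\<^sup>2
               + (norm (trace_at (l t) b (\<lambda>z. Qp z *v rep_L2 x z) b))\<^sup>2)
          + r / 4 * ((eta Qm Qp (l t) - 1) * (norm (Qm (l t) *v trace_at a (l t) (rep_L2 x) (l t)))\<^sup>2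
                   + (1 - eta Qm Qp (l t)) * (norm (Qp (l t) *v trace_at (l t) b (rep_L2 x) (l t)))\<^sup>2)
          \<le> w * (norm (mult_op (Q_at a b Qm Qp (l t)) x))\<^sup>2)"
    and cond_ii: "\<exists>w>0. \<forall>t\<in>{0..\<tau>}. 0 < l t \<and> l t < b \<longrightarrow>
       (\<forall>x\<in>pH_dom a b Qm Qp r W_B (l t).
          - k * ((norm (trace_at a (l t) (\<lambda>z. Qm z *v rep_L2 x z) a))\<^sup>2
               + (norm (trace_at (l t) b (\<lambda>z. Qp z *v rep_L2 x z) b))\<^sup>2)
          + r / 4 * ((1 - eta Qp Qm (l t)) * (norm (Qm (l t) *v trace_at a (l t) (rep_L2 x) (l t)))\<^sup>2
                   + (eta Qp Qm (l t) - 1) * (norm (Qp (l t) *v trace_at (l t) b (rep_L2 x) (l t)))\<^sup>2)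
          \<le> w * (norm (mult_op (Q_at a b Qm Qp (l t)) x))\<^sup>2)"
  shows "stable_family (L2_interval a b) (norm_Q a b (Q_at a b Qm Qp 0)) \<tau>
           (\<lambda>t. pH_dom a b Qm Qp r W_B (l t)) (\<lambda>t. pH_op a b Qm Qp (l t))"
proof -
  interpret moving_interface_system a b m M r Qm Qp W_B k
  proof
    show "a < 0" "0 < b" "0 < m" "C1_on {a..b} Qm" "C1_on {a..b} Qp" "0 < r" "0 < k" "Qp 0 $ 1 $ 1 / Qm 0 $ 1 $ 1 = 1"
      by fact+
  qed (use Qm_bounds Qp_bounds Q_diag Q_ratio k_dissip in blast)+
  have stable: "stable_family X (norm_Q a b (Q 0)) \<tau> (\<lambda>t. Dom (l t)) (\<lambda>t. Gen (l t))"
    if "0 \<le> \<omega>" "\<forall>t\<in>{0..\<tau>}. \<forall>x\<in>Dom (l t). inner_Q a b (Q 0) (Gen (l t) x) x \<le> \<omega> * inner_Q a b (Q 0) x x" for \<omega>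
    by (rule stable_if_quasi_dissipative[OF _ that(1)]) (use l_range that(2) in auto)
  show ?thesis
    using cond_i cond_ii
    by (elim exE conjE) (rule quasi_dissipative[OF less_imp_le less_imp_le l_range]; (rule stable)?; assumption)
qed

end
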